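(* There exists $\ell_0$ such that for every integer $\ell \ge \ell_0$ with $\ell \equiv 1$ or $2 \pmod 3$, the $3$-uniform tight cycle $\mathcal{C}_\ell^3$ on $\ell$ vertices satisfies $\pi(\mathcal{C}_\ell^3) = 2\sqrt{3} - 3$.
   Context: For $\ell\ge 4$, the $3$-uniform tight cycle $\mathcal{C}_\ell^3$ is the $3$-uniform hypergraph with vertex set $\{1,\dots,\ell\}$ whose edges are all the sets $\{x, x+1, x+2\}$, $x \in \{1,\dots,\ell\}$, with elements taken modulo $\ell$. For a $3$-uniform hypergraph $\mathcal{H}$, $\mathrm{ex}(n,\mathcal{H})$ is the maximum number of edges of an $n$-vertex $3$-uniform hypergraph containing no copy of $\mathcal{H}$ as a (not necessarily induced) subhypergraph, and the Turán density is $\pi(\mathcal{H}) = \lim_{n\to\infty} \mathrm{ex}(n,\mathcal{H})/\binom{n}{3}$ (this limit always exists). *)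

theory Defs
  imports Complex_Main
begin

text \<open>A hypergraph is a pair of a vertex set and an edge set.\<close>

type_synonym 'a hypergraph = "'a set \<times> 'a set set"

definition three_graph :: "'a hypergraph \<Rightarrow> bool" where
  "three_graph H \<longleftrightarrow> finite (fst H) \<and> (\<forall>e\<in>snd H. e \<subseteq> fst H \<and> card e = 3)"

definition contains_copy :: "'b hypergraph \<Rightarrow> 'a hypergraph \<Rightarrow> bool" where
  "contains_copy G H \<longleftrightarrow>
     (\<exists>f. inj_on f (fst H) \<and> f ` fst H \<subseteq> fst G \<and> (\<forall>e\<in>snd H. f ` e \<in> snd G))"

text \<open>
  Every finite hypergraph is isomorphic to one whose vertices are natural numbers, so
  restricting the host hypergraphs to vertices of type \<^typ>\<open>nat\<close> loses nothing. The maximum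
  is over a finite set, which is nonempty whenever \<open>H\<close> has an edge.
\<close>

definition turan_number :: "nat \<Rightarrow> 'a hypergraph \<Rightarrow> nat" where
  "turan_number n H =
     Max {card (snd G) | G :: nat hypergraph.
            three_graph G \<and> card (fst G) = n \<and> \<not> contains_copy G H}"

text \<open>The limit exists whenever \<open>H\<close> has an edge; see \<open>turan_density_tendsto\<close> below.\<close>

definition turan_density :: "'a hypergraph \<Rightarrow> real" where
  "turan_density H = lim (\<lambda>n. real (turan_number n H) / real (n choose 3))"

text \<open>
  The representative of \<open>y\<close> modulo \<open>l\<close> in \<open>{1..l}\<close> is \<open>(y - 1) mod l + 1\<close>; below it is
  taken for \<open>y = x + 1\<close> and \<open>y = x + 2\<close>.
\<close>

definition tight_cycle :: "nat \<Rightarrow> nat hypergraph" where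
  "tight_cycle l =
     ({1..l}, {{x, x mod l + 1, (x + 1) mod l + 1} | x. x \<in> {1..l}})"

lemma three_graph_tight_cycle:
  assumes "l \<ge> 4"
  shows "three_graph (tight_cycle l)"
proof -
  have "{x, x mod l + 1, (x + 1) mod l + 1} \<subseteq> {1..l} \<and>
        card {x, x mod l + 1, (x + 1) mod l + 1} = 3" if x: "x \<in> {1..l}" for x
  proof -
    consider "x + 1 < l" | "x + 1 = l" | "x = l" using x by fastforce
    then show ?thesis
    proof cases
      case 1
      then have "x mod l = x" "(x + 1) mod l = x + 1" by simp_all
      then have "{x, x mod l + 1, (x + 1) mod l + 1} = {x, x + 1, x + 2}" by simp
      then show ?thesis using 1 x by simp
    next
      case 2
      then have "x mod l = x" "(x + 1) mod l = 0" by simp_all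
      then have "{x, x mod l + 1, (x + 1) mod l + 1} = {x, x + 1, 1}" by simp
      then show ?thesis using assms 2 x by simp
    next
      case 3
      have "(1 + l) mod l = 1" using assms by (simp only: mod_add_self2) simp
      with 3 have "x mod l = 0" "(x + 1) mod l = 1" by simp_all
      then have "{x, x mod l + 1, (x + 1) mod l + 1} = {l, 1, 2}"
        using 3 by (simp add: numeral_2_eq_2)
      then show ?thesis using assms by simp
    qed
  qed
  then show ?thesis
    unfolding three_graph_def tight_cycle_def fst_conv snd_conv
    using finite_atLeastAtMost by blast
qed

lemma edges_tight_cycle_nonempty: "l \<ge> 1 \<Longrightarrow> snd (tight_cycle l) \<noteq> {}"
  unfolding tight_cycle_def by auto

lemma card_edges_le:
  assumes "three_graph G"
  shows "card (snd G) \<le> card (fst G) choose 3"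
proof -
  have "snd G \<subseteq> {e. e \<subseteq> fst G \<and> card e = 3}"
    using assms by (auto simp: three_graph_def)
  moreover have "finite {e. e \<subseteq> fst G \<and> card e = 3}"
    using assms by (simp add: three_graph_def)
  ultimately have "card (snd G) \<le> card {e. e \<subseteq> fst G \<and> card e = 3}"
    by (rule card_mono[rotated])
  then show ?thesis using assms by (simp add: three_graph_def n_subsets)
qed

lemma finite_edges: "three_graph G \<Longrightarrow> finite (snd G)"
  by (rule finite_subset[of _ "Pow (fst G)"]) (auto simp: three_graph_def)

lemma finite_turan_set:
  "finite {card (snd G) | G :: nat hypergraph.
            three_graph G \<and> card (fst G) = n \<and> \<not> contains_copy G H}"
  by (rule finite_subset[of _ "{..n choose 3}"]) (auto dest: card_edges_le)

lemma turan_number_upper: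
  fixes G :: "nat hypergraph"
  assumes "three_graph G" "card (fst G) = n" "\<not> contains_copy G H"
  shows "card (snd G) \<le> turan_number n H"
  unfolding turan_number_def
  by (intro Max_ge finite_turan_set CollectI exI[of _ G] conjI refl assms)

lemma turan_number_attained:
  assumes "snd H \<noteq> {}"
  obtains G :: "nat hypergraph" where "three_graph G" "card (fst G) = n"
    "\<not> contains_copy G H" "card (snd G) = turan_number n H"
proof -
  have "three_graph ({..<n}, {})" "\<not> contains_copy ({..<n}, {}) H"
    using assms by (auto simp: three_graph_def contains_copy_def)
  then have "{card (snd G) | G :: nat hypergraph.
               three_graph G \<and> card (fst G) = n \<and> \<not> contains_copy G H} \<noteq> {}"
    using card_lessThan by fastforce
  from Max_in[OF finite_turan_set this] show ?thesis
    using that unfolding turan_number_def[symmetric] by auto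
qed

lemma turan_number_Suc_le:
  assumes "snd H \<noteq> {}" and n: "n \<ge> 3"
  shows "(n - 2) * turan_number (Suc n) H \<le> Suc n * turan_number n H"
proof -
  obtain G :: "nat hypergraph" where G: "three_graph G" "card (fst G) = Suc n"
    "\<not> contains_copy G H" "card (snd G) = turan_number (Suc n) H"
    using turan_number_attained[OF assms(1)] by blast
  obtain V E where VE: "G = (V, E)" by (cases G)
  have fin: "finite V" "finite E" and cV: "card V = Suc n"
    using G finite_edges[OF G(1)] by (auto simp: VE three_graph_def)
  have "(n - 2) * card E = (\<Sum>e\<in>E. card {v\<in>V. v \<notin> e})"
  proof -
    have "card {v\<in>V. v \<notin> e} = n - 2" if "e \<in> E" for e
    proof -
      have "e \<subseteq> V" "card e = 3" using G(1) that by (auto simp: three_graph_def VE)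
      moreover have "{v\<in>V. v \<notin> e} = V - e" by auto
      ultimately show ?thesis
        using cV fin by (simp add: card_Diff_subset finite_subset)
    qed
    then show ?thesis by simp
  qed
  also have "\<dots> = (\<Sum>v\<in>V. card {e\<in>E. v \<notin> e})"
    using fin by (intro sum_multicount_gen[symmetric]) auto
  also have "\<dots> \<le> (\<Sum>v\<in>V. turan_number n H)"
  proof (rule sum_mono)
    fix v assume v: "v \<in> V"
    let ?G = "(V - {v}, {e\<in>E. v \<notin> e})"
    have "three_graph ?G" using G(1) by (auto simp: three_graph_def VE)
    moreover have "card (fst ?G) = n" using v cV fin by simp
    moreover have "\<not> contains_copy ?G H"
      using G(3) unfolding contains_copy_def VE by fastforce
    ultimately show "card {e\<in>E. v \<notin> e} \<le> turan_number n H"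
      using turan_number_upper[of ?G n H] by simp
  qed
  finally show ?thesis using G(4) cV by (simp add: VE)
qed

lemma turan_density_tendsto:
  assumes "snd H \<noteq> {}"
  shows "(\<lambda>n. real (turan_number n H) / real (n choose 3)) \<longlonglongrightarrow> turan_density H"
proof -
  let ?r = "\<lambda>n. real (turan_number n H) / real (n choose 3)"
  have step: "?r (Suc n) \<le> ?r n" if n: "n \<ge> 3" for n
  proof -
    let ?a = "turan_number (Suc n) H" and ?b = "turan_number n H"
    let ?c = "Suc n choose 3" and ?d = "n choose 3"
    have pos: "?c > 0" "?d > 0" "n - 2 > 0" using n by auto
    have "(n - 2) * ?c = Suc n * ?d"
      using binomial_absorb_comp[of "Suc n" 3] by (simp add: numeral_3_eq_3 numeral_2_eq_2)
    then have *: "Suc n * ?b * ?d = (n - 2) * (?b * ?c)"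
      by (metis mult.assoc mult.commute)
    have "(n - 2) * (?a * ?d) \<le> Suc n * ?b * ?d"
      using mult_right_mono[OF turan_number_Suc_le[OF assms n], of ?d] by (simp add: ac_simps)
    then have "?a * ?d \<le> ?b * ?c" using pos(3) unfolding * by simp
    then have "real ?a * real ?d \<le> real ?b * real ?c"
      by (metis of_nat_le_iff of_nat_mult)
    then show ?thesis using pos by (simp add: divide_simps mult.commute)
  qed
  have "decseq (\<lambda>n. ?r (n + 3))"
  proof (rule decseq_SucI)
    show "?r (Suc n + 3) \<le> ?r (n + 3)" for n using step[of "n + 3"] by simp
  qed
  then obtain L where "(\<lambda>n. ?r (n + 3)) \<longlonglongrightarrow> L"
    using decseq_convergent[of "\<lambda>n. ?r (n + 3)" 0] by auto
  then have "?r \<longlonglongrightarrow> L" by (rule LIMSEQ_offset)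
  then show ?thesis unfolding turan_density_def by (simp add: limI)
qed

end

theory Submission
  imports Defs
begin

text \<open>
  Call a closed tight walk bad if its length is not divisible by 3. A bad closed walk of length at
  most \<open>L\<close> gives a homomorphism from the tight cycle \<open>C\<^sub>l\<close> for every \<open>l \<ge> 2 * L\<close> not divisible
  by 3, so by sampling and Erdos' theorem on complete partite subsystems it suffices to show that a
  3-graph without bad closed walks of length at most some absolute \<open>L\<close> has at most
  \<open>(2 * sqrt 3 - 3) * n ^ 3\<close> ordered edges.

  A minimal counterexample has large minimum degree. Deleting few edges makes all shadow pairs have
  positive codegree; then tight components have bounded diameter, and the walk length modulo 3 is a
  potential on ordered pairs. Comparing the potentials of \<open>(a, b)\<close> and \<open>(b, a)\<close> colours each pair
  blue or directed red, so that every edge is a star: two red arcs leaving an apex towards a blue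
  pair. The minimum degree forces the out-degree of a vertex to be either tiny or large; counting
  stars with respect to this partition \<open>(A, B)\<close> shows that nearly all triples with two vertices in
  \<open>A\<close> and one in \<open>B\<close> are edges. Walking inside this structure labels almost all pairs of the original
  3-graph, and the same dichotomy now holds for every vertex. In the resulting partition the edges of
  types \<open>AAA\<close> and \<open>ABB\<close> are outnumbered by the missing ones of type \<open>AAB\<close>, so that
  \<open>e(V) \<le> 3 * a\<^sup>2 * b + e(B)\<close>, which contradicts minimality. The recursion
  \<open>d = 3 * a\<^sup>2 * b + d * b ^ 3\<close> is also what the iterated construction achieves.
\<close>

section \<open>Triple systems, tight walks and weighted averages\<close>

text \<open>The value \<open>2 * sqrt 3 - 3\<close> is the maximum of
  \<open>3 * a\<^sup>2 * b / (1 - b ^ 3)\<close> over \<open>a + b = 1\<close> with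
  \<open>a > 0\<close>. Two systems must be kept apart. Only a cleaned subsystem \<open>G\<close>
  has tight components of bounded diameter and hence a colouring, but minimality and minimum degree
  belong to \<open>H\<close>, and the edges lost in cleaning forbid an exact comparison through
  \<open>G\<close>. So \<open>G\<close> serves only to find a rough partition; labels are then
  defined by short walks in \<open>H\<close> itself, and a second partition is read off from them
  that leaves no vertex of \<open>H\<close> exceptional. The additive constant makes a least
  counterexample so large that deleting one vertex yields the minimum degree. It appears as
  \<open>\<gamma>\<close> both in the assumed excess and in the bound for proper parts, so it
  cancels when the bound for the part \<open>B\<close> is inserted; a blow-up removes it in the
  end.\<close>

definition tri :: "'a set \<Rightarrow> ('a \<Rightarrow> 'a \<Rightarrow> 'a \<Rightarrow> bool) \<Rightarrow> bool" where
  "tri V T \<longleftrightarrow> (\<forall>a b c. T a b c \<longrightarrow> T b a c \<and> T a c b \<and> a \<noteq> b \<and> a \<in> V)"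

lemma triD:
  assumes "tri V T" "T a b c"
  shows "T a c b" "T b a c" "T b c a" "T c a b" "T c b a"
    "a \<noteq> b" "b \<noteq> c" "a \<noteq> c" "a \<in> V" "b \<in> V" "c \<in> V"
proof -
  have *: "\<And>a b c. T a b c \<Longrightarrow> T b a c \<and> T a c b \<and> a \<noteq> b \<and> a \<in> V"
    using assms(1) unfolding tri_def by blast
  show 1: "T a c b" and 2: "T b a c" and "a \<noteq> b" "a \<in> V" using *[OF assms(2)] by auto
  show 3: "T b c a" and "b \<in> V" using *[OF 2] by auto
  show 4: "T c a b" and "a \<noteq> c" using *[OF 1] by auto
  show 5: "T c b a" and "b \<noteq> c" using *[OF 3] by auto
  show "c \<in> V" using *[OF 4] by auto
qed

text \<open>A tight walk is a walk on ordered pairs of consecutive vertices: how it may continue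
  depends only on its last two vertices, and relational powers count its edges.\<close>

definition step :: "('a \<Rightarrow> 'a \<Rightarrow> 'a \<Rightarrow> bool) \<Rightarrow> (('a \<times> 'a) \<times> ('a \<times> 'a)) set" where
  "step T = {((a, b), (b, c)) | a b c. T a b c}"

lemma step_iff [simp]: "((a, b), (b', c)) \<in> step T \<longleftrightarrow> b' = b \<and> T a b c"
  unfolding step_def by auto

lemma step_mono: "(\<And>a b c. S a b c \<Longrightarrow> T a b c) \<Longrightarrow> step S \<subseteq> step T"
  unfolding step_def by blast

definition walk_free :: "nat \<Rightarrow> ('a \<Rightarrow> 'a \<Rightarrow> 'a \<Rightarrow> bool) \<Rightarrow> bool" where
  "walk_free L T \<longleftrightarrow> (\<forall>n p. n \<le> L \<and> (p, p) \<in> step T ^^ n \<longrightarrow> 3 dvd n)"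

lemma relpow_trans: "(p, q) \<in> R ^^ m \<Longrightarrow> (q, r) \<in> R ^^ n \<Longrightarrow> (p, r) \<in> R ^^ (m + n)"
  unfolding relpow_add by blast

lemma relpow_mono_rel: "(R :: 'a rel) \<subseteq> S \<Longrightarrow> R ^^ n \<subseteq> S ^^ n"
proof (induction n)
  case (Suc n)
  then show ?case by (simp add: relcomp_mono)
qed simp

lemma walk_free_mono:
  assumes "walk_free L T" "\<And>a b c. S a b c \<Longrightarrow> T a b c"
  shows "walk_free L S"
  using assms relpow_mono_rel[OF step_mono[of S T]] unfolding walk_free_def by blast

text \<open>Going on around the edge, (b, c) to (c, a) to (a, b), undoes a step. Reversing a walk of
  length n thus costs 2 * n, which is -n modulo 3.\<close>

lemma step_back:
  assumes "tri V T" "(p, q) \<in> step T"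
  shows "(q, p) \<in> step T ^^ 2"
proof -
  obtain a b c where "p = (a, b)" "q = (b, c)" and T: "T a b c"
    using assms(2) unfolding step_def by blast
  moreover have "((b, c), (c, a)) \<in> step T" "((c, a), (a, b)) \<in> step T"
    using triD[OF assms(1) T] by auto
  ultimately show ?thesis by (simp add: numeral_2_eq_2 relcomp.relcompI del: step_iff)
qed

lemma walk_back:
  assumes "tri V T" "(p, q) \<in> step T ^^ n"
  shows "(q, p) \<in> step T ^^ (2 * n)"
  using assms(2)
proof (induction n arbitrary: q)
  case (Suc n)
  then obtain r where "(p, r) \<in> step T ^^ n" and r: "(r, q) \<in> step T" by auto
  from Suc.IH[OF this(1)] relpow_trans[OF step_back[OF assms(1) r]] show ?case
    by (simp add: mult.commute)
qed auto

text \<open>The first walk followed by the reversed second one is closed of length m + 2 * n,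
  congruent to m - n modulo 3.\<close>

lemma walk_residue_unique:
  assumes "tri V T" "walk_free L T" "(p, q) \<in> step T ^^ m" "(p, q) \<in> step T ^^ n" "m + 2 * n \<le> L"
  shows "m mod 3 = n mod 3"
proof -
  have "(p, p) \<in> step T ^^ (m + 2 * n)"
    using relpow_trans[OF assms(3) walk_back[OF assms(1,4)]] .
  then have "3 dvd m + 2 * n" using assms(2,5) unfolding walk_free_def by blast
  then show ?thesis by presburger
qed

section \<open>Averages and densities over a finite weighted vertex set\<close>

locale weighted =
  fixes V :: "'a set" and w :: "'a \<Rightarrow> real"
  assumes fin: "finite V" and wpos: "\<And>v. v \<in> V \<Longrightarrow> 0 < w v" and wsum: "sum w V = 1"
begin

definition av :: "('a \<Rightarrow> real) \<Rightarrow> real" where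
  "av f = (\<Sum>v\<in>V. w v * f v)"

abbreviation ms :: "'a set \<Rightarrow> real" where
  "ms S \<equiv> av (\<lambda>v. of_bool (v \<in> S))"

lemma av_mono: "(\<And>v. v \<in> V \<Longrightarrow> f v \<le> g v) \<Longrightarrow> av f \<le> av g"
  unfolding av_def by (intro sum_mono mult_left_mono) (auto simp: less_imp_le wpos)

lemma av_cong: "(\<And>v. v \<in> V \<Longrightarrow> f v = g v) \<Longrightarrow> av f = av g"
  unfolding av_def by (intro sum.cong) auto

lemma av_add: "av (\<lambda>v. f v + g v) = av f + av g"
  unfolding av_def by (simp add: distrib_left sum.distrib)

lemma av_diff: "av (\<lambda>v. f v - g v) = av f - av g"
  unfolding av_def by (simp add: right_diff_distrib sum_subtractf)

lemma av_cmult: "av (\<lambda>v. c * f v) = c * av f"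
  unfolding av_def by (simp add: sum_distrib_left mult.left_commute)

lemma av_multc: "av (\<lambda>v. f v * c) = av f * c"
  unfolding av_def by (simp add: sum_distrib_right mult.assoc)

lemma av_const: "av (\<lambda>v. c) = c"
  unfolding av_def by (simp add: wsum flip: sum_distrib_right)

lemmas av_simps = av_add av_diff av_cmult av_multc av_const

lemma av_swap: "av (\<lambda>a. av (\<lambda>b. f a b)) = av (\<lambda>b. av (\<lambda>a. f a b))"
  unfolding av_def sum_distrib_left by (subst sum.swap) (simp add: mult.left_commute)

lemma av_nonneg: "(\<And>v. v \<in> V \<Longrightarrow> 0 \<le> f v) \<Longrightarrow> 0 \<le> av f"
  using av_mono[of "\<lambda>_. 0" f] by (simp add: av_const)

lemma av_le_const: "(\<And>v. v \<in> V \<Longrightarrow> f v \<le> c) \<Longrightarrow> av f \<le> c"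
  using av_mono[of f "\<lambda>_. c"] by (simp add: av_const)

lemma av_at: "u \<in> V \<Longrightarrow> av (\<lambda>v. of_bool (v = u) * f v) = w u * f u"
proof -
  assume u: "u \<in> V"
  have "av (\<lambda>v. of_bool (v = u) * f v) = (\<Sum>v\<in>V. if v = u then w v * f v else 0)"
    unfolding av_def by (intro sum.cong) auto
  with u fin show ?thesis by (simp add: sum.delta)
qed

lemma ms_nonneg: "0 \<le> ms S" by (rule av_nonneg) simp

lemma ms_mono: "(\<And>v. v \<in> V \<Longrightarrow> v \<in> S \<Longrightarrow> v \<in> S') \<Longrightarrow> ms S \<le> ms S'"
  by (rule av_mono) auto

lemma av_bound_indicator:
  assumes "\<And>v. v \<in> V \<Longrightarrow> v \<in> S \<Longrightarrow> f v \<le> c"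
  shows "av (\<lambda>v. of_bool (v \<in> S) * f v) \<le> ms S * c"
  unfolding av_multc[symmetric] by (rule av_mono) (use assms in auto)

lemma av_bound_indicator_ge:
  assumes "\<And>v. v \<in> V \<Longrightarrow> v \<in> S \<Longrightarrow> c \<le> f v"
  shows "ms S * c \<le> av (\<lambda>v. of_bool (v \<in> S) * f v)"
  unfolding av_multc[symmetric] by (rule av_mono) (use assms in auto)

text \<open>Ordered triples are counted, so an edge contributes six times and the density of a
  complete system tends to 1 as the weights become small.\<close>

definition edens :: "('a \<Rightarrow> 'a \<Rightarrow> 'a \<Rightarrow> bool) \<Rightarrow> real" where
  "edens T = av (\<lambda>a. av (\<lambda>b. av (\<lambda>c. of_bool (T a b c))))"

definition deg :: "('a \<Rightarrow> 'a \<Rightarrow> 'a \<Rightarrow> bool) \<Rightarrow> 'a \<Rightarrow> real" where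
  "deg T a = av (\<lambda>b. av (\<lambda>c. of_bool (T a b c)))"

definition codeg :: "('a \<Rightarrow> 'a \<Rightarrow> 'a \<Rightarrow> bool) \<Rightarrow> 'a \<Rightarrow> 'a \<Rightarrow> real" where
  "codeg T a b = av (\<lambda>c. of_bool (T a b c))"

lemma av2_mono:
  "(\<And>a b. a \<in> V \<Longrightarrow> b \<in> V \<Longrightarrow> f a b \<le> g a b) \<Longrightarrow>
   av (\<lambda>a. av (f a)) \<le> av (\<lambda>a. av (g a))"
  by (intro av_mono) auto

lemma av3_mono:
  "(\<And>a b c. a \<in> V \<Longrightarrow> b \<in> V \<Longrightarrow> c \<in> V \<Longrightarrow> f a b c \<le> g a b c) \<Longrightarrow>
   av (\<lambda>a. av (\<lambda>b. av (f a b))) \<le> av (\<lambda>a. av (\<lambda>b. av (g a b)))"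
  by (intro av_mono) auto

text \<open>
  Maximising the edge density minus \<open>\<epsilon>\<close> times the density of the set of admitted
  pairs makes every remaining shadow pair have large codegree.
\<close>

lemma clean_subgraph:
  assumes H: "tri V H" and eps: "0 < (\<epsilon>::real)"
  obtains G where "tri V G" "\<And>a b c. G a b c \<Longrightarrow> H a b c" "edens G \<ge> edens H - \<epsilon>"
    "\<And>a b c. G a b c \<Longrightarrow> codeg G a b \<ge> \<epsilon> / 3"
proof -
  define GP where "GP = (\<lambda>P a b c. H a b c \<and> (a, b) \<in> P \<and> (b, c) \<in> P \<and> (a, c) \<in> P)"
  define pd where "pd = (\<lambda>P. av (\<lambda>a. av (\<lambda>b. of_bool ((a, b) \<in> P))))"
  define \<Phi> where "\<Phi> = (\<lambda>P. edens (GP P) - \<epsilon> * pd P)"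
  define \<P> where "\<P> = {P. P \<subseteq> V \<times> V \<and> sym P}"
  have finP: "finite \<P>" unfolding \<P>_def using fin by auto
  have VV: "V \<times> V \<in> \<P>" unfolding \<P>_def sym_def by auto
  obtain P where P: "P \<in> \<P>" and max: "\<And>Q. Q \<in> \<P> \<Longrightarrow> \<Phi> Q \<le> \<Phi> P"
  proof -
    have "Max (\<Phi> ` \<P>) \<in> \<Phi> ` \<P>" using finP VV by (intro Max_in) auto
    then obtain P where "P \<in> \<P>" "\<Phi> P = Max (\<Phi> ` \<P>)" by auto
    with that show ?thesis using finP by simp
  qed
  have symP: "(a, b) \<in> P \<Longrightarrow> (b, a) \<in> P" for a b using P unfolding \<P>_def sym_def by blast
  have tG: "tri V (GP P)"
    unfolding tri_def
  proof (intro allI impI)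
    fix a b c assume g: "GP P a b c"
    then have "H a b c" and p: "(a, b) \<in> P" "(b, c) \<in> P" "(a, c) \<in> P" by (simp_all add: GP_def)
    with triD[OF H this(1)] symP[OF p(1)] symP[OF p(2)]
    show "GP P b a c \<and> GP P a c b \<and> a \<noteq> b \<and> a \<in> V" by (simp add: GP_def)
  qed
  have GVV: "GP (V \<times> V) = H"
    unfolding GP_def using triD(9-11)[OF H] by (intro ext) blast
  have pd1: "pd (V \<times> V) \<le> 1" unfolding pd_def by (intro av_le_const) auto
  have pd0: "0 \<le> pd P" unfolding pd_def by (intro av_nonneg) auto
  have "edens H - \<epsilon> * pd (V \<times> V) \<le> edens (GP P) - \<epsilon> * pd P"
    using max[OF VV] by (simp add: \<Phi>_def GVV)
  then have dens: "edens (GP P) \<ge> edens H - \<epsilon>"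
    using mult_left_mono[OF pd1, of \<epsilon>] mult_nonneg_nonneg[OF _ pd0, of \<epsilon>] eps by linarith
  have cod: "codeg (GP P) u v \<ge> \<epsilon> / 3" if uvc: "GP P u v c0" for u v c0
  proof -
    note D = triD[OF tG uvc]
    have uv: "u \<noteq> v" "u \<in> V" "v \<in> V" using D by auto
    have uvP: "(u, v) \<in> P" "(v, u) \<in> P" using uvc symP by (auto simp: GP_def)
    \<comment> \<open>Deleting the pair in both orders lowers the penalty by 2 * \<epsilon> * w u *
      w v. A lost triple contains u and v in one of six ordered pairs of positions, so at most 6 * w
      u * w v times the codegree is lost.\<close>
    define Q where "Q = P - {(u, v), (v, u)}"
    have "Q \<in> \<P>" using P unfolding Q_def \<P>_def sym_def by auto
    then have le: "\<Phi> Q \<le> \<Phi> P" by (rule max)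
    have pdQ: "pd Q = pd P - 2 * (w u * w v)"
    proof -
      have "pd Q = av (\<lambda>a. av (\<lambda>b. of_bool ((a, b) \<in> P) - of_bool (a = u) * (of_bool (b = v) * 1)
                      - of_bool (a = v) * (of_bool (b = u) * 1)))"
        unfolding pd_def by (intro av_cong) (use uvP uv in \<open>auto simp: Q_def\<close>)
      also have "\<dots> = pd P - 2 * (w u * w v)"
        unfolding pd_def av_diff av_cmult av_at[OF uv(2)] av_at[OF uv(3)] by simp
      finally show ?thesis .
    qed
    define g where "g = (\<lambda>c. of_bool (GP P u v c) :: real)"
    have pt: "of_bool (GP P a b c) \<le> of_bool (GP Q a b c)
        + of_bool (a = u) * (of_bool (b = v) * g c) + of_bool (a = v) * (of_bool (b = u) * g c)
        + of_bool (b = u) * (of_bool (c = v) * g a) + of_bool (b = v) * (of_bool (c = u) * g a)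
        + of_bool (a = u) * (of_bool (c = v) * g b) + of_bool (a = v) * (of_bool (c = u) * g b)" for a b c
    proof (cases "GP P a b c \<and> \<not> GP Q a b c")
      case True
      note D' = triD[OF tG conjunct1[OF True]]
      have g0: "0 \<le> g x" for x by (simp add: g_def)
      note nn = g0[of a] g0[of b] g0[of c]
      have L: "of_bool (GP P a b c) = (1::real)" using True by simp
      from True have "(a = u \<and> b = v) \<or> (a = v \<and> b = u) \<or> (b = u \<and> c = v) \<or> (b = v \<and> c = u)
          \<or> (a = u \<and> c = v) \<or> (a = v \<and> c = u)"
        unfolding GP_def Q_def by blast
      then show ?thesis
      proof (elim disjE conjE)
        assume "a = u" "b = v"
        then have "g c = 1" using True by (simp add: g_def)
        then show ?thesis unfolding L using nn \<open>a = u\<close> \<open>b = v\<close> by simp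
      next
        assume "a = v" "b = u"
        then have "g c = 1" using D' by (simp add: g_def)
        then show ?thesis unfolding L using nn \<open>a = v\<close> \<open>b = u\<close> by simp
      next
        assume "b = u" "c = v"
        then have "g a = 1" using D' by (simp add: g_def)
        then show ?thesis unfolding L using nn \<open>b = u\<close> \<open>c = v\<close> by simp
      next
        assume "b = v" "c = u"
        then have "g a = 1" using D' by (simp add: g_def)
        then show ?thesis unfolding L using nn \<open>b = v\<close> \<open>c = u\<close> by simp
      next
        assume "a = u" "c = v"
        then have "g b = 1" using D' by (simp add: g_def)
        then show ?thesis unfolding L using nn \<open>a = u\<close> \<open>c = v\<close> by simp
      next
        assume "a = v" "c = u"
        then have "g b = 1" using D' by (simp add: g_def)
        then show ?thesis unfolding L using nn \<open>a = v\<close> \<open>c = u\<close> by simp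
      qed
    next
      case False
      have nn: "0 \<le> of_bool X * (of_bool Y * g z)" for X Y z by (simp add: g_def)
      have "of_bool (GP P a b c) \<le> (of_bool (GP Q a b c) :: real)" using False by auto
      then show ?thesis
        using nn[of "a = u" "b = v" c] nn[of "a = v" "b = u" c] nn[of "b = u" "c = v" a]
          nn[of "b = v" "c = u" a] nn[of "a = u" "c = v" b] nn[of "a = v" "c = u" b] by linarith
    qed
    have "edens (GP P) \<le> edens (GP Q) + 6 * (w u * (w v * codeg (GP P) u v))"
    proof -
      have "edens (GP P) \<le> av (\<lambda>a. av (\<lambda>b. av (\<lambda>c. of_bool (GP Q a b c)
        + of_bool (a = u) * (of_bool (b = v) * g c) + of_bool (a = v) * (of_bool (b = u) * g c)
        + of_bool (b = u) * (of_bool (c = v) * g a) + of_bool (b = v) * (of_bool (c = u) * g a)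
        + of_bool (a = u) * (of_bool (c = v) * g b) + of_bool (a = v) * (of_bool (c = u) * g b))))"
        unfolding edens_def by (intro av3_mono pt)
      also have "\<dots> = edens (GP Q) + 6 * (w u * (w v * codeg (GP P) u v))"
        unfolding av_add av_cmult av_at[OF uv(2)] av_at[OF uv(3)]
        by (simp add: edens_def codeg_def g_def av_cmult)
      finally show ?thesis .
    qed
    then have "2 * \<epsilon> * (w u * w v) \<le> 6 * (w u * w v) * codeg (GP P) u v"
      using le unfolding \<Phi>_def pdQ by (simp add: algebra_simps)
    then have "(w u * w v) * \<epsilon> \<le> (w u * w v) * (3 * codeg (GP P) u v)"
      by (simp add: algebra_simps)
    moreover have "0 < w u * w v" using wpos uv by simp
    ultimately have "\<epsilon> \<le> 3 * codeg (GP P) u v" using mult_le_cancel_left_pos by blast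
    then show ?thesis by simp
  qed
  have "H a b c" if "GP P a b c" for a b c using that by (simp add: GP_def)
  from that[OF tG this dens cod] show ?thesis .
qed

end

section \<open>Bounded diameter and star colourings\<close>

text \<open>
  \<open>Bl\<close> is the set of blue pairs and \<open>Rd c a\<close> a red arc from \<open>c\<close> to \<open>a\<close>; the three disjuncts
  are the three choices of the apex.
\<close>

definition star_coloured ::
    "('a \<Rightarrow> 'a \<Rightarrow> 'a \<Rightarrow> bool) \<Rightarrow> ('a \<Rightarrow> 'a \<Rightarrow> bool) \<Rightarrow> ('a \<Rightarrow> 'a \<Rightarrow> bool) \<Rightarrow> bool" where
  "star_coloured G Bl Rd \<longleftrightarrow>
     (\<forall>a b. Bl a b \<longrightarrow> Bl b a) \<and> (\<forall>a b. Rd a b \<longrightarrow> \<not> Rd b a \<and> \<not> Bl a b) \<and>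
     (\<forall>a b c. G a b c \<longrightarrow> (Bl a b \<and> Rd c a \<and> Rd c b) \<or> (Bl b c \<and> Rd a b \<and> Rd a c)
                            \<or> (Bl a c \<and> Rd b a \<and> Rd b c))"

text \<open>Fix one pair in each tight component; the potential of a pair is the length of a walk of
  at most K steps from there. A walk to (a, b) prolonged by one step competes with the walk chosen
  for (b, c), and comparing them takes a closed walk of length at most K + 1 + 2 * K.\<close>

lemma potential_exists:
  assumes G: "tri V G" and free: "walk_free L G" and L: "3 * K + 1 \<le> L"
    and diam: "\<And>p q. (p, q) \<in> (step G)\<^sup>* \<Longrightarrow> \<exists>k\<le>K. (p, q) \<in> step G ^^ k"
  obtains \<phi> :: "'a \<times> 'a \<Rightarrow> nat" where "\<And>a b c. G a b c \<Longrightarrow> \<phi> (b, c) mod 3 = (\<phi> (a, b) + 1) mod 3"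
proof -
  let ?R = "(step G)\<^sup>*"
  have symR: "(q, p) \<in> ?R" if "(p, q) \<in> ?R" for p q
    using that walk_back[OF G] unfolding rtrancl_power by blast
  define rep where "rep = (\<lambda>p. SOME q. (p, q) \<in> ?R)"
  have rep: "(p, rep p) \<in> ?R" for p
    unfolding rep_def by (rule someI[of _ p]) simp
  have rep_eq: "rep p = rep q" if "(p, q) \<in> ?R" for p q
  proof -
    have "(p, r) \<in> ?R \<longleftrightarrow> (q, r) \<in> ?R" for r
      using that symR[OF that] by (meson rtrancl_trans)
    then show ?thesis unfolding rep_def by simp
  qed
  define \<phi> where "\<phi> = (\<lambda>p. SOME k. k \<le> K \<and> (rep p, p) \<in> step G ^^ k)"
  have \<phi>: "\<phi> p \<le> K \<and> (rep p, p) \<in> step G ^^ \<phi> p" for p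
    unfolding \<phi>_def using diam[OF symR[OF rep[of p]]] by (rule someI_ex)
  have "\<phi> (b, c) mod 3 = (\<phi> (a, b) + 1) mod 3" if T: "G a b c" for a b c
  proof -
    have st: "((a, b), (b, c)) \<in> step G" using T by simp
    then have "rep (a, b) = rep (b, c)" by (intro rep_eq) auto
    then have "(rep (b, c), (b, c)) \<in> step G ^^ (\<phi> (a, b) + 1)"
      using relpow_trans[of _ _ "\<phi> (a, b)" _ _ 1] \<phi>[of "(a, b)"] st by auto
    moreover have "(rep (b, c), (b, c)) \<in> step G ^^ \<phi> (b, c)" using \<phi> by blast
    moreover have "\<phi> (a, b) + 1 + 2 * \<phi> (b, c) \<le> L" using \<phi>[of "(a, b)"] \<phi>[of "(b, c)"] L by linarith
    ultimately show ?thesis using walk_residue_unique[OF G free] by metis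
  qed
  with that show ?thesis by blast
qed

text \<open>With 2 standing for -1, \<open>s a b\<close> is the potential of (b, a) minus that of
  (a, b), hence antisymmetric modulo 3. Around an edge the values \<open>s a b\<close>,
  \<open>s b c\<close>, \<open>s c a\<close> are d, d + 1, d - 1, so each residue occurs once: one
  pair is blue, and the other two are red arcs from the vertex opposite to it.\<close>

lemma star_colouring_of_potential:
  assumes G: "tri V G" and \<phi>: "\<And>a b c. G a b c \<Longrightarrow> \<phi> (b, c) mod 3 = (\<phi> (a, b) + 1 :: nat) mod 3"
  obtains Bl Rd where "star_coloured G Bl Rd"
proof -
  define s where "s = (\<lambda>a b. (\<phi> (b, a) + 2 * \<phi> (a, b)) mod 3)"
  have "star_coloured G (\<lambda>a b. s a b = 0) (\<lambda>a b. s a b = 2)"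
    unfolding star_coloured_def
  proof (intro conjI allI impI)
    fix a b assume "s a b = 0" then show "s b a = 0" unfolding s_def by presburger
  next
    fix a b assume "s a b = 2" then show "s b a \<noteq> 2" unfolding s_def by presburger
  next
    fix a b assume "s a b = 2" then show "s a b \<noteq> 0" by simp
  next
    fix a b c assume T: "G a b c"
    note D = triD[OF G T]
    define x where "x = \<phi> (a, b) mod 3"
    define y where "y = \<phi> (b, a) mod 3"
    have "\<phi> (b, c) mod 3 = (\<phi> (a, b) mod 3 + 1) mod 3" "\<phi> (c, a) mod 3 = (\<phi> (b, c) mod 3 + 1) mod 3"
      "\<phi> (a, c) mod 3 = (\<phi> (b, a) mod 3 + 1) mod 3" "\<phi> (c, b) mod 3 = (\<phi> (a, c) mod 3 + 1) mod 3"
      using \<phi>[OF T] \<phi>[OF D(3)] \<phi>[OF D(2)] \<phi>[OF D(1)] unfolding mod_add_left_eq by blast+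
    moreover have "s u v = (\<phi> (v, u) mod 3 + 2 * (\<phi> (u, v) mod 3)) mod 3" for u v
    proof -
      have "(2 * \<phi> (u, v)) mod 3 = (2 * (\<phi> (u, v) mod 3)) mod 3" by (rule mod_mult_right_eq[symmetric])
      then show ?thesis unfolding s_def by (subst (1 2) mod_add_eq[symmetric]) simp
    qed
    moreover have "x = 0 \<or> x = 1 \<or> x = 2" "y = 0 \<or> y = 1 \<or> y = 2" unfolding x_def y_def by auto
    ultimately show "(s a b = 0 \<and> s c a = 2 \<and> s c b = 2) \<or> (s b c = 0 \<and> s a b = 2 \<and> s a c = 2)
      \<or> (s a c = 0 \<and> s b a = 2 \<and> s b c = 2)"
      using x_def[symmetric] y_def[symmetric] by (elim disjE) simp_all
  qed
  with that show ?thesis by blast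
qed

context weighted
begin

text \<open>While the balls around p grow, take a pair that is new at radius 7 * n + 5. The pairs
  two steps after it have measure at least \<open>\<delta>\<^sup>2\<close>. None of them is within 7
  * n, since walking back costs 4 steps, and all are within 7 * n + 7. So every seven steps gain
  \<open>\<delta>\<^sup>2\<close>, and the total measure 1 stops this before N rounds.\<close>

lemma walk_diameter:
  assumes G: "tri V G" and \<delta>: "0 < \<delta>" and cod: "\<And>a b c. G a b c \<Longrightarrow> codeg G a b \<ge> \<delta>"
    and N: "1 < real N * \<delta>\<^sup>2" and reach: "(p, q) \<in> (step G)\<^sup>*"
  shows "\<exists>k\<le>7 * N + 4. (p, q) \<in> step G ^^ k"
proof -
  define Bk where "Bk = (\<lambda>k. {q. \<exists>j\<le>k. (p, q) \<in> step G ^^ j})"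
  define pm where "pm = (\<lambda>X. av (\<lambda>a. av (\<lambda>b. of_bool ((a, b) \<in> X))))"
  have Bk_mono: "Bk i \<subseteq> Bk j" if "i \<le> j" for i j
    using that unfolding Bk_def by (auto intro: order_trans)
  have Bk_step: "r \<in> Bk (i + j)" if "q \<in> Bk i" "(q, r) \<in> step G ^^ j" for q r i j
  proof -
    obtain j' where "j' \<le> i" "(p, q) \<in> step G ^^ j'" using \<open>q \<in> Bk i\<close> unfolding Bk_def by blast
    then have "j' + j \<le> i + j" "(p, r) \<in> step G ^^ (j' + j)"
      using relpow_trans[OF _ \<open>(q, r) \<in> step G ^^ j\<close>] by auto
    then show ?thesis unfolding Bk_def by blast
  qed
  have grow: "(\<exists>k\<le>7 * n + 4. Bk k = Bk (k + 1)) \<or> real n * \<delta>\<^sup>2 \<le> pm (Bk (7 * n))" for n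
  proof (induction n)
    case 0
    have "0 \<le> pm (Bk 0)" unfolding pm_def by (intro av_nonneg) auto
    then show ?case by simp
  next
    case (Suc n)
    show ?case
    proof (cases "\<exists>k\<le>7 * Suc n + 4. Bk k = Bk (k + 1)")
      case False
      then have "\<not> (\<exists>k\<le>7 * n + 4. Bk k = Bk (k + 1))" by auto
      then have IH: "real n * \<delta>\<^sup>2 \<le> pm (Bk (7 * n))" using Suc.IH by blast
      have "7 * n + 4 \<le> 7 * Suc n + 4" by simp
      with False have "Bk (7 * n + 4) \<noteq> Bk (7 * n + 4 + 1)" by blast
      moreover have "7 * n + 4 + 1 = 7 * n + 5" by simp
      ultimately have "Bk (7 * n + 4) \<noteq> Bk (7 * n + 5)" by metis
      then obtain r where r: "r \<in> Bk (7 * n + 5)" "r \<notin> Bk (7 * n + 4)"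
        using Bk_mono[of "7 * n + 4" "7 * n + 5"] by auto
      then obtain j where j: "j \<le> 7 * n + 5" "(p, r) \<in> step G ^^ j" unfolding Bk_def by blast
      \<comment> \<open>As r differs from p it ends a step, so it lies in an edge and the codegree
        hypothesis applies to it.\<close>
      have "j \<noteq> 0" using r j Bk_def by force
      then obtain j' where "j = Suc j'" by (cases j) auto
      with j obtain r' where "(r', r) \<in> step G" by auto
      then obtain a b c where rbc: "r = (b, c)" and "G a b c" unfolding step_def by auto
      then have "G b c a" using triD[OF G] by blast
      then have codr: "codeg G b c \<ge> \<delta>" by (rule cod)
      define N2 where "N2 = {r'. (r, r') \<in> step G ^^ 2}"
      have N2I: "(d, e) \<in> N2" if "G b c d" "G c d e" for d e
      proof -
        have "((b, c), (c, d)) \<in> step G" "((c, d), (d, e)) \<in> step G" using that by auto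
        then show ?thesis unfolding N2_def rbc by (simp add: numeral_2_eq_2 relcomp.relcompI del: step_iff)
      qed
      have "\<delta>\<^sup>2 \<le> codeg G b c * \<delta>" using codr \<delta> by (simp add: power2_eq_square)
      also have "\<dots> \<le> pm N2"
        unfolding codeg_def pm_def av_multc[symmetric]
      proof (rule av_mono)
        fix d assume "d \<in> V"
        show "of_bool (G b c d) * \<delta> \<le> av (\<lambda>e. of_bool ((d, e) \<in> N2))"
        proof (cases "G b c d")
          case True
          then have "\<delta> \<le> codeg G c d" using cod triD[OF G] by blast
          also have "\<dots> \<le> av (\<lambda>e. of_bool ((d, e) \<in> N2))"
            unfolding codeg_def by (rule av_mono) (use N2I True in auto)
          finally show ?thesis using True by simp
        qed (auto intro: av_nonneg)
      qed
      finally have m2: "\<delta>\<^sup>2 \<le> pm N2" .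
      have disj: "N2 \<inter> Bk (7 * n) = {}"
      proof (rule equals0I)
        fix t assume "t \<in> N2 \<inter> Bk (7 * n)"
        then have "(r, t) \<in> step G ^^ 2" "t \<in> Bk (7 * n)" unfolding N2_def by auto
        then have "r \<in> Bk (7 * n + 2 * 2)" using Bk_step walk_back[OF G] by blast
        then show False using r by simp
      qed
      have "N2 \<subseteq> Bk (7 * Suc n)"
      proof
        fix t assume "t \<in> N2"
        then have "t \<in> Bk (7 * n + 5 + 2)" unfolding N2_def using Bk_step[OF r(1)] by blast
        then show "t \<in> Bk (7 * Suc n)" by (simp add: add.commute)
      qed
      moreover have "Bk (7 * n) \<subseteq> Bk (7 * Suc n)" by (rule Bk_mono) simp
      ultimately have "pm (Bk (7 * n)) + pm N2 \<le> pm (Bk (7 * Suc n))"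
        unfolding pm_def av_add[symmetric] using disj by (intro av2_mono) (auto simp: of_bool_def)
      then have "real (Suc n) * \<delta>\<^sup>2 \<le> pm (Bk (7 * Suc n))"
        using IH m2 by (simp add: algebra_simps)
      then show ?thesis by blast
    qed blast
  qed
  have "pm (Bk (7 * N)) \<le> 1" unfolding pm_def by (intro av_le_const) auto
  then obtain k where k: "k \<le> 7 * N + 4" "Bk k = Bk (k + 1)" using grow[of N] N by fastforce
  from reach have "q \<in> Bk k"
  proof (induction rule: rtrancl_induct)
    case base
    have "(p, p) \<in> step G ^^ 0" by simp
    then show ?case unfolding Bk_def by blast
  next
    case (step y z)
    then show ?case using Bk_step[of y k z 1] k(2) by auto
  qed
  then show ?thesis using k(1) unfolding Bk_def by (auto intro: order_trans)
qed

end

section \<open>Stability for star-coloured systems\<close>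

definition tdc :: real where "tdc = 2 * sqrt 3 - 3"

lemma tdc_sq: "tdc * tdc = 3 - 6 * tdc"
proof -
  have "sqrt 3 * sqrt 3 = (3::real)" by simp
  then show ?thesis unfolding tdc_def by (simp add: field_simps)
qed

lemma tdc_bounds: "(4641 / 10000) < tdc" "tdc < (46411 / 100000)"
proof -
  have "sqrt 3 > sqrt ((34641 / 20000)\<^sup>2)" by (intro real_sqrt_less_mono) (simp add: power2_eq_square)
  then show "(4641 / 10000) < tdc" by (simp add: tdc_def)
  have "sqrt 3 < sqrt ((346411 / 200000)\<^sup>2)" by (intro real_sqrt_less_mono) (simp add: power2_eq_square)
  then show "tdc < (46411 / 100000)" by (simp add: tdc_def)
qed

text \<open>The optimal proportion of the independent part is \<open>(3 - sqrt 3) / 2 = (3 - tdc) / 4\<close>.\<close>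

lemma recursion_identity:
  fixes x y :: real
  shows "tdc * ((x + y) ^ 3 - y ^ 3) - 3 * x * x * y = x * (tdc + 3) * (x - (3 - tdc) / 4 * (x + y))\<^sup>2"
  using tdc_sq by algebra

text \<open>For x + y = 1 this says that a partition with all triples of type xxy, and a system of
  density at most \<open>tdc\<close> inside the part y, has density at most
  \<open>tdc\<close>.\<close>

lemma recursion_bound:
  fixes x y :: real
  assumes "0 \<le> x"
  shows "3 * x * x * y \<le> tdc * ((x + y) ^ 3 - y ^ 3)"
proof -
  have "0 \<le> x * (tdc + 3) * (x - (3 - tdc) / 4 * (x + y))\<^sup>2"
    using assms tdc_bounds by simp
  then show ?thesis using recursion_identity[of x y] by linarith
qed

context weighted
begin

lemma av3_rot: "av (\<lambda>a. av (\<lambda>b. av (\<lambda>c. f c a b))) = av (\<lambda>a. av (\<lambda>b. av (\<lambda>c. f a b c)))"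
proof -
  have "av (\<lambda>a. av (\<lambda>b. av (\<lambda>c. f c a b))) = av (\<lambda>a. av (\<lambda>c. av (\<lambda>b. f c a b)))"
    by (intro av_cong av_swap)
  also have "\<dots> = av (\<lambda>c. av (\<lambda>a. av (\<lambda>b. f c a b)))" by (rule av_swap)
  finally show ?thesis .
qed

lemma av3_swap: "av (\<lambda>a. av (\<lambda>b. av (\<lambda>c. f b a c))) = av (\<lambda>a. av (\<lambda>b. av (\<lambda>c. f a b c)))"
  by (rule av_swap)

lemma av3_swap23: "av (\<lambda>a. av (\<lambda>b. av (\<lambda>c. f a c b))) = av (\<lambda>a. av (\<lambda>b. av (\<lambda>c. f a b c)))"
  by (intro av_cong av_swap)

text \<open>The interval for \<open>ms A\<close> surrounds the optimal proportion 0.63397... of the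
  independent part. Triples of other types, in particular those inside \<open>B\<close>, are left
  unrestricted.\<close>

definition approx_structure ::
    "real \<Rightarrow> ('a \<Rightarrow> 'a \<Rightarrow> 'a \<Rightarrow> bool) \<Rightarrow> 'a set \<Rightarrow> 'a set \<Rightarrow> bool" where
  "approx_structure \<mu> H A B \<longleftrightarrow> A \<subseteq> V \<and> B \<subseteq> V \<and> A \<inter> B = {} \<and> 1 - \<mu> \<le> ms A + ms B \<and>
     (3169 / 5000) \<le> ms A \<and> ms A \<le> (6341 / 10000) \<and>
     av (\<lambda>a. av (\<lambda>a'. av (\<lambda>b. of_bool (a \<in> A \<and> a' \<in> A \<and> b \<in> B \<and> \<not> H a a' b)))) \<le> \<mu>"

text \<open>Stars are sorted by the places of the apex and of the blue pair. Each missing red arc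
  from \<open>B\<close> to \<open>A\<close> and each non-blue pair in \<open>A\<close> destroys more
  stars of the intended kind than it permits of other kinds. Edges inside \<open>B\<close> obey the
  bound for a proper part, so \<open>recursion_identity\<close> leaves room only for defects of
  order \<epsilon>.\<close>

lemma approx_structure_exists:
  assumes H: "tri V H" and G: "tri V G" and GH: "\<And>a b c. G a b c \<Longrightarrow> H a b c"
    and star: "star_coloured G Bl Rd"
    and tot: "edens H > tdc + \<gamma>"
    and sub: "\<And>B. B \<subseteq> V \<Longrightarrow> B \<noteq> V \<Longrightarrow>
       edens (\<lambda>a b c. a \<in> B \<and> b \<in> B \<and> c \<in> B \<and> H a b c) \<le> tdc * ms B ^ 3 + \<gamma>"
    and degH: "\<And>v. v \<in> V \<Longrightarrow> deg H v \<ge> (58 / 125)"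
    and eps: "0 < \<epsilon>" "\<epsilon> \<le> 1 / 10 ^ 12" and dens: "edens G \<ge> edens H - \<epsilon>"
  shows "\<exists>A B. approx_structure (1 / 10 ^ 6) H A B"
proof -
  define ou where "ou = (\<lambda>v. av (\<lambda>u. of_bool (Rd v u)))"
  define iu where "iu = (\<lambda>v. av (\<lambda>u. of_bool (Rd u v)))"
  define bu where "bu = (\<lambda>v. av (\<lambda>u. of_bool (Bl v u)))"
  have BlS: "Bl b a" if "Bl a b" for a b using star that unfolding star_coloured_def by blast
  have RdA: "\<not> Rd b a \<and> \<not> Bl a b \<and> \<not> Bl b a" if "Rd a b" for a b
    using star that unfolding star_coloured_def by blast
  have star': "(Bl a b \<and> Rd c a \<and> Rd c b) \<or> (Bl b c \<and> Rd a b \<and> Rd a c) \<or> (Bl a c \<and> Rd b a \<and> Rd b c)"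
    if "G a b c" for a b c using star that unfolding star_coloured_def by blast
  have nonneg: "0 \<le> ou v" "0 \<le> iu v" "0 \<le> bu v" for v
    unfolding ou_def iu_def bu_def by (auto intro: av_nonneg)
  have sum1: "ou v + iu v + bu v \<le> 1" for v
  proof -
    have "ou v + iu v + bu v = av (\<lambda>u. of_bool (Rd v u) + of_bool (Rd u v) + of_bool (Bl v u))"
      unfolding ou_def iu_def bu_def by (simp add: av_simps)
    also have "\<dots> \<le> 1" by (rule av_le_const) (use RdA in \<open>auto simp: of_bool_def\<close>)
    finally show ?thesis .
  qed
  \<comment> \<open>Either v is the apex, with two red out-neighbours joined by a blue pair, or v is
    in the blue pair and sees one blue neighbour and one red in-neighbour, in either order.\<close>
  have degG: "deg G v \<le> av (\<lambda>u. of_bool (Rd v u) * av (\<lambda>t. of_bool (Rd v t \<and> Bl u t))) + 2 * (bu v * iu v)" for v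
  proof -
    have "deg G v \<le> av (\<lambda>u. av (\<lambda>t. of_bool (Rd v u) * of_bool (Rd v t \<and> Bl u t)
       + of_bool (Bl v u) * of_bool (Rd t v) + of_bool (Rd u v) * of_bool (Bl v t)))"
      unfolding deg_def
    proof (rule av2_mono)
      fix u t
      show "of_bool (G v u t) \<le> of_bool (Rd v u) * of_bool (Rd v t \<and> Bl u t)
         + of_bool (Bl v u) * of_bool (Rd t v) + (of_bool (Rd u v) * of_bool (Bl v t) :: real)"
        using star'[of v u t] by (cases "G v u t") auto
    qed
    also have "\<dots> = av (\<lambda>u. of_bool (Rd v u) * av (\<lambda>t. of_bool (Rd v t \<and> Bl u t))) + 2 * (bu v * iu v)"
      unfolding av_add av_cmult av_multc ou_def iu_def bu_def by simp
    finally show ?thesis .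
  qed
  have degG': "deg G v \<le> ou v * ou v + 2 * (bu v * iu v)" for v
  proof -
    have "av (\<lambda>u. of_bool (Rd v u) * av (\<lambda>t. of_bool (Rd v t \<and> Bl u t))) \<le> av (\<lambda>u. of_bool (Rd v u) * ou v)"
      unfolding ou_def by (intro av_mono mult_left_mono) auto
    then have "av (\<lambda>u. of_bool (Rd v u) * av (\<lambda>t. of_bool (Rd v t \<and> Bl u t))) \<le> ou v * ou v"
      unfolding av_multc by (simp add: ou_def)
    then show ?thesis using degG[of v] by linarith
  qed
  have bi: "2 * (bu v * iu v) \<le> (1 - ou v)\<^sup>2 / 2" for v
  proof -
    have "4 * (bu v * iu v) \<le> (bu v + iu v)\<^sup>2"
      using zero_le_power2[of "bu v - iu v"] by (simp add: power2_eq_square algebra_simps)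
    also have "\<dots> \<le> (1 - ou v)\<^sup>2" using sum1[of v] nonneg[of v] by (intro power_mono) auto
    finally show ?thesis by simp
  qed

  \<comment> \<open>58 / 125 - 927 / 2000 = 1 / 2000, so every vertex of \<open>Z\<close> lost more
    than 1 / 2000 of its degree in cleaning; Markov's inequality then bounds the measure of
    \<open>Z\<close>.\<close>
  define Z where "Z = {v \<in> V. deg G v < (927 / 2000)}"
  define A where "A = {v \<in> V. v \<notin> Z \<and> ou v \<le> (1 / 25)}"
  define B where "B = {v \<in> V. v \<notin> Z \<and> (31 / 50) \<le> ou v}"
  define \<alpha> where "\<alpha> = ms A"
  define \<beta> where "\<beta> = ms B"
  define \<zeta> where "\<zeta> = ms Z"
  \<comment> \<open>With x = \<open>ou v\<close> the degree is at most x^2 + (1 - x)^2 / 2. This is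
    convex and takes the values 0.4624 at 1 / 25 and 0.4566 at 31 / 50, both below 927 / 2000 =
    0.4635.\<close>
  have cover: "v \<in> A \<or> v \<in> B \<or> v \<in> Z" if v: "v \<in> V" for v
  proof (rule ccontr)
    assume "\<not> ?thesis"
    then have d: "(927 / 2000) \<le> deg G v" and o: "(1 / 25) < ou v" "ou v < (31 / 50)"
      using v unfolding A_def B_def Z_def by auto
    have "(ou v - (1 / 25)) * ((31 / 50) - ou v) > 0" using o by simp
    then have "ou v * ou v < (33 / 50) * ou v - (31 / 1250)" by (simp add: field_simps)
    moreover have "(927 / 2000) \<le> ou v * ou v + (1 - ou v)\<^sup>2 / 2" using d degG'[of v] bi[of v] by linarith
    then have "(927 / 2000) \<le> (3 / 2) * (ou v * ou v) - ou v + (1 / 2)" by (simp add: power2_eq_square field_simps)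
    ultimately show False using o by linarith
  qed
  have disj: "A \<inter> B = {}" "A \<inter> Z = {}" "B \<inter> Z = {}" "A \<subseteq> V" "B \<subseteq> V" "Z \<subseteq> V"
    unfolding A_def B_def Z_def by auto
  have abz: "\<alpha> + \<beta> + \<zeta> = 1"
  proof -
    have "\<alpha> + \<beta> + \<zeta> = av (\<lambda>v. of_bool (v \<in> A) + of_bool (v \<in> B) + of_bool (v \<in> Z))"
      unfolding \<alpha>_def \<beta>_def \<zeta>_def by (simp add: av_simps)
    also have "\<dots> = av (\<lambda>v. 1)" by (rule av_cong) (use cover disj in fastforce)
    finally show ?thesis by (simp add: av_const)
  qed
  have pos: "0 \<le> \<alpha>" "0 \<le> \<beta>" "0 \<le> \<zeta>" unfolding \<alpha>_def \<beta>_def \<zeta>_def by (simp_all add: ms_nonneg)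
  have zeta: "\<zeta> \<le> 2000 * \<epsilon>"
  proof -
    have "\<zeta> * (1 / 2000) \<le> av (\<lambda>v. of_bool (v \<in> Z) * (deg H v - deg G v))"
      unfolding \<zeta>_def
    proof (rule av_bound_indicator_ge)
      fix v assume "v \<in> V" "v \<in> Z"
      then show "(1 / 2000) \<le> deg H v - deg G v" using degH[of v] unfolding Z_def by simp
    qed
    also have "\<dots> \<le> av (\<lambda>v. deg H v - deg G v)"
    proof (rule av_mono)
      fix v assume "v \<in> V"
      have "deg G v \<le> deg H v" unfolding deg_def by (intro av2_mono) (use GH in auto)
      then show "of_bool (v \<in> Z) * (deg H v - deg G v) \<le> deg H v - deg G v" by (auto simp: of_bool_def)
    qed
    also have "\<dots> = edens H - edens G" unfolding av_diff by (simp add: edens_def deg_def)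
    also have "\<dots> \<le> \<epsilon>" using dens by simp
    finally show ?thesis by simp
  qed
  \<comment> \<open>2 * (9 / 25) * (16 / 25) = 0.4608 is less than 927 / 2000 - (1 / 25)^2 = 0.4619,
    which confines both \<open>bu a\<close> and \<open>iu a\<close>.\<close>
  have A_bi: "(9 / 25) \<le> iu a \<and> (9 / 25) \<le> bu a \<and> bu a \<le> (16 / 25) \<and> iu a \<le> (16 / 25)" if "a \<in> A" for a
  proof -
    have o: "ou a \<le> (1 / 25)" and d: "(927 / 2000) \<le> deg G a" using that unfolding A_def Z_def by auto
    have "ou a * ou a \<le> (1 / 25) * (1 / 25)" using o nonneg[of a] by (intro mult_mono) auto
    then have p: "(4619 / 10000) \<le> 2 * (bu a * iu a)" using d degG'[of a] by simp
    have *: "(9 / 25) \<le> y" if xy: "0 \<le> x" "0 \<le> y" "x + y \<le> 1" "(4619 / 10000) \<le> 2 * (x * y)" for x y :: real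
    proof (rule ccontr)
      assume y: "\<not> (9 / 25) \<le> y"
      have "x * y \<le> (1 - y) * y" using xy by (intro mult_right_mono) auto
      moreover have "0 \<le> ((9 / 25) - y) * ((16 / 25) - y)" using y by simp
      ultimately have "x * y \<le> (144 / 625)" by (simp add: field_simps)
      with xy show False by simp
    qed
    have "(9 / 25) \<le> iu a" using *[of "bu a" "iu a"] p nonneg[of a] sum1[of a] by simp
    moreover have "(9 / 25) \<le> bu a" using *[of "iu a" "bu a"] p nonneg[of a] sum1[of a] by (simp add: mult.commute)
    ultimately show ?thesis using sum1[of a] nonneg[of a] by simp
  qed
  have B_o: "(31 / 50) \<le> ou b \<and> bu b + iu b \<le> (19 / 50) \<and> (927 / 2000) \<le> deg G b" if "b \<in> B" for b
    using that sum1[of b] unfolding B_def Z_def by auto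

  have small_eps: "\<zeta> \<le> 1 / 10 ^ 8" using zeta eps by simp
  \<comment> \<open>If some v in \<open>B\<close> has out-degree at most 21 / 25, its out-neighbours
    need more blue degree than the 19 / 50 available at vertices of \<open>B\<close>, so many of
    them lie in \<open>A\<close>. Otherwise all of \<open>B\<close> has larger out-degree; by
    antisymmetry at most half of the pairs inside \<open>B\<close> are red arcs, and \<beta> is at
    most 8 / 25.\<close>
  have alpha_half: "(1 / 2) \<le> \<alpha>"
  proof (cases "\<exists>v\<in>B. ou v \<le> (21 / 25)")
    case True
    then obtain v where v: "v \<in> B" "ou v \<le> (21 / 25)" by blast
    define x where "x = ou v"
    have "av (\<lambda>u. of_bool (Rd v u) * av (\<lambda>t. of_bool (Rd v t \<and> Bl u t)))
        \<le> av (\<lambda>u. (19 / 50) * of_bool (Rd v u) + (13 / 50) * of_bool (u \<in> A) + of_bool (u \<in> Z))"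
    proof (rule av_mono)
      fix u assume u: "u \<in> V"
      have 1: "av (\<lambda>t. of_bool (Rd v t \<and> Bl u t)) \<le> bu u" unfolding bu_def by (intro av_mono) auto
      have 2: "bu u \<le> (19 / 50) + (13 / 50) * of_bool (u \<in> A) + of_bool (u \<in> Z)"
        using cover[OF u] A_bi[of u] B_o[of u] nonneg[of u] sum1[of u] by (auto simp: of_bool_def)
      show "of_bool (Rd v u) * av (\<lambda>t. of_bool (Rd v t \<and> Bl u t))
         \<le> (19 / 50) * of_bool (Rd v u) + (13 / 50) * of_bool (u \<in> A) + of_bool (u \<in> Z)"
        using 1 2 by (cases "Rd v u") auto
    qed
    also have "\<dots> = (19 / 50) * x + (13 / 50) * \<alpha> + \<zeta>" unfolding av_add av_cmult ou_def x_def \<alpha>_def \<zeta>_def by simp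
    finally have "(927 / 2000) \<le> (19 / 50) * x + (13 / 50) * \<alpha> + \<zeta> + (1 - x)\<^sup>2 / 2"
      using degG[of v] bi[of v] B_o[OF v(1)] unfolding x_def by linarith
    then have "(927 / 2000) \<le> (13 / 50) * \<alpha> + \<zeta> + (1 / 2) - (31 / 50) * x + (1 / 2) * (x * x)"
      by (simp add: power2_eq_square field_simps)
    moreover have "0 \<le> (x - (31 / 50)) * ((21 / 25) - x)" using v B_o[OF v(1)] unfolding x_def by simp
    then have "x * x \<le> (73 / 50) * x - (651 / 1250)" by (simp add: field_simps)
    ultimately show ?thesis using small_eps v unfolding x_def by simp
  next
    case False
    have "\<beta> * (21 / 25) \<le> av (\<lambda>v. of_bool (v \<in> B) * ou v)"
      unfolding \<beta>_def by (rule av_bound_indicator_ge) (use False in force)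
    also have "\<dots> = av (\<lambda>v. av (\<lambda>u. of_bool (v \<in> B) * of_bool (Rd v u)))"
      unfolding ou_def by (simp add: av_cmult)
    also have "\<dots> \<le> av (\<lambda>v. av (\<lambda>u. of_bool (v \<in> B) * (of_bool (u \<in> A) + of_bool (u \<in> Z))
        + of_bool (v \<in> B \<and> u \<in> B \<and> Rd v u)))"
      by (intro av2_mono) (use cover in fastforce)
    also have "\<dots> = \<beta> * (\<alpha> + \<zeta>) + av (\<lambda>v. av (\<lambda>u. of_bool (v \<in> B \<and> u \<in> B \<and> Rd v u)))"
      unfolding av_add av_cmult av_multc \<alpha>_def \<beta>_def \<zeta>_def by simp
    finally have 1: "\<beta> * (21 / 25) \<le> \<beta> * (\<alpha> + \<zeta>) + av (\<lambda>v. av (\<lambda>u. of_bool (v \<in> B \<and> u \<in> B \<and> Rd v u)))" .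
    have "2 * av (\<lambda>v. av (\<lambda>u. of_bool (v \<in> B \<and> u \<in> B \<and> Rd v u)))
       = av (\<lambda>v. av (\<lambda>u. of_bool (v \<in> B \<and> u \<in> B \<and> Rd v u) + of_bool (u \<in> B \<and> v \<in> B \<and> Rd u v)))"
      unfolding av_add using av_swap[of "\<lambda>v u. of_bool (v \<in> B \<and> u \<in> B \<and> Rd v u)"] by simp
    also have "\<dots> \<le> av (\<lambda>v. av (\<lambda>u. of_bool (v \<in> B) * of_bool (u \<in> B)))"
      by (intro av2_mono) (use RdA in \<open>auto simp: of_bool_def\<close>)
    also have "\<dots> = \<beta> * \<beta>" unfolding av_cmult av_multc \<beta>_def by simp
    finally have "av (\<lambda>v. av (\<lambda>u. of_bool (v \<in> B \<and> u \<in> B \<and> Rd v u))) \<le> \<beta> * \<beta> / 2" by simp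
    moreover have "\<beta> * (\<alpha> + \<zeta>) = \<beta> - \<beta> * \<beta>"
      using abz by (simp add: algebra_simps flip: distrib_left)
    ultimately have "\<beta> * (\<beta> - (8 / 25)) \<le> 0" using 1 by (simp add: field_simps)
    then have "\<beta> \<le> (8 / 25)" using pos by (auto simp: mult_le_0_iff)
    then show ?thesis using abz small_eps by simp
  qed
  \<comment> \<open>Vertices of \<open>A\<close> have in-degree at least 9 / 25 but send out at most
    1 / 25, so on average at least 8 / 25 comes in from \<open>B\<close> and
    \<open>Z\<close>.\<close>
  have beta_lb: "(31 / 100) \<le> \<beta>"
  proof -
    have "\<alpha> * (9 / 25) \<le> av (\<lambda>a. of_bool (a \<in> A) * iu a)"
      unfolding \<alpha>_def by (rule av_bound_indicator_ge) (use A_bi in blast)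
    also have "\<dots> = av (\<lambda>a. av (\<lambda>u. of_bool (a \<in> A) * of_bool (Rd u a)))"
      unfolding iu_def by (simp add: av_cmult)
    also have "\<dots> \<le> av (\<lambda>a. av (\<lambda>u. of_bool (u \<in> A) * of_bool (Rd u a) + of_bool (a \<in> A) * (of_bool (u \<in> B) + of_bool (u \<in> Z))))"
      by (intro av2_mono) (use cover in fastforce)
    also have "\<dots> = av (\<lambda>u. of_bool (u \<in> A) * ou u) + \<alpha> * (\<beta> + \<zeta>)"
      unfolding av_add av_cmult av_multc \<alpha>_def \<beta>_def \<zeta>_def ou_def
      by (subst av_swap) (simp add: av_cmult)
    also have "av (\<lambda>u. of_bool (u \<in> A) * ou u) \<le> \<alpha> * (1 / 25)"
      unfolding \<alpha>_def by (rule av_bound_indicator) (auto simp: A_def)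
    finally have "\<alpha> * (8 / 25) \<le> \<alpha> * (\<beta> + \<zeta>)" by (simp add: field_simps)
    then have "(8 / 25) \<le> \<beta> + \<zeta>" using alpha_half by (simp add: mult_le_cancel_left)
    then show ?thesis using small_eps by simp
  qed

  \<comment> \<open>The defects: \<open>q\<close> and \<open>m\<close> measure missing red arcs from
    \<open>B\<close> to \<open>A\<close> seen from either end, \<open>n\<close> non-blue pairs in
    \<open>A\<close>; \<open>Q\<close> and \<open>Nn\<close> are the totals.\<close>
  define q where "q = (\<lambda>b. av (\<lambda>a. of_bool (a \<in> A \<and> \<not> Rd b a)))"
  define m where "m = (\<lambda>a. av (\<lambda>b. of_bool (b \<in> B \<and> \<not> Rd b a)))"
  define n where "n = (\<lambda>a. av (\<lambda>a'. of_bool (a' \<in> A \<and> \<not> Bl a a')))"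
  define iB where "iB = (\<lambda>c. av (\<lambda>t. of_bool (t \<in> B \<and> Rd t c)))"
  define Q where "Q = av (\<lambda>b. of_bool (b \<in> B) * q b)"
  define Nn where "Nn = av (\<lambda>a. of_bool (a \<in> A) * n a)"
  have Qm: "Q = av (\<lambda>a. of_bool (a \<in> A) * m a)"
  proof -
    have "Q = av (\<lambda>b. av (\<lambda>a. of_bool (b \<in> B) * of_bool (a \<in> A \<and> \<not> Rd b a)))"
      unfolding Q_def q_def by (simp add: av_cmult)
    also have "\<dots> = av (\<lambda>a. av (\<lambda>b. of_bool (b \<in> B) * of_bool (a \<in> A \<and> \<not> Rd b a)))" by (rule av_swap)
    also have "\<dots> = av (\<lambda>a. av (\<lambda>b. of_bool (a \<in> A) * of_bool (b \<in> B \<and> \<not> Rd b a)))"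
      by (intro av_cong) auto
    finally show ?thesis unfolding m_def by (simp add: av_cmult)
  qed
  have nn: "0 \<le> q v" "0 \<le> m v" "0 \<le> n v" "0 \<le> iB v" for v
    unfolding q_def m_def n_def iB_def by (auto intro: av_nonneg)
  have QN: "0 \<le> Q" "0 \<le> Nn" unfolding Q_def Nn_def using nn by (auto intro!: av_nonneg)
  have n_ub: "n a \<le> (16 / 25)" if "a \<in> A" for a
  proof -
    have "n a + bu a \<le> av (\<lambda>a'. 1)" unfolding n_def bu_def av_add[symmetric] by (rule av_mono) auto
    then show ?thesis using A_bi[OF that] by (simp add: av_const)
  qed
  have q_iB: "q b + iB b \<le> (19 / 50)" if b: "b \<in> B" for b
  proof -
    have "q b + iB b + ou b \<le> av (\<lambda>_. 1)"
      unfolding q_def iB_def ou_def av_add[symmetric] by (rule av_mono) (use RdA disj in \<open>auto simp: of_bool_def\<close>)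
    then show ?thesis using B_o[OF b] by (simp add: av_const)
  qed
  have oA: "av (\<lambda>a. of_bool (a \<in> A \<and> Rd c a)) = \<alpha> - q c" for c
  proof -
    have "av (\<lambda>a. of_bool (a \<in> A \<and> Rd c a)) + q c = \<alpha>"
      unfolding q_def \<alpha>_def av_add[symmetric] by (rule av_cong) auto
    then show ?thesis by simp
  qed

  \<comment> \<open>\<open>U\<close> has its apex in \<open>A\<close>; \<open>X\<close> has its apex
    in \<open>B\<close> and a mixed blue pair; \<open>Y\<close> is the intended kind. Stars inside
    \<open>B\<close> go to \<open>BB\<close>. \<open>X\<close> names its \<open>A\<close>-vertex
    first, so both orders must be added, whence the factor 2 below.\<close>
  define U where "U = (\<lambda>c a b. c \<in> A \<and> (a \<in> A \<union> B \<and> Rd c a) \<and> (b \<in> A \<union> B \<and> Rd c b))"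
  define X where "X = (\<lambda>c a b. c \<in> B \<and> a \<in> A \<and> b \<in> B \<and> Bl a b \<and> Rd c b)"
  define Y where "Y = (\<lambda>c a b. c \<in> B \<and> a \<in> A \<and> b \<in> A \<and> Bl a b \<and> Rd c a \<and> Rd c b \<and> G c a b)"
  define BB where "BB = (\<lambda>a b c. a \<in> B \<and> b \<in> B \<and> c \<in> B \<and> H a b c)"
  let ?o = "\<lambda>P. of_bool P :: real"
  have U_le: "edens U \<le> (1 / 25) * (Nn + Q)"
  proof -
    define oW where "oW = (\<lambda>c. av (\<lambda>a. ?o (a \<in> A \<union> B \<and> Rd c a)))"
    have "edens U = av (\<lambda>c. av (\<lambda>a. av (\<lambda>b. ?o (c \<in> A) * (?o (a \<in> A \<union> B \<and> Rd c a) * ?o (b \<in> A \<union> B \<and> Rd c b)))))"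
      unfolding edens_def U_def by (simp only: of_bool_conj)
    also have "\<dots> = av (\<lambda>c. ?o (c \<in> A) * (oW c * oW c))"
      unfolding av_cmult av_multc oW_def ..
    also have "\<dots> \<le> av (\<lambda>c. (1 / 25) * (?o (c \<in> A) * n c + ?o (c \<in> A) * m c))"
    proof (rule av_mono)
      fix c
      have 0: "0 \<le> oW c" unfolding oW_def by (auto intro: av_nonneg)
      have "oW c \<le> ou c" unfolding oW_def ou_def by (rule av_mono) auto
      then have 1: "oW c \<le> (1 / 25)" if "c \<in> A" using that unfolding A_def by auto
      have "oW c \<le> n c + m c" unfolding oW_def n_def m_def av_add[symmetric]
        by (rule av_mono) (use RdA in \<open>auto simp: of_bool_def\<close>)
      then have "oW c * oW c \<le> (1 / 25) * (n c + m c)" if "c \<in> A" using 0 1[OF that] by (intro mult_mono) auto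
      then show "?o (c \<in> A) * (oW c * oW c) \<le> (1 / 25) * (?o (c \<in> A) * n c + ?o (c \<in> A) * m c)"
        by (auto simp: of_bool_def)
    qed
    also have "\<dots> = (1 / 25) * (Nn + Q)" unfolding av_cmult av_add Nn_def Qm ..
    finally show ?thesis .
  qed
  have X_le: "edens X \<le> av (\<lambda>b. ?o (b \<in> B) * (iB b * q b))"
  proof -
    have "edens X = av (\<lambda>b. av (\<lambda>c. av (\<lambda>a. ?o (X c a b))))"
      unfolding edens_def using av3_rot[of "\<lambda>b c a. ?o (X c a b)"] by simp
    also have "\<dots> \<le> av (\<lambda>b. av (\<lambda>c. av (\<lambda>a. ?o (b \<in> B) * (?o (c \<in> B \<and> Rd c b) * ?o (a \<in> A \<and> \<not> Rd b a)))))"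
      by (intro av3_mono) (use RdA in \<open>auto simp: X_def of_bool_def\<close>)
    also have "\<dots> = av (\<lambda>b. ?o (b \<in> B) * (iB b * q b))" unfolding av_cmult av_multc iB_def q_def ..
    finally show ?thesis .
  qed
  \<comment> \<open>Pointwise any coefficient in [0, 1] would do for 7 / 50. This one satisfies (31
    / 100) * (7 / 50) > 1 / 25, which pays for the \<open>Nn\<close> term of \<open>U\<close>, and 1
    / 25 + 112 / 625 < 6 / 25, which leaves a gain in \<open>Q\<close>.\<close>
  have Y_le: "edens Y \<le> av (\<lambda>c. ?o (c \<in> B) * ((\<alpha> - q c) * (\<alpha> - q c))) - (7 / 50) * (\<beta> * Nn) + (112 / 625) * Q"
  proof -
    define T where "T = av (\<lambda>c. av (\<lambda>a. av (\<lambda>b. ?o (c \<in> B \<and> \<not> Rd c a) * (?o (a \<in> A) * ?o (b \<in> A \<and> \<not> Bl a b)))))"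
    have "edens Y \<le> av (\<lambda>c. av (\<lambda>a. av (\<lambda>b. ?o (c \<in> B) * (?o (a \<in> A \<and> Rd c a) * ?o (b \<in> A \<and> Rd c b))
       - (7 / 50) * (?o (c \<in> B) * (?o (a \<in> A) * ?o (b \<in> A \<and> \<not> Bl a b)))
       + (7 / 50) * (?o (c \<in> B \<and> \<not> Rd c a) * (?o (a \<in> A) * ?o (b \<in> A \<and> \<not> Bl a b)))
       + (7 / 50) * (?o (c \<in> B \<and> \<not> Rd c b) * (?o (b \<in> A) * ?o (a \<in> A \<and> \<not> Bl b a))))))"
      unfolding edens_def
    proof (rule av3_mono)
      fix c a b
      show "?o (Y c a b) \<le> ?o (c \<in> B) * (?o (a \<in> A \<and> Rd c a) * ?o (b \<in> A \<and> Rd c b))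
       - (7 / 50) * (?o (c \<in> B) * (?o (a \<in> A) * ?o (b \<in> A \<and> \<not> Bl a b)))
       + (7 / 50) * (?o (c \<in> B \<and> \<not> Rd c a) * (?o (a \<in> A) * ?o (b \<in> A \<and> \<not> Bl a b)))
       + (7 / 50) * (?o (c \<in> B \<and> \<not> Rd c b) * (?o (b \<in> A) * ?o (a \<in> A \<and> \<not> Bl b a)))"
        using BlS[of a b] BlS[of b a]
        by (cases "c \<in> B"; cases "a \<in> A"; cases "b \<in> A"; cases "Bl a b"; cases "Rd c a"; cases "Rd c b")
          (auto simp: Y_def)
    qed
    also have "\<dots> = av (\<lambda>c. ?o (c \<in> B) * ((\<alpha> - q c) * (\<alpha> - q c))) - (7 / 50) * (\<beta> * Nn) + (7 / 50) * T + (7 / 50) * T"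
    proof -
      have "av (\<lambda>c. av (\<lambda>a. av (\<lambda>b. ?o (c \<in> B \<and> \<not> Rd c b) * (?o (b \<in> A) * ?o (a \<in> A \<and> \<not> Bl b a))))) = T"
        unfolding T_def by (rule av3_swap23)
      moreover have "av (\<lambda>c. av (\<lambda>a. av (\<lambda>b. ?o (c \<in> B) * (?o (a \<in> A) * ?o (b \<in> A \<and> \<not> Bl a b))))) = \<beta> * Nn"
        unfolding av_cmult av_multc \<beta>_def Nn_def n_def ..
      moreover have "av (\<lambda>c. av (\<lambda>a. av (\<lambda>b. ?o (c \<in> B) * (?o (a \<in> A \<and> Rd c a) * ?o (b \<in> A \<and> Rd c b)))))
          = av (\<lambda>c. ?o (c \<in> B) * ((\<alpha> - q c) * (\<alpha> - q c)))"
        unfolding av_cmult av_multc oA ..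
      ultimately show ?thesis unfolding av_add av_diff
        by (simp only: av_cmult[of "7/50"] T_def)
    qed
    also have "T \<le> (16 / 25) * Q"
    proof -
      have "T = av (\<lambda>c. av (\<lambda>a. ?o (c \<in> B \<and> \<not> Rd c a) * (?o (a \<in> A) * n a)))"
        unfolding T_def n_def av_cmult ..
      also have "\<dots> = av (\<lambda>a. av (\<lambda>c. ?o (c \<in> B \<and> \<not> Rd c a) * (?o (a \<in> A) * n a)))" by (rule av_swap)
      also have "\<dots> = av (\<lambda>a. m a * (?o (a \<in> A) * n a))" unfolding av_multc m_def ..
      also have "\<dots> \<le> av (\<lambda>a. (16 / 25) * (?o (a \<in> A) * m a))"
      proof (rule av_mono)
        fix a show "m a * (?o (a \<in> A) * n a) \<le> (16 / 25) * (?o (a \<in> A) * m a)"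
          using n_ub[of a] nn(2)[of a] mult_right_mono[of "n a" "(16 / 25)" "m a"] by (cases "a \<in> A") (auto simp: mult.commute)
      qed
      finally show ?thesis unfolding av_cmult Qm .
    qed
    finally show ?thesis by simp
  qed
  have main: "edens U + 2 * edens X + edens Y \<le> \<alpha> * \<alpha> * \<beta> - (17 / 5000) * Nn - (13 / 625) * Q"
  proof -
    have "2 * edens X + av (\<lambda>c. ?o (c \<in> B) * ((\<alpha> - q c) * (\<alpha> - q c)))
        \<le> av (\<lambda>b. 2 * (?o (b \<in> B) * (iB b * q b)) + ?o (b \<in> B) * ((\<alpha> - q b) * (\<alpha> - q b)))"
      using X_le unfolding av_add av_cmult by simp
    also have "\<dots> \<le> av (\<lambda>b. \<alpha> * \<alpha> * ?o (b \<in> B) - (6 / 25) * (?o (b \<in> B) * q b))"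
    proof (rule av_mono)
      fix b
      \<comment> \<open>\<open>iB b\<close> is at most 19 / 50 - q b and \<alpha> at least 1 / 2, so
        the linear coefficient of \<open>q b\<close> is at most 2 * (19 / 50) - 1 = -6 / 25.\<close>
      have "2 * (iB b * q b) + (\<alpha> - q b) * (\<alpha> - q b) \<le> \<alpha> * \<alpha> - (6 / 25) * q b" if b: "b \<in> B"
      proof -
        have "iB b * q b \<le> ((19 / 50) - q b) * q b" using q_iB[OF b] nn by (intro mult_right_mono) auto
        moreover have "(1 / 2) * q b \<le> \<alpha> * q b" using alpha_half nn(1) by (rule mult_right_mono)
        moreover have "0 \<le> q b * q b" by simp
        moreover have "(\<alpha> - q b) * (\<alpha> - q b) = \<alpha> * \<alpha> - 2 * (\<alpha> * q b) + q b * q b"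
          "((19 / 50) - q b) * q b = (19 / 50) * q b - q b * q b" by algebra+
        ultimately show ?thesis by linarith
      qed
      then show "2 * (?o (b \<in> B) * (iB b * q b)) + ?o (b \<in> B) * ((\<alpha> - q b) * (\<alpha> - q b))
          \<le> \<alpha> * \<alpha> * ?o (b \<in> B) - (6 / 25) * (?o (b \<in> B) * q b)" by (cases "b \<in> B") auto
    qed
    also have "\<dots> = \<alpha> * \<alpha> * \<beta> - (6 / 25) * Q" unfolding av_diff av_cmult \<beta>_def Q_def ..
    finally have "2 * edens X + av (\<lambda>c. ?o (c \<in> B) * ((\<alpha> - q c) * (\<alpha> - q c))) \<le> \<alpha> * \<alpha> * \<beta> - (6 / 25) * Q" .
    moreover have "(31 / 100) * Nn \<le> \<beta> * Nn" using beta_lb QN by (intro mult_right_mono) auto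
    ultimately show ?thesis using U_le Y_le by (simp add: field_simps)
  qed
  have total: "edens G \<le> 3 * \<zeta> + edens BB + 3 * (edens U + 2 * edens X + edens Y)"
  proof -
    have "edens G \<le> av (\<lambda>a. av (\<lambda>b. av (\<lambda>c. ?o (a \<in> Z) + ?o (b \<in> Z) + ?o (c \<in> Z) + ?o (BB a b c)
       + (?o (U c a b) + ?o (X c a b) + ?o (X c b a) + ?o (Y c a b))
       + (?o (U a b c) + ?o (X a b c) + ?o (X a c b) + ?o (Y a b c))
       + (?o (U b a c) + ?o (X b a c) + ?o (X b c a) + ?o (Y b a c)))))"
      unfolding edens_def
    proof (rule av3_mono)
      fix a b c assume V: "a \<in> V" "b \<in> V" "c \<in> V"
      show "?o (G a b c) \<le> ?o (a \<in> Z) + ?o (b \<in> Z) + ?o (c \<in> Z) + ?o (BB a b c)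
       + (?o (U c a b) + ?o (X c a b) + ?o (X c b a) + ?o (Y c a b))
       + (?o (U a b c) + ?o (X a b c) + ?o (X a c b) + ?o (Y a b c))
       + (?o (U b a c) + ?o (X b a c) + ?o (X b c a) + ?o (Y b a c))"
      proof (cases "G a b c")
        case True
        note D = triD[OF G True]
        have "a \<in> Z \<or> b \<in> Z \<or> c \<in> Z \<or> BB a b c
          \<or> U c a b \<or> X c a b \<or> X c b a \<or> Y c a b \<or> U a b c \<or> X a b c \<or> X a c b \<or> Y a b c
          \<or> U b a c \<or> X b a c \<or> X b c a \<or> Y b a c"
          using star'[OF True] cover[OF V(1)] cover[OF V(2)] cover[OF V(3)] GH[OF True] D(1-5) True
            BlS[of a b] BlS[of b c] BlS[of a c]
          unfolding U_def X_def Y_def BB_def by (elim disjE conjE) simp_all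
        then show ?thesis by (elim disjE) (simp_all add: add_nonneg_nonneg)
      qed (simp add: add_nonneg_nonneg)
    qed
    also have "\<dots> = 3 * \<zeta> + edens BB + 3 * (edens U + 2 * edens X + edens Y)"
    proof -
      have p1: "av (\<lambda>a. av (\<lambda>b. av (\<lambda>c. ?o (W c a b)))) = edens W" for W
        unfolding edens_def by (rule av3_rot)
      have p2: "av (\<lambda>a. av (\<lambda>b. av (\<lambda>c. ?o (W c b a)))) = edens W" for W
        using p1[of W] by (subst av_swap) simp
      have p3: "av (\<lambda>a. av (\<lambda>b. av (\<lambda>c. ?o (W b a c)))) = edens W" for W
        unfolding edens_def by (rule av3_swap)
      have p4: "av (\<lambda>a. av (\<lambda>b. av (\<lambda>c. ?o (W a c b)))) = edens W" for W
        unfolding edens_def by (rule av3_swap23)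
      have p5: "av (\<lambda>a. av (\<lambda>b. av (\<lambda>c. ?o (W b c a)))) = edens W" for W
        using p4[of W] by (subst av_swap) simp
      have p6: "av (\<lambda>a. av (\<lambda>b. av (\<lambda>c. ?o (W a b c)))) = edens W" for W
        unfolding edens_def ..
      show ?thesis unfolding av_add av_const p1[of U] p1[of X] p1[of Y] p2[of X] p3[of U] p3[of X] p3[of Y]
          p4[of X] p5[of X] p6[of U] p6[of X] p6[of Y] p6[of BB] \<zeta>_def[symmetric] by simp
    qed
    finally show ?thesis .
  qed
  define E where "E = av (\<lambda>a. av (\<lambda>a'. av (\<lambda>b. ?o (a \<in> A \<and> a' \<in> A \<and> b \<in> B \<and> G a a' b))))"
  have Y_E: "edens Y \<le> E"
  proof -
    have "edens Y = av (\<lambda>a. av (\<lambda>a'. av (\<lambda>b. ?o (Y b a a'))))" unfolding edens_def by (rule av3_rot[symmetric])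
    also have "\<dots> \<le> E" unfolding E_def by (intro av3_mono) (use triD(3)[OF G] in \<open>auto simp: Y_def of_bool_def\<close>)
    finally show ?thesis .
  qed
  have E_M: "E + av (\<lambda>a. av (\<lambda>a'. av (\<lambda>b. ?o (a \<in> A \<and> a' \<in> A \<and> b \<in> B \<and> \<not> H a a' b)))) \<le> \<alpha> * \<alpha> * \<beta>"
  proof -
    have "E + av (\<lambda>a. av (\<lambda>a'. av (\<lambda>b. ?o (a \<in> A \<and> a' \<in> A \<and> b \<in> B \<and> \<not> H a a' b))))
        \<le> av (\<lambda>a. av (\<lambda>a'. av (\<lambda>b. ?o (a \<in> A) * (?o (a' \<in> A) * ?o (b \<in> B)))))"
      unfolding E_def av_add[symmetric] by (intro av3_mono) (use GH in \<open>auto simp: of_bool_def\<close>)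
    also have "\<dots> = \<alpha> * \<alpha> * \<beta>" unfolding av_cmult av_multc \<alpha>_def \<beta>_def by simp
    finally show ?thesis .
  qed
  have X_Q: "edens X \<le> (19 / 50) * Q"
  proof -
    have "edens X \<le> av (\<lambda>b. (19 / 50) * (?o (b \<in> B) * q b))"
    proof (rule order_trans[OF X_le av_mono])
      fix b
      have "iB b * q b \<le> (19 / 50) * q b" if b: "b \<in> B"
        using q_iB[OF b] nn(1)[of b] by (intro mult_right_mono) auto
      then show "?o (b \<in> B) * (iB b * q b) \<le> (19 / 50) * (?o (b \<in> B) * q b)" by auto
    qed
    then show ?thesis unfolding av_cmult Q_def .
  qed
  have "B \<noteq> V"
  proof
    assume "B = V"
    then have "A = {}" using disj by blast
    then have "\<alpha> = 0" unfolding \<alpha>_def by (simp add: av_const)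
    then show False using alpha_half by simp
  qed
  then have "edens BB \<le> tdc * \<beta> ^ 3 + \<gamma>" using sub[OF disj(5)] unfolding BB_def \<beta>_def by blast
  then have lower: "tdc - tdc * \<beta> ^ 3 - (\<epsilon> + 3 * \<zeta>) \<le> 3 * (edens U + 2 * edens X + edens Y)"
    using total tot dens by linarith
  define s where "s = \<alpha> + \<beta>"
  have s: "1 - 1 / 10 ^ 8 \<le> s" "s \<le> 1" using abz pos small_eps unfolding s_def by auto
  have "s ^ 3 \<le> 1" using s by (intro power_le_one) auto
  then have "tdc * (s ^ 3 - \<beta> ^ 3) \<le> tdc - tdc * \<beta> ^ 3" using tdc_bounds by (simp add: algebra_simps)
  then have upper: "3 * (\<alpha> * \<alpha> * \<beta>) + \<alpha> * (tdc + 3) * (\<alpha> - (3 - tdc) / 4 * s)\<^sup>2 \<le> tdc - tdc * \<beta> ^ 3"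
    using recursion_identity[of \<alpha> \<beta>] unfolding s_def by (simp add: algebra_simps)
  have kap: "\<epsilon> + 3 * \<zeta> \<le> 7 / 10 ^ 9" using zeta eps by simp
  have sq0: "0 \<le> \<alpha> * (tdc + 3) * (\<alpha> - (3 - tdc) / 4 * s)\<^sup>2" using pos tdc_bounds by simp
  \<comment> \<open>Together, \<open>lower\<close>, \<open>main\<close> and \<open>upper\<close>
    bound 3 * (17 / 5000) * Nn + 3 * (13 / 625) * Q plus the square by \<epsilon> + 3 *
    \<zeta>.\<close>
  have QNs: "Nn \<le> 7 / 10 ^ 7" "Q \<le> 7 / (6 * 10 ^ 8) * 10" and sq: "\<alpha> * (tdc + 3) * (\<alpha> - (3 - tdc) / 4 * s)\<^sup>2 \<le> 7 / 10 ^ 9"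
    using lower upper main kap sq0 QN by (simp_all add: field_simps)
  have M: "av (\<lambda>a. av (\<lambda>a'. av (\<lambda>b. ?o (a \<in> A \<and> a' \<in> A \<and> b \<in> B \<and> \<not> H a a' b)))) \<le> 1 / 10 ^ 6"
    using lower upper sq0 kap E_M Y_E U_le X_Q QNs by (simp add: field_simps)
  have "(1 / 2) * 3 * (\<alpha> - (3 - tdc) / 4 * s)\<^sup>2 \<le> \<alpha> * (tdc + 3) * (\<alpha> - (3 - tdc) / 4 * s)\<^sup>2"
    using alpha_half tdc_bounds by (intro mult_right_mono mult_mono) auto
  then have "(\<alpha> - (3 - tdc) / 4 * s)\<^sup>2 \<le> (1 / 10 ^ 4)\<^sup>2" using sq by (simp add: power2_eq_square)
  then have ab: "\<bar>\<alpha> - (3 - tdc) / 4 * s\<bar> \<le> 1 / 10 ^ 4"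
    by (metis abs_le_square_iff abs_of_nonneg divide_nonneg_nonneg zero_le_one zero_le_power zero_le_numeral)
  define y where "y = (3 - tdc) / 4 * s"
  have y: "y \<le> (3 - tdc) / 4 * 1" "(3 - tdc) / 4 * (1 - 1 / 10 ^ 8) \<le> y"
    unfolding y_def using s tdc_bounds by (intro mult_left_mono; simp)+
  have "\<alpha> - y \<le> 1 / 10 ^ 4" "y - \<alpha> \<le> 1 / 10 ^ 4" using ab unfolding y_def by linarith+
  then have "(3169 / 5000) \<le> \<alpha>" "\<alpha> \<le> (6341 / 10000)" using tdc_bounds y by (simp_all add: field_simps)
  moreover have "1 - 1 / 10 ^ 6 \<le> \<alpha> + \<beta>" using s unfolding s_def by simp
  ultimately have "approx_structure (1 / 10 ^ 6) H A B"
    unfolding approx_structure_def using M disj unfolding \<alpha>_def \<beta>_def by simp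
  then show ?thesis by blast
qed

end

section \<open>Walk labels around an approximate structure\<close>

text \<open>
  Lengths are shifted by 2 because the base pair will be of the form \<open>(b, a)\<close>; then the pairs
  \<open>(a, a')\<close>, \<open>(a, b)\<close> and \<open>(b, a)\<close> of the structure \<open>AAB\<close> get the labels 0, 1 and 2.
\<close>

definition lab ::
    "('a \<Rightarrow> 'a \<Rightarrow> 'a \<Rightarrow> bool) \<Rightarrow> 'a \<times> 'a \<Rightarrow> nat \<Rightarrow> 'a \<times> 'a \<Rightarrow> nat \<Rightarrow> bool" where
  "lab T p0 k p t \<longleftrightarrow> (\<exists>j\<le>k. (p0, p) \<in> step T ^^ j \<and> (j + 2) mod 3 = t)"

lemma lab_start: "lab T p k p 2"
  unfolding lab_def by (rule exI[of _ 0]) simp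

lemma lab_step:
  assumes "lab T p k (a, b) t" "T a b c" "k < k'"
  shows "lab T p k' (b, c) ((t + 1) mod 3)"
proof -
  obtain j where j: "j \<le> k" "(p, (a, b)) \<in> step T ^^ j" "(j + 2) mod 3 = t"
    using assms(1) unfolding lab_def by blast
  have "(p, (b, c)) \<in> step T ^^ (Suc j)" using j(2) assms(2) by (auto simp del: relpow.simps(1))
  moreover have "(Suc j + 2) mod 3 = (t + 1) mod 3" 
    unfolding j(3)[symmetric] mod_add_left_eq by simp
  ultimately show ?thesis using j(1) assms(3) unfolding lab_def by (intro exI[of _ "Suc j"]) auto
qed

lemma lab01: "lab T p k (a, b) 0 \<Longrightarrow> T a b c \<Longrightarrow> k < k' \<Longrightarrow> lab T p k' (b, c) 1"
  using lab_step[of T p k a b 0 c k'] by simp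

lemma lab12: "lab T p k (a, b) 1 \<Longrightarrow> T a b c \<Longrightarrow> k < k' \<Longrightarrow> lab T p k' (b, c) 2"
  using lab_step[of T p k a b 1 c k'] by (simp add: numeral_2_eq_2)

lemma lab20: "lab T p k (a, b) 2 \<Longrightarrow> T a b c \<Longrightarrow> k < k' \<Longrightarrow> lab T p k' (b, c) 0"
  using lab_step[of T p k a b 2 c k'] by simp

lemma lab_mono:
  assumes "lab T p k q t" "k \<le> k'"
  shows "lab T p k' q t"
proof -
  obtain j where "j \<le> k" "(p, q) \<in> step T ^^ j \<and> (j + 2) mod 3 = t"
    using assms(1) unfolding lab_def by blast
  then show ?thesis using assms(2) unfolding lab_def by (intro exI[of _ j]) simp
qed

lemma lab_unique:
  assumes "tri V T" "walk_free L T" "lab T p k q t" "lab T p k' q t'" "k + 2 * k' \<le> L"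
  shows "t = t'"
proof -
  obtain j j' where j: "j \<le> k" "(p, q) \<in> step T ^^ j" "(j + 2) mod 3 = t"
    "j' \<le> k'" "(p, q) \<in> step T ^^ j'" "(j' + 2) mod 3 = t'"
    using assms(3,4) unfolding lab_def by blast
  have "j mod 3 = j' mod 3"
    by (rule walk_residue_unique[OF assms(1,2) j(2,5)]) (use j assms(5) in linarith)
  then show ?thesis using j by (metis mod_add_cong)
qed

context weighted
begin

lemma pick_in:
  assumes "0 < ms S"
  obtains v where "v \<in> V" "v \<in> S" "ms S * f v \<le> av (\<lambda>v. of_bool (v \<in> S) * f v)"
proof -
  have restr: "av (\<lambda>v. of_bool (v \<in> S) * h v) = (\<Sum>v\<in>V \<inter> S. w v * h v)" for h
    unfolding av_def by (rule sum.mono_neutral_cong_right) (use fin in auto)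
  define X where "X = av (\<lambda>v. of_bool (v \<in> S) * f v)"
  have ms: "ms S = (\<Sum>v\<in>V \<inter> S. w v)" using restr[of "\<lambda>_. 1"] by simp
  have ne: "V \<inter> S \<noteq> {}" using assms ms by auto
  have "\<exists>v\<in>V \<inter> S. ms S * f v \<le> X"
  proof (rule ccontr)
    assume "\<not> ?thesis"
    then have "(\<Sum>v\<in>V \<inter> S. w v * X) < (\<Sum>v\<in>V \<inter> S. w v * (ms S * f v))"
      using ne fin wpos by (intro sum_strict_mono mult_strict_left_mono) (auto simp: not_le)
    also have "\<dots> = ms S * X"
      unfolding X_def restr by (simp add: sum_distrib_left algebra_simps)
    also have "\<dots> = (\<Sum>v\<in>V \<inter> S. w v * X)" by (simp add: ms sum_distrib_right)
    finally show False by simp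
  qed
  with that show ?thesis unfolding X_def by blast
qed

text \<open>Averaging gives \<open>a0\<close> in \<open>A\<close> with few missing triples, then
  \<open>b0\<close> in \<open>B\<close> for which few triples with \<open>a0\<close> are missing.
  From (b0, a0) walks continue through pairs of types \<open>AA\<close>, \<open>AB\<close>,
  \<open>BA\<close>, \<open>AA\<close> with labels 0, 1, 2, 0. A target pair is reached unless
  almost every choice of the intermediate vertex fails, so the error grows only by constant
  factors.\<close>

lemma core_labels:
  assumes H: "tri V H" and A: "approx_structure (1 / 10 ^ 6) H A B"
  obtains p where
    "av (\<lambda>a. av (\<lambda>b. of_bool (a \<in> A \<and> b \<in> B \<and> \<not> lab H p 5 (a, b) 1))) \<le> 12 / 10 ^ 6"
    "av (\<lambda>a. av (\<lambda>b. of_bool (a \<in> A \<and> b \<in> B \<and> \<not> lab H p 5 (b, a) 2))) \<le> 12 / 10 ^ 6"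
    "av (\<lambda>a. av (\<lambda>a'. of_bool (a \<in> A \<and> a' \<in> A \<and> \<not> lab H p 5 (a, a') 0))) \<le> 12 / 10 ^ 6"
proof -
  define \<alpha> where "\<alpha> = ms A"
  define \<beta> where "\<beta> = ms B"
  define \<mu> :: real where "\<mu> = 1 / 10 ^ 6"
  have \<alpha>: "(3169 / 5000) \<le> \<alpha>" "\<alpha> \<le> (6341 / 10000)" and \<beta>1: "1 - \<mu> \<le> \<alpha> + \<beta>"
    and miss: "av (\<lambda>a. av (\<lambda>a'. av (\<lambda>b. of_bool (a \<in> A \<and> a' \<in> A \<and> b \<in> B \<and> \<not> H a a' b)))) \<le> \<mu>"
    and AV: "A \<subseteq> V" "B \<subseteq> V" "A \<inter> B = {}"
    using A unfolding approx_structure_def \<alpha>_def \<beta>_def \<mu>_def by auto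
  have "\<alpha> + \<beta> \<le> 1"
  proof -
    have "\<alpha> + \<beta> \<le> av (\<lambda>_. 1)" unfolding \<alpha>_def \<beta>_def av_add[symmetric] by (rule av_mono) (use AV in \<open>auto simp: of_bool_def\<close>)
    then show ?thesis by (simp add: av_const)
  qed
  then have \<beta>: "(1829 / 5000) \<le> \<beta>" "\<beta> \<le> (1831 / 5000)" using \<alpha> \<beta>1 by (simp_all add: \<mu>_def)
  let ?o = "\<lambda>P. of_bool P :: real"
  define f where "f = (\<lambda>a. av (\<lambda>a'. av (\<lambda>b. ?o (a' \<in> A \<and> b \<in> B \<and> \<not> H a a' b))))"
  have "av (\<lambda>a. ?o (a \<in> A) * f a) \<le> \<mu>"
    using miss unfolding f_def av_cmult[symmetric] of_bool_conj .
  moreover have "0 < ms A" using \<alpha> unfolding \<alpha>_def by simp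
  ultimately obtain a0 where a0: "a0 \<in> V" "a0 \<in> A" "\<alpha> * f a0 \<le> \<mu>"
    using pick_in[of A f] unfolding \<alpha>_def by (metis order_trans)
  have f0: "0 \<le> f a0" unfolding f_def by (intro av_nonneg) auto
  have f_a0: "f a0 \<le> (8 / 5) * \<mu>"
  proof -
    have "(3169 / 5000) * f a0 \<le> \<alpha> * f a0" using \<alpha> f0 by (intro mult_right_mono) auto
    then show ?thesis using a0 f0 by (simp add: \<mu>_def)
  qed
  define g where "g = (\<lambda>b. av (\<lambda>a'. ?o (a' \<in> A \<and> \<not> H a0 a' b)))"
  have "av (\<lambda>b. ?o (b \<in> B) * g b) = av (\<lambda>b. av (\<lambda>a'. ?o (a' \<in> A \<and> b \<in> B \<and> \<not> H a0 a' b)))"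
    unfolding g_def av_cmult[symmetric] by (intro av_cong) auto
  also have "\<dots> = f a0" unfolding f_def by (rule av_swap)
  finally have gf: "av (\<lambda>b. ?o (b \<in> B) * g b) = f a0" .
  moreover have "0 < ms B" using \<beta> unfolding \<beta>_def by simp
  ultimately obtain b0 where b0: "b0 \<in> V" "b0 \<in> B" "\<beta> * g b0 \<le> f a0"
    using pick_in[of B g] unfolding \<beta>_def by metis
  define p where "p = (b0, a0)"
  define X2 where "X2 = (\<lambda>a b. H b0 a0 a \<and> H a0 a b)"
  define l2 where "l2 = (\<lambda>a b. ?o (a \<in> A \<and> b \<in> B \<and> \<not> lab H p 2 (a, b) 1))"
  define l3 where "l3 = (\<lambda>a b. ?o (a \<in> A \<and> b \<in> B \<and> \<not> lab H p 3 (b, a) 2))"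
  define l4 where "l4 = (\<lambda>a a'. ?o (a \<in> A \<and> a' \<in> A \<and> \<not> lab H p 4 (a, a') 0))"
  have L2: "lab H p 2 (a, b) 1" if "H b0 a0 a" "H a0 a b" for a b
  proof -
    have "lab H p 0 (b0, a0) 2" unfolding p_def by (rule lab_start)
    from lab20[OF this that(1), of 1] have "lab H p 1 (a0, a) 0" by simp
    from lab01[OF this that(2), of 2] show ?thesis by simp
  qed
  have m2: "av (\<lambda>a. av (\<lambda>b. l2 a b)) \<le> (33 / 10) * \<mu>"
  proof -
    have "av (\<lambda>a. av (\<lambda>b. l2 a b)) \<le> av (\<lambda>a. av (\<lambda>b. ?o (a \<in> A \<and> \<not> H a0 a b0) * ?o (b \<in> B) + ?o (a \<in> A \<and> b \<in> B \<and> \<not> H a0 a b)))"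
    proof (rule av2_mono)
      fix a b
      have "H b0 a0 a" if "H a0 a b0" using triD[OF H that] by blast
      then show "l2 a b \<le> ?o (a \<in> A \<and> \<not> H a0 a b0) * ?o (b \<in> B) + ?o (a \<in> A \<and> b \<in> B \<and> \<not> H a0 a b)"
        using L2[of a b] unfolding l2_def by (auto simp: of_bool_def)
    qed
    also have "\<dots> = g b0 * \<beta> + f a0" unfolding av_add av_cmult av_multc g_def f_def \<beta>_def ..
    also have "\<dots> \<le> 2 * f a0" using b0 by (simp add: mult.commute)
    finally show ?thesis using f_a0 by (simp add: \<mu>_def)
  qed
  have m3: "av (\<lambda>a. av (\<lambda>b. l3 a b)) \<le> (49 / 10) * \<mu>"
  proof -
    \<comment> \<open>The factor \<alpha> introduces the intermediate vertex a' of the step from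
      (a', b) to (b, a); it is divided out at the end.\<close>
    have "av (\<lambda>a. av (\<lambda>b. l3 a b)) * \<alpha> = av (\<lambda>a. av (\<lambda>b. av (\<lambda>a'. l3 a b * ?o (a' \<in> A))))"
      unfolding av_multc av_cmult \<alpha>_def ..
    also have "\<dots> \<le> av (\<lambda>a. av (\<lambda>b. av (\<lambda>a'. ?o (a \<in> A) * l2 a' b + ?o (a \<in> A \<and> a' \<in> A \<and> b \<in> B \<and> \<not> H a a' b))))"
    proof (rule av3_mono)
      fix a b a'
      have "lab H p 3 (b, a) 2" if "lab H p 2 (a', b) 1" "H a a' b"
        using lab12[OF that(1)] triD[OF H that(2)] by simp
      then show "l3 a b * ?o (a' \<in> A) \<le> ?o (a \<in> A) * l2 a' b + ?o (a \<in> A \<and> a' \<in> A \<and> b \<in> B \<and> \<not> H a a' b)"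
        unfolding l2_def l3_def by (auto simp: of_bool_def)
    qed
    also have "\<dots> = \<alpha> * av (\<lambda>b. av (\<lambda>a'. l2 a' b)) + av (\<lambda>a. av (\<lambda>b. av (\<lambda>a'. ?o (a \<in> A \<and> a' \<in> A \<and> b \<in> B \<and> \<not> H a a' b))))"
      unfolding av_add av_cmult av_multc \<alpha>_def ..
    also have "av (\<lambda>b. av (\<lambda>a'. l2 a' b)) = av (\<lambda>a. av (\<lambda>b. l2 a b))" by (rule av_swap)
    also have "av (\<lambda>a. av (\<lambda>b. av (\<lambda>a'. ?o (a \<in> A \<and> a' \<in> A \<and> b \<in> B \<and> \<not> H a a' b))))
      = av (\<lambda>a. av (\<lambda>a'. av (\<lambda>b. ?o (a \<in> A \<and> a' \<in> A \<and> b \<in> B \<and> \<not> H a a' b))))" by (rule av3_swap23)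
    finally have "av (\<lambda>a. av (\<lambda>b. l3 a b)) * \<alpha> \<le> \<alpha> * av (\<lambda>a. av (\<lambda>b. l2 a b)) + \<mu>" using miss by linarith
    then have "\<alpha> * (av (\<lambda>a. av (\<lambda>b. l3 a b)) - av (\<lambda>a. av (\<lambda>b. l2 a b))) \<le> \<alpha> * ((8 / 5) * \<mu>)"
      using \<alpha> by (simp add: \<mu>_def algebra_simps)
    then have "av (\<lambda>a. av (\<lambda>b. l3 a b)) - av (\<lambda>a. av (\<lambda>b. l2 a b)) \<le> (8 / 5) * \<mu>"
      using \<alpha> by (simp add: mult_le_cancel_left)
    then show ?thesis using m2 by simp
  qed
  have m4: "av (\<lambda>a. av (\<lambda>a'. l4 a a')) \<le> 12 * \<mu>"
  proof -
    have "av (\<lambda>a. av (\<lambda>a'. l4 a a')) * \<beta> = av (\<lambda>a. av (\<lambda>a'. av (\<lambda>b. l4 a a' * ?o (b \<in> B))))"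
      unfolding av_multc av_cmult \<beta>_def ..
    also have "\<dots> \<le> av (\<lambda>a. av (\<lambda>a'. av (\<lambda>b. ?o (a' \<in> A) * l3 a b + ?o (a \<in> A \<and> a' \<in> A \<and> b \<in> B \<and> \<not> H a a' b))))"
    proof (rule av3_mono)
      fix a a' b
      have "lab H p 4 (a, a') 0" if "lab H p 3 (b, a) 2" "H a a' b"
        using lab20[OF that(1)] triD[OF H that(2)] by simp
      then show "l4 a a' * ?o (b \<in> B) \<le> ?o (a' \<in> A) * l3 a b + ?o (a \<in> A \<and> a' \<in> A \<and> b \<in> B \<and> \<not> H a a' b)"
        unfolding l4_def l3_def by (auto simp: of_bool_def)
    qed
    also have "\<dots> = \<alpha> * av (\<lambda>a. av (\<lambda>b. l3 a b)) + av (\<lambda>a. av (\<lambda>a'. av (\<lambda>b. ?o (a \<in> A \<and> a' \<in> A \<and> b \<in> B \<and> \<not> H a a' b))))"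
      unfolding av_add av_cmult av_multc \<alpha>_def ..
    finally have *: "av (\<lambda>a. av (\<lambda>a'. l4 a a')) * \<beta> \<le> \<alpha> * av (\<lambda>a. av (\<lambda>b. l3 a b)) + \<mu>" using miss by linarith
    have "0 \<le> av (\<lambda>a. av (\<lambda>b. l3 a b))" "0 \<le> av (\<lambda>a. av (\<lambda>a'. l4 a a'))"
      unfolding l3_def l4_def by (intro av_nonneg; simp)+
    then have "av (\<lambda>a. av (\<lambda>a'. l4 a a')) * (1829 / 5000) \<le> av (\<lambda>a. av (\<lambda>a'. l4 a a')) * \<beta>"
       "\<alpha> * av (\<lambda>a. av (\<lambda>b. l3 a b)) \<le> (6341 / 10000) * ((49 / 10) * \<mu>)"
      using \<alpha> \<beta> m3 by - (rule mult_left_mono mult_mono; simp)+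
    then show ?thesis using * by (simp add: \<mu>_def)
  qed
  have "av (\<lambda>a. av (\<lambda>b. ?o (a \<in> A \<and> b \<in> B \<and> \<not> lab H p 5 (a, b) 1))) \<le> av (\<lambda>a. av (\<lambda>b. l2 a b))"
    unfolding l2_def by (intro av2_mono) (use lab_mono[of H p 2] in \<open>auto simp: of_bool_def\<close>)
  moreover have "av (\<lambda>a. av (\<lambda>b. ?o (a \<in> A \<and> b \<in> B \<and> \<not> lab H p 5 (b, a) 2))) \<le> av (\<lambda>a. av (\<lambda>b. l3 a b))"
    unfolding l3_def by (intro av2_mono) (use lab_mono[of H p 3] in \<open>auto simp: of_bool_def\<close>)
  moreover have "av (\<lambda>a. av (\<lambda>a'. ?o (a \<in> A \<and> a' \<in> A \<and> \<not> lab H p 5 (a, a') 0))) \<le> av (\<lambda>a. av (\<lambda>a'. l4 a a'))"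
    unfolding l4_def by (intro av2_mono) (use lab_mono[of H p 4] in \<open>auto simp: of_bool_def\<close>)
  ultimately show ?thesis using that[of p] m2 m3 m4 by (simp add: \<mu>_def)
qed

text \<open>In terms of the colouring, z sends red arcs to its sinks, is blue to its twins and
  receives red arcs from its sources. Vertices behaving like \<open>B\<close> have many sinks, those
  behaving like \<open>A\<close> many twins and sources. The bound 7 allows two steps after a core
  label.\<close>

definition sinks :: "('a \<Rightarrow> 'a \<Rightarrow> 'a \<Rightarrow> bool) \<Rightarrow> 'a \<times> 'a \<Rightarrow> 'a set \<Rightarrow> 'a \<Rightarrow> 'a set" where
  "sinks H p A z = {a \<in> A. lab H p 7 (z, a) 2 \<and> lab H p 7 (a, z) 1}"

definition twins :: "('a \<Rightarrow> 'a \<Rightarrow> 'a \<Rightarrow> bool) \<Rightarrow> 'a \<times> 'a \<Rightarrow> 'a set \<Rightarrow> 'a \<Rightarrow> 'a set" where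
  "twins H p A z = {a \<in> A. lab H p 7 (z, a) 0 \<and> lab H p 7 (a, z) 0}"

definition sources :: "('a \<Rightarrow> 'a \<Rightarrow> 'a \<Rightarrow> bool) \<Rightarrow> 'a \<times> 'a \<Rightarrow> 'a set \<Rightarrow> 'a \<Rightarrow> 'a set" where
  "sources H p B z = {b \<in> B. lab H p 7 (z, b) 1 \<and> lab H p 7 (b, z) 2}"

text \<open>P, R and y stand for the measures of sinks, twins and sources. Suppose P < 1 / 2. If R
  is at most \<beta>, eliminating y by 2 * R * y - y^2 \<le> R^2 leaves P^2 + R^2, which convexity
  in R shows to be too small. If R exceeds \<beta>, the bound increases up to y = \<beta>, where it
  is at most 2 * \<alpha> * \<beta> - (\<alpha> - R) * (2 * \<beta> - (\<alpha> - R)). Since 2 *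
  \<alpha> * \<beta> hardly exceeds 4639 / 10000, both \<alpha> - R and \<beta> - y must be
  small.\<close>

lemma dichotomy_arith:
  fixes \<alpha> \<beta> P R y :: real
  assumes \<alpha>: "(3169 / 5000) \<le> \<alpha>" "\<alpha> \<le> (6341 / 10000)" and \<beta>: "(1829 / 5000) \<le> \<beta>" "\<beta> \<le> (1831 / 5000)"
    and P: "0 \<le> P" and R: "0 \<le> R" and PR: "P + R \<le> \<alpha>" and y: "0 \<le> y" "y \<le> \<beta>"
    and main: "(4639 / 10000) \<le> P * P + 2 * (R * y) + (\<beta> * \<beta> - y * y)"
  shows "(1 / 2) \<le> P \<or> (\<alpha> - (1 / 50) \<le> R \<and> \<beta> - (1 / 50) \<le> y)"
proof (cases "(1 / 2) \<le> P")
  case False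
  have \<beta>2: "\<beta> * \<beta> \<le> (13411 / 100000)" using mult_mono[OF \<beta>(2) \<beta>(2)] \<beta> by simp
  have PP: "P * P \<le> (\<alpha> - R) * (\<alpha> - R)" using P PR by (intro mult_mono) auto
  have P5: "P * P \<le> (1 / 2) * (1 / 2)" using False P by (intro mult_mono) auto
  show ?thesis
  proof (cases "R \<le> \<beta>")
    case True
    have "0 \<le> (R - y) * (R - y)" by simp
    then have "2 * (R * y) - y * y \<le> R * R" by (simp add: algebra_simps)
    then have s: "(3297 / 10000) \<le> P * P + R * R" using main \<beta>2 by simp
    have "(7 / 25) \<le> R"
    proof (rule ccontr)
      assume "\<not> ?thesis"
      then have "R * R \<le> (7 / 25) * (7 / 25)" using R by (intro mult_mono) auto
      then show False using s P5 by simp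
    qed
    then have "0 \<le> (R - (7 / 25)) * ((1831 / 5000) - R)" using True \<beta> by simp
    then have "R * R \<le> (3231 / 5000) * R - (12817 / 125000)" by (simp add: field_simps)
    moreover have "(\<alpha> - R) * (\<alpha> - R) \<le> ((6341 / 10000) - R) * ((6341 / 10000) - R)" using \<alpha> True \<beta> by (intro mult_mono) auto
    then have "P * P \<le> (40209 / 100000) - (6341 / 5000) * R + R * R" using PP by (simp add: field_simps)
    ultimately show ?thesis using s True \<beta> by simp
  next
    case R\<beta>: False
    have "0 \<le> (\<beta> - y) * (2 * R - \<beta> - y)" using y R\<beta> by (intro mult_nonneg_nonneg) auto
    then have yb: "2 * (R * y) - y * y \<le> 2 * (R * \<beta>) - \<beta> * \<beta>" by (simp add: algebra_simps)
    have ab: "\<alpha> * \<beta> \<le> (6341 / 10000) * (1831 / 5000)" using \<alpha> \<beta> by (intro mult_mono) auto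
    have Rlb: "\<alpha> - (1 / 50) \<le> R"
    proof (rule ccontr)
      assume "\<not> ?thesis"
      then have D: "(1 / 50) \<le> \<alpha> - R" "\<alpha> - R \<le> (2683 / 10000)" using R\<beta> \<alpha> \<beta> by auto
      have "(1 / 50) * (23 / 50) \<le> (\<alpha> - R) * (2 * \<beta> - (\<alpha> - R))" using D \<beta> by (intro mult_mono) auto
      moreover have "(\<alpha> - R) * (\<alpha> - R) + 2 * (R * \<beta>) = 2 * (\<alpha> * \<beta>) - (\<alpha> - R) * (2 * \<beta> - (\<alpha> - R))"
        by (simp add: algebra_simps)
      ultimately show False using main yb PP ab by simp
    qed
    then have "P * P \<le> (1 / 50) * (1 / 50)" using P PR by (intro mult_mono) auto
    moreover have "R * \<beta> \<le> \<alpha> * \<beta>" using PR P \<beta> by (intro mult_right_mono) auto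
    moreover have "(\<beta> - y) * (2 * R - \<beta> - y) = 2 * (R * \<beta>) - \<beta> * \<beta> - (2 * (R * y) - y * y)"
      by (simp add: algebra_simps)
    ultimately have "(\<beta> - y) * (2 * R - \<beta> - y) \<le> (1 / 500)" using main ab by simp
    moreover have "(\<beta> - y) * (2 / 5) \<le> (\<beta> - y) * (2 * R - \<beta> - y)"
      using y Rlb \<alpha> \<beta> by (intro mult_left_mono) auto
    ultimately show ?thesis using Rlb by simp
  qed
qed simp

text \<open>An edge z u t carries the labels of (u, t) and (t, u) over to the pairs at z: if u and t
  are in \<open>A\<close>, both become sinks; if one is in \<open>A\<close> and one in
  \<open>B\<close>, they become a twin and a source. Two sources cannot form an edge with z, as one
  pair would get the labels 2 and 0. Counting the link of z in this way yields the inequality of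
  \<open>dichotomy_arith\<close>.\<close>

lemma vertex_dichotomy:
  assumes H: "tri V H" and free: "walk_free L H" and L: "40 \<le> L"
    and A: "approx_structure (1 / 10 ^ 6) H A B"
    and e1: "av (\<lambda>a. av (\<lambda>b. of_bool (a \<in> A \<and> b \<in> B \<and> \<not> lab H p 5 (a, b) 1))) \<le> 12 / 10 ^ 6"
    and e2: "av (\<lambda>a. av (\<lambda>b. of_bool (a \<in> A \<and> b \<in> B \<and> \<not> lab H p 5 (b, a) 2))) \<le> 12 / 10 ^ 6"
    and e0: "av (\<lambda>a. av (\<lambda>a'. of_bool (a \<in> A \<and> a' \<in> A \<and> \<not> lab H p 5 (a, a') 0))) \<le> 12 / 10 ^ 6"
    and z: "z \<in> V" and dz: "(58 / 125) \<le> deg H z"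
  shows "ms (sinks H p A z) + ms (twins H p A z) \<le> ms A"
    and "(1 / 2) \<le> ms (sinks H p A z) \<or>
      (ms A - (1 / 50) \<le> ms (twins H p A z) \<and> ms B - (1 / 50) \<le> ms (sources H p B z))"
proof -
  let ?o = "\<lambda>P. of_bool P :: real"
  define \<alpha> where "\<alpha> = ms A"
  define \<beta> where "\<beta> = ms B"
  define P where "P = sinks H p A z"
  define R where "R = twins H p A z"
  define S where "S = sources H p B z"
  define W where "W = V - A - B"
  have \<alpha>: "(3169 / 5000) \<le> \<alpha>" "\<alpha> \<le> (6341 / 10000)" and AV: "A \<subseteq> V" "B \<subseteq> V" "A \<inter> B = {}"
    and ab: "1 - 1 / 10 ^ 6 \<le> \<alpha> + \<beta>"
    using A unfolding approx_structure_def \<alpha>_def \<beta>_def by auto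
  have one: "\<alpha> + \<beta> + ms W = 1"
  proof -
    have "\<alpha> + \<beta> + ms W = av (\<lambda>_. 1)"
      unfolding \<alpha>_def \<beta>_def av_add[symmetric] W_def by (rule av_cong) (use AV in \<open>auto simp: of_bool_def\<close>)
    then show ?thesis by (simp add: av_const)
  qed
  have W: "0 \<le> ms W" "ms W \<le> 1 / 10 ^ 6" using one ab ms_nonneg[of W] by auto
  have \<beta>: "(1829 / 5000) \<le> \<beta>" "\<beta> \<le> (1831 / 5000)" using \<alpha> ab one W by simp_all
  have uniq: "t = t'" if "lab H p k q t" "lab H p k' q t'" "k + 2 * k' \<le> 40" for k k' q t t'
    using lab_unique[OF H free that(1,2)] that(3) L by simp
  show PR: "ms (sinks H p A z) + ms (twins H p A z) \<le> ms A"
    unfolding av_add[symmetric]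
  proof (rule av_mono)
    fix v
    have "\<not> (lab H p 7 (z, v) 2 \<and> lab H p 7 (z, v) 0)" using uniq[of 7 "(z, v)" 2 7 0] by auto
    then show "?o (v \<in> sinks H p A z) + ?o (v \<in> twins H p A z) \<le> ?o (v \<in> A)"
      unfolding sinks_def twins_def by (auto simp: of_bool_def)
  qed
  define y where "y = ms S"
  have y: "0 \<le> y" "y \<le> \<beta>" unfolding y_def \<beta>_def by (rule ms_nonneg, rule ms_mono) (simp add: S_def sources_def)
  define l0 where "l0 = (\<lambda>a a'. a \<in> A \<and> a' \<in> A \<and> \<not> lab H p 5 (a, a') 0)"
  define l1 where "l1 = (\<lambda>a b. a \<in> A \<and> b \<in> B \<and> \<not> lab H p 5 (a, b) 1)"
  define l2 where "l2 = (\<lambda>a b. a \<in> A \<and> b \<in> B \<and> \<not> lab H p 5 (b, a) 2)"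
  have P_I: "u \<in> P" if "u \<in> A" "H z u t" "lab H p 5 (u, t) 0" "lab H p 5 (t, u) 0" for u t
  proof -
    note D = triD[OF H that(2)]
    have "lab H p 6 (t, z) 1" using lab01[OF that(3) D(3)] by simp
    then have "lab H p 7 (z, u) 2" using lab12 D by fastforce
    moreover have "lab H p 7 (u, z) 1" using lab01[OF that(4) D(5)] by simp
    ultimately show ?thesis using that(1) unfolding P_def sinks_def by simp
  qed
  have RS_I: "u \<in> R \<and> t \<in> S" if "u \<in> A" "t \<in> B" "H z u t" "lab H p 5 (u, t) 1" "lab H p 5 (t, u) 2" for u t
  proof -
    note D = triD[OF H that(3)]
    have 1: "lab H p 6 (t, z) 2" using lab12[OF that(4) D(3)] by simp
    then have 2: "lab H p 7 (z, u) 0" using lab20 D by fastforce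
    have 3: "lab H p 6 (u, z) 0" using lab20[OF that(5) D(5)] by simp
    then have 4: "lab H p 7 (z, t) 1" using lab01 D by fastforce
    show ?thesis using that(1,2) 2 4 lab_mono[OF 1, of 7] lab_mono[OF 3, of 7]
      unfolding R_def S_def twins_def sources_def by simp
  qed
  have SS: False if "u \<in> S" "t \<in> S" "H z u t" for u t
  proof -
    have "lab H p 7 (z, u) 1" "lab H p 7 (t, z) 2" using that unfolding S_def sources_def by auto
    moreover from this(1) have "lab H p 8 (u, t) 2" using lab12 that(3) by fastforce
    then have "lab H p 9 (t, z) 0" using lab20 triD(3)[OF H that(3)] by fastforce
    ultimately show False using uniq[of 7 "(t, z)" 2 9 0] by auto
  qed
  have PA: "P \<subseteq> A" "R \<subseteq> A" "S \<subseteq> B" unfolding P_def R_def S_def sinks_def twins_def sources_def by auto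
  have "deg H z \<le> av (\<lambda>u. av (\<lambda>t. ?o (u \<in> P) * ?o (t \<in> P) + ?o (u \<in> R) * ?o (t \<in> S) + ?o (u \<in> S) * ?o (t \<in> R)
     + (?o (u \<in> B) * ?o (t \<in> B) - ?o (u \<in> S) * ?o (t \<in> S))
     + (?o (u \<in> W) + ?o (t \<in> W) + ?o (l0 u t) + ?o (l0 t u) + ?o (l1 u t) + ?o (l2 u t) + ?o (l1 t u) + ?o (l2 t u))))"
    unfolding deg_def
  proof (rule av2_mono)
    fix u t assume ut: "u \<in> V" "t \<in> V"
    define err where "err = ?o (u \<in> W) + ?o (t \<in> W) + ?o (l0 u t) + ?o (l0 t u) + ?o (l1 u t) + ?o (l2 u t) + ?o (l1 t u) + ?o (l2 t u)"
    have err0: "0 \<le> err" unfolding err_def by (simp add: add_nonneg_nonneg)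
    define T1 where "T1 = ?o (u \<in> P) * ?o (t \<in> P)"
    define T2 where "T2 = ?o (u \<in> R) * ?o (t \<in> S)"
    define T3 where "T3 = ?o (u \<in> S) * ?o (t \<in> R)"
    define T4 where "T4 = ?o (u \<in> B) * ?o (t \<in> B) - ?o (u \<in> S) * ?o (t \<in> S)"
    have T0: "0 \<le> T1" "0 \<le> T2" "0 \<le> T3" unfolding T1_def T2_def T3_def by simp_all
    have T4: "0 \<le> T4" unfolding T4_def using PA by (auto simp: of_bool_def)
    have H1: "?o (H z u t) \<le> 1" by simp
    have "1 \<le> T1 + T2 + T3 + T4 + err" if hzut: "H z u t"
    proof -
      note D = triD[OF H hzut]
      have big: "1 \<le> err" if "u \<in> W \<or> t \<in> W \<or> l0 u t \<or> l0 t u \<or> l1 u t \<or> l2 u t \<or> l1 t u \<or> l2 t u"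
        using that unfolding err_def by (elim disjE) (simp_all add: add_nonneg_nonneg)
      consider "u \<in> W \<or> t \<in> W \<or> l0 u t \<or> l0 t u \<or> l1 u t \<or> l2 u t \<or> l1 t u \<or> l2 t u"
        | "u \<in> A" "t \<in> A" "\<not> l0 u t" "\<not> l0 t u" | "u \<in> A" "t \<in> B" "\<not> l1 u t" "\<not> l2 u t"
        | "u \<in> B" "t \<in> A" "\<not> l1 t u" "\<not> l2 t u" | "u \<in> B" "t \<in> B"
        using ut unfolding W_def by blast
      then show ?thesis
      proof cases
        case 1
        then show ?thesis using big T0 T4 by linarith
      next
        case 2
        then have "u \<in> P" "t \<in> P" using P_I[of u t] P_I[of t u] hzut D unfolding l0_def by auto
        then have "T1 = 1" unfolding T1_def by simp
        then show ?thesis using T0 T4 err0 by linarith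
      next
        case 3
        then have "u \<in> R" "t \<in> S" using RS_I[of u t] hzut D unfolding l1_def l2_def by auto
        then have "T2 = 1" unfolding T2_def by simp
        then show ?thesis using T0 T4 err0 by linarith
      next
        case 4
        then have "t \<in> R" "u \<in> S" using RS_I[of t u] hzut D unfolding l1_def l2_def by auto
        then have "T3 = 1" unfolding T3_def by simp
        then show ?thesis using T0 T4 err0 by linarith
      next
        case 5
        then have "T4 = 1" unfolding T4_def using SS[of u t] hzut by (auto simp: of_bool_def)
        then show ?thesis using T0 T4 err0 by linarith
      qed
    qed
    then have "?o (H z u t) \<le> T1 + T2 + T3 + T4 + err"
      using T0 T4 err0 by (cases "H z u t") auto
    then show "?o (H z u t) \<le> ?o (u \<in> P) * ?o (t \<in> P) + ?o (u \<in> R) * ?o (t \<in> S) + ?o (u \<in> S) * ?o (t \<in> R)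
     + (?o (u \<in> B) * ?o (t \<in> B) - ?o (u \<in> S) * ?o (t \<in> S))
     + (?o (u \<in> W) + ?o (t \<in> W) + ?o (l0 u t) + ?o (l0 t u) + ?o (l1 u t) + ?o (l2 u t) + ?o (l1 t u) + ?o (l2 t u))"
      unfolding err_def T1_def T2_def T3_def T4_def .
  qed
  also have "\<dots> = ms P * ms P + ms R * y + y * ms R + (\<beta> * \<beta> - y * y)
     + (ms W + ms W + av (\<lambda>u. av (\<lambda>t. ?o (l0 u t))) + av (\<lambda>u. av (\<lambda>t. ?o (l0 t u)))
       + av (\<lambda>u. av (\<lambda>t. ?o (l1 u t))) + av (\<lambda>u. av (\<lambda>t. ?o (l2 u t)))
       + av (\<lambda>u. av (\<lambda>t. ?o (l1 t u))) + av (\<lambda>u. av (\<lambda>t. ?o (l2 t u))))"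
    unfolding av_add av_diff av_cmult av_multc av_const y_def \<beta>_def ..
  \<comment> \<open>Two terms for \<open>W\<close> and six for wrong labels: 2 * 1 + 6 * 12 =
    74.\<close>
  also have "\<dots> \<le> ms P * ms P + 2 * (ms R * y) + (\<beta> * \<beta> - y * y) + 74 / 10 ^ 6"
    using W e0 e1 e2 av_swap[of "\<lambda>u t. ?o (l0 t u)"] av_swap[of "\<lambda>u t. ?o (l1 t u)"] av_swap[of "\<lambda>u t. ?o (l2 t u)"]
    unfolding l0_def[symmetric] l1_def[symmetric] l2_def[symmetric] by (simp add: l0_def l1_def l2_def mult.commute)
  finally have "(4639 / 10000) \<le> ms P * ms P + 2 * (ms R * y) + (\<beta> * \<beta> - y * y)" using dz by simp
  from dichotomy_arith[OF \<alpha> \<beta> ms_nonneg ms_nonneg PR[folded \<alpha>_def P_def R_def] y this]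
  show "(1 / 2) \<le> ms (sinks H p A z) \<or>
      (ms A - (1 / 50) \<le> ms (twins H p A z) \<and> ms B - (1 / 50) \<le> ms (sources H p B z))"
    unfolding P_def R_def \<alpha>_def \<beta>_def y_def S_def .
qed

end

section \<open>Exact structure of a minimal counterexample\<close>

context weighted
begin

text \<open>Edges inside \<open>A'\<close> and edges with one vertex in \<open>A'\<close> and two in
  \<open>B'\<close> contain pairs with a wrong label. Such pairs, of total measure \<open>N\<close>
  inside \<open>A'\<close> and \<open>Gt\<close> between the parts, in turn exclude many edges of
  type \<open>A'A'B'\<close>. The constants make the excluded ones prevail, after which the bound
  for the proper part \<open>B'\<close> finishes.\<close>

lemma no_extremal_counterexample:
  assumes H: "tri V H" and free: "walk_free L H" and L: "40 \<le> L"
    and struct: "approx_structure (1 / 10 ^ 6) H A B"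
    and tot: "edens H > tdc + \<gamma>"
    and sub: "\<And>B. B \<subseteq> V \<Longrightarrow> B \<noteq> V \<Longrightarrow>
       edens (\<lambda>a b c. a \<in> B \<and> b \<in> B \<and> c \<in> B \<and> H a b c) \<le> tdc * ms B ^ 3 + \<gamma>"
    and degH: "\<And>v. v \<in> V \<Longrightarrow> deg H v \<ge> (58 / 125)"
  shows False
proof -
  let ?o = "\<lambda>P. of_bool P :: real"
  obtain p where
    e1: "av (\<lambda>a. av (\<lambda>b. ?o (a \<in> A \<and> b \<in> B \<and> \<not> lab H p 5 (a, b) 1))) \<le> 12 / 10 ^ 6" and
    e2: "av (\<lambda>a. av (\<lambda>b. ?o (a \<in> A \<and> b \<in> B \<and> \<not> lab H p 5 (b, a) 2))) \<le> 12 / 10 ^ 6" and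
    e0: "av (\<lambda>a. av (\<lambda>a'. ?o (a \<in> A \<and> a' \<in> A \<and> \<not> lab H p 5 (a, a') 0))) \<le> 12 / 10 ^ 6"
    using core_labels[OF H struct] by blast
  define \<alpha> where "\<alpha> = ms A"
  define \<beta> where "\<beta> = ms B"
  define P where "P = sinks H p A"
  define R where "R = twins H p A"
  define S where "S = sources H p B"
  have \<alpha>: "(3169 / 5000) \<le> \<alpha>" "\<alpha> \<le> (6341 / 10000)" and AV: "A \<subseteq> V" "B \<subseteq> V" "A \<inter> B = {}"
    and ab: "1 - 1 / 10 ^ 6 \<le> \<alpha> + \<beta>"
    using struct unfolding approx_structure_def \<alpha>_def \<beta>_def by auto
  have \<beta>: "(1829 / 5000) \<le> \<beta>" using \<alpha> ab by simp
  note dich = vertex_dichotomy[OF H free L struct e1 e2 e0 _ degH]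
  have PR: "ms (P z) + ms (R z) \<le> \<alpha>" if "z \<in> V" for z
    using dich(1)[OF that that] unfolding P_def R_def \<alpha>_def .
  have uniq: "t = t'" if "lab H p k q t" "lab H p k' q t'" "k + 2 * k' \<le> 40" for k k' q t t'
    using lab_unique[OF H free that(1,2)] that(3) L by simp
  have mono: "lab H p k q t \<Longrightarrow> k \<le> k' \<Longrightarrow> lab H p k' q t" for k k' q t by (rule lab_mono)

  define A' where "A' = {z \<in> V. \<alpha> - (1 / 50) \<le> ms (R z) \<and> \<beta> - (1 / 50) \<le> ms (S z)}"
  define B' where "B' = V - A'"
  define a where "a = ms A'"
  define b where "b = ms B'"
  have P_half: "(1 / 2) \<le> ms (P z)" if "z \<in> B'" for z
    using dich(2)[of z] that unfolding B'_def A'_def P_def R_def S_def \<alpha>_def \<beta>_def by auto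
  have ab1: "a + b = 1"
  proof -
    have "a + b = av (\<lambda>_. 1)"
      unfolding a_def b_def av_add[symmetric] by (rule av_cong) (auto simp: B'_def)
    then show ?thesis by (simp add: av_const)
  qed
  \<comment> \<open>A vertex of \<open>A - A'\<close> has at least 1 / 2 sinks, hence few twins, so
    its defects of label 0 towards \<open>A\<close> in the two directions sum to at least 1 / 2; in
    total only 24 / 10^6 is available. \<open>A'B\<close> is the analogue with few sinks.\<close>
  have AA': "ms (A - A') \<le> 48 / 10 ^ 6"
  proof -
    define f where "f = (\<lambda>z. av (\<lambda>v. ?o (v \<in> A \<and> \<not> lab H p 5 (z, v) 0) + ?o (v \<in> A \<and> \<not> lab H p 5 (v, z) 0)))"
    have "ms (A - A') * (1 / 2) \<le> av (\<lambda>z. ?o (z \<in> A - A') * f z)"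
    proof (rule av_bound_indicator_ge)
      fix z assume z: "z \<in> V" "z \<in> A - A'"
      then have "(1 / 2) \<le> ms (P z)" using P_half unfolding B'_def by blast
      then have R: "ms (R z) \<le> \<alpha> - (1 / 2)" using PR[OF z(1)] by simp
      have "\<alpha> \<le> ms (R z) + f z" unfolding \<alpha>_def f_def av_add[symmetric]
      proof (rule av_mono)
        fix v
        show "?o (v \<in> A) \<le> ?o (v \<in> R z) + (?o (v \<in> A \<and> \<not> lab H p 5 (z, v) 0) + ?o (v \<in> A \<and> \<not> lab H p 5 (v, z) 0))"
          using mono[of 5 "(z, v)" 0 7] mono[of 5 "(v, z)" 0 7] unfolding R_def twins_def by auto
      qed
      then show "(1 / 2) \<le> f z" using R by simp
    qed
    also have "\<dots> \<le> av (\<lambda>z. av (\<lambda>v. ?o (z \<in> A \<and> v \<in> A \<and> \<not> lab H p 5 (z, v) 0) + ?o (v \<in> A \<and> z \<in> A \<and> \<not> lab H p 5 (v, z) 0)))"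
      unfolding f_def av_cmult[symmetric] by (intro av2_mono) auto
    also have "\<dots> \<le> 24 / 10 ^ 6"
      unfolding av_add using e0 av_swap[of "\<lambda>z v. ?o (v \<in> A \<and> z \<in> A \<and> \<not> lab H p 5 (v, z) 0)"] by simp
    finally show ?thesis by simp
  qed
  have A'B: "ms (A' \<inter> B) \<le> 40 / 10 ^ 6"
  proof -
    define f where "f = (\<lambda>z. av (\<lambda>v. ?o (v \<in> A \<and> \<not> lab H p 5 (z, v) 2) + ?o (v \<in> A \<and> \<not> lab H p 5 (v, z) 1)))"
    have "ms (A' \<inter> B) * (3 / 5) \<le> av (\<lambda>z. ?o (z \<in> A' \<inter> B) * f z)"
    proof (rule av_bound_indicator_ge)
      fix z assume z: "z \<in> V" "z \<in> A' \<inter> B"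
      then have "\<alpha> - (1 / 50) \<le> ms (R z)" unfolding A'_def by blast
      then have Pz: "ms (P z) \<le> (1 / 50)" using PR[OF z(1)] by simp
      have "\<alpha> \<le> ms (P z) + f z" unfolding \<alpha>_def f_def av_add[symmetric]
      proof (rule av_mono)
        fix v
        show "?o (v \<in> A) \<le> ?o (v \<in> P z) + (?o (v \<in> A \<and> \<not> lab H p 5 (z, v) 2) + ?o (v \<in> A \<and> \<not> lab H p 5 (v, z) 1))"
          using mono[of 5 "(z, v)" 2 7] mono[of 5 "(v, z)" 1 7] unfolding P_def sinks_def by auto
      qed
      then show "(3 / 5) \<le> f z" using Pz \<alpha> by simp
    qed
    also have "\<dots> \<le> av (\<lambda>z. av (\<lambda>v. ?o (v \<in> A \<and> z \<in> B \<and> \<not> lab H p 5 (z, v) 2) + ?o (v \<in> A \<and> z \<in> B \<and> \<not> lab H p 5 (v, z) 1)))"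
      unfolding f_def av_cmult[symmetric] by (intro av2_mono) auto
    also have "\<dots> \<le> 24 / 10 ^ 6"
      unfolding av_add using e1 e2 av_swap[of "\<lambda>z v. ?o (v \<in> A \<and> z \<in> B \<and> \<not> lab H p 5 (z, v) 2)"]
        av_swap[of "\<lambda>z v. ?o (v \<in> A \<and> z \<in> B \<and> \<not> lab H p 5 (v, z) 1)"] by simp
    finally show ?thesis by simp
  qed
  have a_lb: "(633 / 1000) \<le> a"
  proof -
    have "\<alpha> \<le> a + ms (A - A')" unfolding \<alpha>_def a_def av_add[symmetric] by (rule av_mono) auto
    then show ?thesis using AA' \<alpha> by simp
  qed
  have a_ub: "a \<le> (127 / 200)"
  proof -
    have "a + \<beta> \<le> 1 + ms (A' \<inter> B)"
    proof -
      have "a + \<beta> \<le> av (\<lambda>v. 1 + ?o (v \<in> A' \<inter> B))"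
        unfolding a_def \<beta>_def av_add[symmetric] by (rule av_mono) auto
      then show ?thesis by (simp add: av_simps)
    qed
    then show ?thesis using A'B ab \<alpha> by simp
  qed
  have RA': "a - (107 / 5000) \<le> ms (R z \<inter> A')" "(61 / 100) \<le> ms (R z \<inter> A')" if "z \<in> A'" for z
  proof -
    have "ms (R z) \<le> ms (R z \<inter> A') + ms (A - A')"
      unfolding av_add[symmetric] by (rule av_mono) (auto simp: R_def twins_def)
    moreover have "\<alpha> - (1 / 50) \<le> ms (R z)" using that unfolding A'_def by blast
    ultimately show "a - (107 / 5000) \<le> ms (R z \<inter> A')" "(61 / 100) \<le> ms (R z \<inter> A')" using AA' \<alpha> a_ub by simp_all
  qed
  have PA': "(4999 / 10000) \<le> ms (P z \<inter> A')" if "z \<in> B'" for z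
  proof -
    have "ms (P z) \<le> ms (P z \<inter> A') + ms (A - A')"
      unfolding av_add[symmetric] by (rule av_mono) (auto simp: P_def sinks_def)
    then show ?thesis using AA' P_half[OF that] by simp
  qed
  have SB': "(17 / 50) \<le> ms (S z \<inter> B')" if "z \<in> A'" for z
  proof -
    have "ms (S z) \<le> ms (S z \<inter> B') + ms (A' \<inter> B)"
      unfolding av_add[symmetric] by (rule av_mono) (auto simp: S_def sources_def B'_def)
    moreover have "\<beta> - (1 / 50) \<le> ms (S z)" using that unfolding A'_def by blast
    ultimately show ?thesis using A'B \<beta> by simp
  qed

  define nb where "nb = (\<lambda>z z'. z \<in> A' \<and> z' \<in> A' \<and> \<not> lab H p 9 (z, z') 0)"
  define pr where "pr = (\<lambda>z v. lab H p 9 (z, v) 1 \<and> lab H p 9 (v, z) 2)"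
  define N where "N = av (\<lambda>z. av (\<lambda>z'. ?o (nb z z')))"
  define g where "g = (\<lambda>v. av (\<lambda>z. ?o (z \<in> A' \<and> \<not> pr z v)))"
  define Gt where "Gt = av (\<lambda>v. ?o (v \<in> B') * g v)"
  define EA where "EA = edens (\<lambda>x y z. x \<in> A' \<and> y \<in> A' \<and> z \<in> A' \<and> H x y z)"
  define EB where "EB = edens (\<lambda>x y z. x \<in> B' \<and> y \<in> B' \<and> z \<in> B' \<and> H x y z)"
  define EAAB where "EAAB = edens (\<lambda>x y z. x \<in> A' \<and> y \<in> A' \<and> z \<in> B' \<and> H x y z)"
  define EABB where "EABB = edens (\<lambda>x y z. x \<in> A' \<and> y \<in> B' \<and> z \<in> B' \<and> H x y z)"
  define M where "M = edens (\<lambda>x y z. x \<in> A' \<and> y \<in> A' \<and> z \<in> B' \<and> \<not> H x y z)"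
  have N0: "0 \<le> N" unfolding N_def by (intro av_nonneg) simp
  have g0: "0 \<le> g v" for v unfolding g_def by (intro av_nonneg) simp
  have G0: "0 \<le> Gt" unfolding Gt_def using g0 by (intro av_nonneg) simp

  \<comment> \<open>Two consecutive pairs around an edge inside \<open>A'\<close> are always in
    \<open>nb\<close>: if some pair has label 0, the next two have labels 1 and 2. Twins leave each
    y at most 11 / 500 of successors in \<open>nb\<close>.\<close>
  have EA_le: "EA \<le> (33 / 500) * N"
  proof -
    define K where "K = (\<lambda>x y t. nb x y \<and> nb y t)"
    have "edens K \<le> av (\<lambda>x. av (\<lambda>y. ?o (nb x y) * (11 / 500)))"
      unfolding edens_def
    proof (rule av2_mono)
      fix x y
      have "av (\<lambda>t. ?o (nb y t)) \<le> (11 / 500)" if "y \<in> A'"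
      proof -
        have "av (\<lambda>t. ?o (nb y t)) + ms (R y \<inter> A') \<le> a"
          unfolding a_def av_add[symmetric]
        proof (rule av_mono)
          fix v
          show "?o (nb y v) + ?o (v \<in> R y \<inter> A') \<le> ?o (v \<in> A')"
            using mono[of 7 "(y, v)" 0 9] unfolding nb_def R_def twins_def by (auto simp: of_bool_def)
        qed
        then show ?thesis using RA'(1)[OF that] by simp
      qed
      then show "av (\<lambda>t. ?o (K x y t)) \<le> ?o (nb x y) * (11 / 500)"
        unfolding K_def by (cases "nb x y") (auto simp: nb_def av_const)
    qed
    then have K_le: "edens K \<le> (11 / 500) * N" unfolding av_multc N_def by simp
    have "EA \<le> av (\<lambda>x. av (\<lambda>y. av (\<lambda>t. ?o (K x y t) + ?o (K t x y) + ?o (K y t x))))"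
      unfolding EA_def edens_def
    proof (rule av3_mono)
      fix x y t
      show "?o (x \<in> A' \<and> y \<in> A' \<and> t \<in> A' \<and> H x y t) \<le> ?o (K x y t) + ?o (K t x y) + ?o (K y t x)"
      proof (cases "x \<in> A' \<and> y \<in> A' \<and> t \<in> A' \<and> H x y t")
        case True
        have *: "nb v u" if "H x' v u" "lab H p 9 (x', v) 0" "v \<in> A'" "u \<in> A'" for x' v u
        proof -
          have "lab H p 10 (v, u) 1" using lab01[OF that(2,1)] by simp
          then show ?thesis using uniq[of 10 "(v, u)" 1 9 0] that unfolding nb_def by auto
        qed
        have **: "nb u x'" if "H x' v u" "lab H p 9 (x', v) 0" "x' \<in> A'" "u \<in> A'" for x' v u
        proof -
          have "lab H p 10 (v, u) 1" using lab01[OF that(2,1)] by simp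
          then have "lab H p 11 (u, x') 2" using lab12 triD[OF H that(1)] by fastforce
          then show ?thesis using uniq[of 11 "(u, x')" 2 9 0] that unfolding nb_def by auto
        qed
        have "K x y t \<or> K t x y \<or> K y t x"
        proof (rule ccontr)
          assume n: "\<not> ?thesis"
          have m: "x \<in> A'" "y \<in> A'" "t \<in> A'" and h: "H x y t" using True by auto
          note h2 = triD(3)[OF H h] triD(4)[OF H h]
          consider "lab H p 9 (x, y) 0" | "lab H p 9 (y, t) 0" | "nb x y" "nb y t"
            using m unfolding nb_def by blast
          then show False
          proof cases
            case 1
            from *[OF h 1 m(2,3)] **[OF h 1 m(1,3)] n show False unfolding K_def by blast
          next
            case 2
            from *[OF h2(1) 2 m(3,1)] **[OF h2(1) 2 m(2,1)] n show False unfolding K_def by blast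
          next
            case 3
            then show False using n unfolding K_def by blast
          qed
        qed
        then show ?thesis by (elim disjE) (simp_all add: add_nonneg_nonneg)
      qed (simp add: add_nonneg_nonneg)
    qed
    also have "\<dots> = edens K + edens K + edens K"
      unfolding av_add av3_rot[of "\<lambda>x y t. ?o (K x y t)"]
        av3_rot[of "\<lambda>x y t. ?o (K y t x)", symmetric] edens_def by simp
    finally show ?thesis using K_le by simp
  qed

  \<comment> \<open>If both pairs at z had the right labels, (y, z) would have label 2 and, by
    walking on from (z, x), also label 0.\<close>
  have EABB_le: "EABB \<le> 2 * (b * Gt)"
  proof -
    have "EABB \<le> av (\<lambda>z. av (\<lambda>x. av (\<lambda>y. ?o (x \<in> B' \<and> z \<in> A' \<and> \<not> pr z x) * ?o (y \<in> B') + ?o (x \<in> B') * ?o (y \<in> B' \<and> z \<in> A' \<and> \<not> pr z y))))"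
      unfolding EABB_def edens_def
    proof (rule av3_mono)
      fix z x y
      have "\<not> (pr z x \<and> pr z y)" if h: "H z x y"
      proof
        assume "pr z x \<and> pr z y"
        then have l: "lab H p 9 (z, x) 1" "lab H p 9 (y, z) 2" unfolding pr_def by auto
        have "lab H p 10 (x, y) 2" using lab12[OF l(1) h] by simp
        then have "lab H p 11 (y, z) 0" using lab20 triD[OF H h] by fastforce
        then show False using uniq[OF _ l(2), of 11 0] by auto
      qed
      then show "?o (z \<in> A' \<and> x \<in> B' \<and> y \<in> B' \<and> H z x y)
        \<le> ?o (x \<in> B' \<and> z \<in> A' \<and> \<not> pr z x) * ?o (y \<in> B') + ?o (x \<in> B') * ?o (y \<in> B' \<and> z \<in> A' \<and> \<not> pr z y)"
        by (auto simp: of_bool_def)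
    qed
    also have "\<dots> = av (\<lambda>z. av (\<lambda>x. ?o (x \<in> B' \<and> z \<in> A' \<and> \<not> pr z x))) * b + b * av (\<lambda>z. av (\<lambda>y. ?o (y \<in> B' \<and> z \<in> A' \<and> \<not> pr z y)))"
      unfolding av_add av_cmult av_multc b_def ..
    also have "av (\<lambda>z. av (\<lambda>x. ?o (x \<in> B' \<and> z \<in> A' \<and> \<not> pr z x))) = Gt"
      unfolding Gt_def g_def av_cmult[symmetric] of_bool_conj by (subst av_swap) simp
    finally show ?thesis by (simp add: algebra_simps)
  qed

  \<comment> \<open>For a source v of z, an edge z z' v would pass from (v, z) with label 2 to (z,
    z') with label 0.\<close>
  have M2: "(17 / 50) * N \<le> M"
  proof -
    have "N * (17 / 50) \<le> av (\<lambda>z. av (\<lambda>z'. ?o (nb z z') * ms (S z \<inter> B')))"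
      unfolding N_def av_multc[symmetric]
    proof (rule av2_mono)
      fix z z'
      show "?o (nb z z') * (17 / 50) \<le> ?o (nb z z') * ms (S z \<inter> B')"
        using SB'[of z] unfolding nb_def by (auto simp: of_bool_def)
    qed
    also have "\<dots> = av (\<lambda>z. av (\<lambda>z'. av (\<lambda>v. ?o (nb z z') * ?o (v \<in> S z \<inter> B'))))" unfolding av_cmult ..
    also have "\<dots> \<le> M" unfolding M_def edens_def
    proof (rule av3_mono)
      fix z z' v
      have "\<not> H z z' v" if nb: "nb z z'" and v: "v \<in> S z"
      proof
        assume h: "H z z' v"
        have "lab H p 7 (v, z) 2" using v unfolding S_def sources_def by simp
        then have "lab H p 9 (z, z') 0" using lab20 triD[OF H h] by fastforce
        then show False using nb unfolding nb_def by simp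
      qed
      then show "?o (nb z z') * ?o (v \<in> S z \<inter> B') \<le> ?o (z \<in> A' \<and> z' \<in> A' \<and> v \<in> B' \<and> \<not> H z z' v)"
        unfolding nb_def by (auto simp: of_bool_def)
    qed
    finally show ?thesis by (simp add: mult.commute)
  qed

  \<comment> \<open>If z and v are wrongly labelled, no twin x of z forms an edge with them. Both
    orders of z and x contribute 61 / 100 each; the overlap, where x and v are wrong too, costs at
    most \<open>g v\<close>, itself at most 7 / 50. And 2 * (61 / 100) - 7 / 50 = 27 / 25.\<close>
  have M1: "(27 / 25) * Gt \<le> M"
  proof -
    define q where "q = (\<lambda>v z. z \<in> A' \<and> \<not> pr z v)"
    have gq: "g v = av (\<lambda>z. ?o (q v z))" for v unfolding g_def q_def ..
    have no: "\<not> H z x v" if "q v z" "x \<in> R z" "z \<in> A'" for z x v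
    proof
      assume h: "H z x v"
      note D = triD[OF H h]
      have l: "lab H p 7 (z, x) 0" "lab H p 7 (x, z) 0" using that(2) unfolding R_def twins_def by auto
      have "lab H p 8 (x, v) 1" using lab01[OF l(1) h] by simp
      then have 2: "lab H p 9 (v, z) 2" using lab12 D by fastforce
      have "lab H p 8 (z, v) 1" using lab01[OF l(2) D(2)] by simp
      then have "lab H p 9 (z, v) 1" by (rule mono) simp
      with 2 that(1) show False unfolding q_def pr_def by blast
    qed
    have "Gt * (27 / 25) \<le> av (\<lambda>v. ?o (v \<in> B') * (2 * av (\<lambda>z. ?o (q v z) * ms (R z \<inter> A')) - g v * g v))"
      unfolding Gt_def av_multc[symmetric]
    proof (rule av_mono)
      fix v
      have "g v * (27 / 25) \<le> 2 * av (\<lambda>z. ?o (q v z) * ms (R z \<inter> A')) - g v * g v" if v: "v \<in> B'"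
      proof -
        have "g v + ms (P v \<inter> A') \<le> a"
          unfolding g_def a_def av_add[symmetric]
        proof (rule av_mono)
          fix z
          show "?o (z \<in> A' \<and> \<not> pr z v) + ?o (z \<in> P v \<inter> A') \<le> ?o (z \<in> A')"
            using mono[of 7 "(v, z)" 2 9] mono[of 7 "(z, v)" 1 9] unfolding pr_def P_def sinks_def by (auto simp: of_bool_def)
        qed
        then have gu: "g v \<le> (7 / 50)" using PA'[OF v] a_ub by simp
        have "g v * (61 / 100) \<le> av (\<lambda>z. ?o (q v z) * ms (R z \<inter> A'))"
          unfolding gq av_multc[symmetric] by (rule av_mono) (use RA'(2) in \<open>auto simp: q_def of_bool_def\<close>)
        moreover have "g v * g v \<le> g v * (7 / 50)" using gu g0 by (intro mult_left_mono)
        ultimately show ?thesis by simp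
      qed
      then show "?o (v \<in> B') * g v * (27 / 25) \<le> ?o (v \<in> B') * (2 * av (\<lambda>z. ?o (q v z) * ms (R z \<inter> A')) - g v * g v)"
        by (cases "v \<in> B'") auto
    qed
    also have "\<dots> = av (\<lambda>v. av (\<lambda>z. av (\<lambda>x. ?o (v \<in> B') * (?o (q v z) * ?o (x \<in> R z \<inter> A') + ?o (q v x) * ?o (z \<in> R x \<inter> A') - ?o (q v z) * ?o (q v x)))))"
    proof (rule av_cong)
      fix v
      have "av (\<lambda>z. av (\<lambda>x. ?o (q v x) * ?o (z \<in> R x \<inter> A'))) = av (\<lambda>z. ?o (q v z) * ms (R z \<inter> A'))"
        by (subst av_swap) (simp add: av_cmult)
      then show "?o (v \<in> B') * (2 * av (\<lambda>z. ?o (q v z) * ms (R z \<inter> A')) - g v * g v) =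
         av (\<lambda>z. av (\<lambda>x. ?o (v \<in> B') * (?o (q v z) * ?o (x \<in> R z \<inter> A') + ?o (q v x) * ?o (z \<in> R x \<inter> A') - ?o (q v z) * ?o (q v x))))"
        unfolding av_cmult[of "?o (v \<in> B')"] av_diff av_add
        by (simp only: gq av_cmult av_multc) simp
    qed
    also have "\<dots> \<le> av (\<lambda>v. av (\<lambda>z. av (\<lambda>x. ?o (z \<in> A' \<and> x \<in> A' \<and> v \<in> B' \<and> \<not> H z x v))))"
    proof (rule av3_mono)
      fix v z x
      show "?o (v \<in> B') * (?o (q v z) * ?o (x \<in> R z \<inter> A') + ?o (q v x) * ?o (z \<in> R x \<inter> A') - ?o (q v z) * ?o (q v x))
        \<le> ?o (z \<in> A' \<and> x \<in> A' \<and> v \<in> B' \<and> \<not> H z x v)"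
      proof (cases "v \<in> B' \<and> (q v z \<and> x \<in> R z \<inter> A' \<or> q v x \<and> z \<in> R x \<inter> A')")
        case True
        have "H z x v \<Longrightarrow> H x z v" using triD(2)[OF H] .
        then have "z \<in> A' \<and> x \<in> A' \<and> v \<in> B' \<and> \<not> H z x v"
          using True no[of v z x] no[of v x z] unfolding q_def by blast
        then show ?thesis using True by (auto simp: q_def of_bool_def)
      qed (auto simp: of_bool_def)
    qed
    also have "\<dots> = M" unfolding M_def edens_def
      by (rule av3_rot[of "\<lambda>v z x. ?o (z \<in> A' \<and> x \<in> A' \<and> v \<in> B' \<and> \<not> H z x v)", symmetric])
    finally show ?thesis by (simp add: mult.commute)
  qed

  have EAAB_M: "EAAB + M = a * a * b"
  proof -
    have "EAAB + M = av (\<lambda>x. av (\<lambda>y. av (\<lambda>z. ?o (x \<in> A') * (?o (y \<in> A') * ?o (z \<in> B')))))"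
      unfolding EAAB_def M_def edens_def av_add[symmetric] by (intro av_cong) auto
    also have "\<dots> = a * a * b" unfolding av_cmult av_multc a_def b_def by simp
    finally show ?thesis .
  qed
  have split: "edens H = EA + 3 * EAAB + 3 * EABB + EB"
  proof -
    define TA where "TA = (\<lambda>x y z. x \<in> A' \<and> y \<in> A' \<and> z \<in> B' \<and> H x y z)"
    define TB where "TB = (\<lambda>x y z. x \<in> A' \<and> y \<in> B' \<and> z \<in> B' \<and> H x y z)"
    have "edens H = av (\<lambda>x. av (\<lambda>y. av (\<lambda>z. ?o (x \<in> A' \<and> y \<in> A' \<and> z \<in> A' \<and> H x y z)
      + (?o (TA x y z) + ?o (TA y z x) + ?o (TA z x y)) + (?o (TB x y z) + ?o (TB y z x) + ?o (TB z x y))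
      + ?o (x \<in> B' \<and> y \<in> B' \<and> z \<in> B' \<and> H x y z))))"
      unfolding edens_def
    proof (intro av_cong)
      fix x y z assume v: "x \<in> V" "y \<in> V" "z \<in> V"
      have m: "(x \<in> B') = (x \<notin> A')" "(y \<in> B') = (y \<notin> A')" "(z \<in> B') = (z \<notin> A')" using v unfolding B'_def by auto
      have h: "H y z x = H x y z" "H z x y = H x y z" using triD(3,4)[OF H] by blast+
      show "?o (H x y z) = ?o (x \<in> A' \<and> y \<in> A' \<and> z \<in> A' \<and> H x y z)
      + (?o (TA x y z) + ?o (TA y z x) + ?o (TA z x y)) + (?o (TB x y z) + ?o (TB y z x) + ?o (TB z x y))
      + ?o (x \<in> B' \<and> y \<in> B' \<and> z \<in> B' \<and> H x y z)"
        unfolding TA_def TB_def m h by (cases "x \<in> A'"; cases "y \<in> A'"; cases "z \<in> A'") simp_all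
    qed
    also have "\<dots> = EA + 3 * EAAB + 3 * EABB + EB"
    proof -
      have r: "av (\<lambda>x. av (\<lambda>y. av (\<lambda>z. ?o (W z x y)))) = edens W"
        "av (\<lambda>x. av (\<lambda>y. av (\<lambda>z. ?o (W y z x)))) = edens W" for W
        unfolding edens_def using av3_rot[of "\<lambda>x y t. ?o (W x y t)"]
          av3_rot[of "\<lambda>x y t. ?o (W y t x)"] by simp_all
      show ?thesis
        unfolding av_add r[of TA] r[of TB] EA_def EB_def EAAB_def EABB_def TA_def[symmetric] TB_def[symmetric]
          edens_def[symmetric] by simp
    qed
    finally show ?thesis .
  qed
  have b_le: "b \<le> (367 / 1000)" using ab1 a_lb by simp
  have "2 * (b * Gt) \<le> (367 / 500) * Gt" using mult_right_mono[OF b_le G0] by simp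
  \<comment> \<open>3 * M pays for everything: \<open>EA\<close> is at most (33 / 500) * (50 / 17) *
    M < M / 5, and 3 * EABB is at most 3 * (367 / 500) * (25 / 27) * M < (21 / 10) * M.\<close>
  then have "EA + 3 * EAAB + 3 * EABB \<le> 3 * a * a * b"
    using EA_le EABB_le EAAB_M M1 M2 N0 G0 by simp
  also have "\<dots> \<le> tdc * ((a + b) ^ 3 - b ^ 3)" by (rule recursion_bound) (use a_lb in simp)
  finally have "edens H \<le> tdc - tdc * b ^ 3 + EB" unfolding split ab1 by (simp add: algebra_simps)
  moreover have "EB \<le> tdc * b ^ 3 + \<gamma>"
  proof -
    have "B' \<noteq> V"
    proof
      assume "B' = V"
      then have "A' = {}" unfolding B'_def A'_def by blast
      then have "a = 0" unfolding a_def by (simp add: av_const)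
      then show False using a_lb by simp
    qed
    then show ?thesis unfolding EB_def b_def by (intro sub) (auto simp: B'_def)
  qed
  ultimately show False using tot by simp
qed

text \<open>
  The constants: \<open>\<epsilon> = 1 / 10 ^ 12\<close> in the cleaning step gives codegree at least \<open>\<delta> = \<epsilon> / 3\<close>,
  so \<open>N = 10 ^ 25\<close> satisfies \<open>N * \<delta>\<^sup>2 > 1\<close> and \<open>K = 7 * N + 4\<close> bounds the diameter.
\<close>

definition (in -) walk_bound :: nat where "walk_bound = 3 * (7 * 10 ^ 25 + 4) + 40"

theorem no_minimal_counterexample:
  assumes H: "tri V H" and free: "walk_free walk_bound H"
    and tot: "edens H > tdc + \<gamma>"
    and sub: "\<And>B. B \<subseteq> V \<Longrightarrow> B \<noteq> V \<Longrightarrow>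
       edens (\<lambda>a b c. a \<in> B \<and> b \<in> B \<and> c \<in> B \<and> H a b c) \<le> tdc * ms B ^ 3 + \<gamma>"
    and degH: "\<And>v. v \<in> V \<Longrightarrow> deg H v \<ge> (58 / 125)"
  shows False
proof -
  obtain G where G: "tri V G" "\<And>a b c. G a b c \<Longrightarrow> H a b c" "edens G \<ge> edens H - 1 / 10 ^ 12"
    "\<And>a b c. G a b c \<Longrightarrow> codeg G a b \<ge> (1 / 10 ^ 12) / 3"
    using clean_subgraph[OF H, of "1 / 10 ^ 12"] by auto
  have freeG: "walk_free walk_bound G" using walk_free_mono[OF free] G(2) by blast
  have diam: "\<exists>k\<le>7 * 10 ^ 25 + 4. (p, q) \<in> step G ^^ k" if "(p, q) \<in> (step G)\<^sup>*" for p q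
    by (rule walk_diameter[OF G(1) _ G(4) _ that]) (simp_all add: power2_eq_square)
  have bound: "3 * (7 * 10 ^ 25 + 4) + 1 \<le> walk_bound" unfolding walk_bound_def by simp
  obtain \<phi> :: "'a \<times> 'a \<Rightarrow> nat"
    where "\<And>a b c. G a b c \<Longrightarrow> \<phi> (b, c) mod 3 = (\<phi> (a, b) + 1) mod 3"
    using potential_exists[OF G(1) freeG bound diam] by blast
  then obtain Bl Rd where "star_coloured G Bl Rd"
    using star_colouring_of_potential[OF G(1), of \<phi>] by blast
  from approx_structure_exists[OF H G(1,2) this tot sub degH _ _ G(3)]
  obtain A B where "approx_structure (1 / 10 ^ 6) H A B" by auto
  \<comment> \<open>The summand 40 of \<open>walk_bound\<close> provides for the comparison of
    labels.\<close>
  from no_extremal_counterexample[OF H free _ this tot sub degH] show False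
    by (simp add: walk_bound_def)
qed

end

section \<open>Systems without short bad closed walks\<close>

definition triples :: "('a \<Rightarrow> 'a \<Rightarrow> 'a \<Rightarrow> bool) \<Rightarrow> nat" where
  "triples T = card {(a, b, c). T a b c}"

lemma triples_subset: "tri V T \<Longrightarrow> {(a, b, c). T a b c} \<subseteq> V \<times> V \<times> V"
  using triD(9-11)[of V T] by blast

lemma triples_le: "tri V T \<Longrightarrow> finite V \<Longrightarrow> triples T \<le> card V ^ 3"
  using card_mono[OF _ triples_subset[of V T]]
  by (simp add: triples_def card_cartesian_product power3_eq_cube mult.assoc)

lemma sum_triples:
  assumes "tri V T" "finite V"
  shows "(\<Sum>a\<in>V. \<Sum>b\<in>V. \<Sum>c\<in>V. of_bool (T a b c)) = real (triples T)"
proof -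
  have "(\<Sum>a\<in>V. \<Sum>b\<in>V. \<Sum>c\<in>V. of_bool (T a b c)) = (\<Sum>(a, b, c)\<in>V \<times> V \<times> V. of_bool (T a b c) :: real)"
    by (simp only: sum.cartesian_product)
  also have "\<dots> = (\<Sum>x\<in>V \<times> V \<times> V. of_bool (x \<in> {(a, b, c). T a b c}))"
    by (intro sum.cong) auto
  also have "\<dots> = real (card ((V \<times> V \<times> V) \<inter> {x. x \<in> {(a, b, c). T a b c}}))"
    using assms(2) by (intro sum_of_bool_eq) auto
  also have "(V \<times> V \<times> V) \<inter> {x. x \<in> {(a, b, c). T a b c}} = {(a, b, c). T a b c}"
    using triples_subset[OF assms(1)] by blast
  finally show ?thesis unfolding triples_def .
qed

lemma tri_restrict: "tri V T \<Longrightarrow> B \<subseteq> V \<Longrightarrow> tri B (\<lambda>a b c. a \<in> B \<and> b \<in> B \<and> c \<in> B \<and> T a b c)"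
  unfolding tri_def by blast

lemma (in weighted) edens_remove_vertex:
  assumes T: "tri V T" and v: "v \<in> V"
  shows "edens T \<le> edens (\<lambda>a b c. a \<in> V - {v} \<and> b \<in> V - {v} \<and> c \<in> V - {v} \<and> T a b c) + 3 * (w v * deg T v)"
proof -
  have "edens T \<le> av (\<lambda>a. av (\<lambda>b. av (\<lambda>c. of_bool (a \<in> V - {v} \<and> b \<in> V - {v} \<and> c \<in> V - {v} \<and> T a b c)
     + of_bool (a = v) * of_bool (T v b c) + of_bool (b = v) * of_bool (T v a c) + of_bool (c = v) * of_bool (T v a b))))"
    unfolding edens_def
  proof (rule av3_mono)
    fix a b c assume "a \<in> V" "b \<in> V" "c \<in> V"
    then show "of_bool (T a b c) \<le> of_bool (a \<in> V - {v} \<and> b \<in> V - {v} \<and> c \<in> V - {v} \<and> T a b c)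
     + of_bool (a = v) * of_bool (T v b c) + of_bool (b = v) * of_bool (T v a c) + of_bool (c = v) * (of_bool (T v a b) :: real)"
      using triD[OF T, of a b c] by (cases "T a b c"; cases "a = v"; cases "b = v"; cases "c = v") auto
  qed
  also have "\<dots> = edens (\<lambda>a b c. a \<in> V - {v} \<and> b \<in> V - {v} \<and> c \<in> V - {v} \<and> T a b c) + 3 * (w v * deg T v)"
    unfolding av_add av_cmult av_at[OF v] by (simp add: edens_def deg_def)
  finally show ?thesis .
qed

lemma walk_map:
  assumes "\<And>a b c. T' a b c \<Longrightarrow> T (f a) (f b) (f c)" "(p, q) \<in> step T' ^^ n"
  shows "(map_prod f f p, map_prod f f q) \<in> step T ^^ n"
  using assms(2)
proof (induction n arbitrary: q)
  case (Suc n)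
  then obtain r where r: "(p, r) \<in> step T' ^^ n" "(r, q) \<in> step T'" by auto
  then obtain a b c where "r = (a, b)" "q = (b, c)" "T' a b c" unfolding step_def by auto
  then have "(map_prod f f r, map_prod f f q) \<in> step T" using assms(1) by auto
  then show ?case using Suc.IH[OF r(1)] by (auto intro: relcompI)
qed simp

lemma walk_free_map:
  assumes "walk_free L T" "\<And>a b c. T' a b c \<Longrightarrow> T (f a) (f b) (f c)"
  shows "walk_free L T'"
  unfolding walk_free_def
proof (intro allI impI)
  fix n p assume "n \<le> L \<and> (p, p) \<in> step T' ^^ n"
  then have "n \<le> L \<and> (map_prod f f p, map_prod f f p) \<in> step T ^^ n"
    using walk_map[of T' T f, OF assms(2)] by blast
  then show "3 dvd n" using assms(1) unfolding walk_free_def by blast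
qed

text \<open>
  A least counterexample to the inequality with an additive constant has at least as many
  vertices as the cube root of the constant, so all vertex weights are tiny.
\<close>

lemma triples_bound_additive:
  fixes T :: "'a \<Rightarrow> 'a \<Rightarrow> 'a \<Rightarrow> bool"
  assumes "finite V" "tri V T" "walk_free walk_bound T"
  shows "real (triples T) \<le> tdc * real (card V) ^ 3 + 10 ^ 15"
proof (rule ccontr)
  assume neg: "\<not> ?thesis"
  define bad where "bad = (\<lambda>n. \<exists>(V :: 'a set) T. finite V \<and> card V = n \<and> tri V T \<and> walk_free walk_bound T
     \<and> tdc * real n ^ 3 + 10 ^ 15 < real (triples T))"
  have "bad (card V)" unfolding bad_def using assms neg by (intro exI[of _ V] exI[of _ T]) simp
  then obtain n where n: "bad n" "\<And>m. m < n \<Longrightarrow> \<not> bad m" using ex_least_nat_le[of bad] by blast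
  then obtain V :: "'a set" and T where V: "finite V" "card V = n" and T: "tri V T" "walk_free walk_bound T"
    and big: "tdc * real n ^ 3 + 10 ^ 15 < real (triples T)" unfolding bad_def by blast
  \<comment> \<open>For n up to 10^5 the trivial bound n^3 does not exceed the additive constant
    10^15.\<close>
  have n_large: "10 ^ 5 < n"
  proof (rule ccontr)
    assume "\<not> ?thesis"
    then have "real n ^ 3 \<le> (10 ^ 5) ^ 3" by (intro power_mono) auto
    also have "(10 ^ 5) ^ 3 = (10 ^ 15 :: real)" by simp
    finally have "real n ^ 3 \<le> 10 ^ 15" .
    moreover have "real (triples T) \<le> real n ^ 3"
      using triples_le[OF T(1) V(1)] V(2) by (metis of_nat_le_iff of_nat_power)
    moreover have "0 \<le> tdc * real n ^ 3" using tdc_bounds by simp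
    ultimately show False using big by linarith
  qed
  define x where "x = 1 / real n"
  have x: "0 < x" "x < 1 / 10 ^ 5" and nx: "real n * x = 1"
    using n_large by (auto simp: x_def field_simps)
  interpret weighted V "\<lambda>_. x" by unfold_locales (use V x nx in auto)
  have ed: "edens S = real (triples S) * x ^ 3" if "tri V S" for S
    using sum_triples[OF that V(1)] unfolding edens_def av_def
    by (simp only: flip: sum_distrib_left) (simp add: power3_eq_cube)
  have msB: "ms B = real (card B) * x" if "B \<subseteq> V" for B
    using V(1) that unfolding av_def by (simp add: Int_absorb1 flip: sum_distrib_left)
  define \<gamma> where "\<gamma> = 10 ^ 15 * x ^ 3"
  have n3: "real n ^ 3 * x ^ 3 = 1" using nx by (metis power_mult_distrib power_one)
  have tot: "edens T > tdc + \<gamma>"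
  proof -
    have "(tdc * real n ^ 3 + 10 ^ 15) * x ^ 3 < real (triples T) * x ^ 3"
      using big x by (intro mult_strict_right_mono) auto
    moreover have "(tdc * real n ^ 3 + 10 ^ 15) * x ^ 3 = tdc + \<gamma>"
      using n3 unfolding \<gamma>_def by (simp add: distrib_right mult.assoc)
    ultimately show ?thesis using ed[OF T(1)] by simp
  qed
  have sub: "edens (\<lambda>a b c. a \<in> B \<and> b \<in> B \<and> c \<in> B \<and> T a b c) \<le> tdc * ms B ^ 3 + \<gamma>"
    if B: "B \<subseteq> V" "B \<noteq> V" for B
  proof -
    define S where "S = (\<lambda>a b c. a \<in> B \<and> b \<in> B \<and> c \<in> B \<and> T a b c)"
    have S: "tri B S" unfolding S_def by (rule tri_restrict[OF T(1) B(1)])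
    have finB: "finite B" using B V finite_subset by blast
    have "card B < n" using B V psubset_card_mono by blast
    then have nb: "\<not> bad (card B)" by (rule n(2))
    have fS: "walk_free walk_bound S" by (rule walk_free_mono[OF T(2)]) (simp add: S_def)
    have "real (triples S) \<le> tdc * real (card B) ^ 3 + 10 ^ 15"
    proof (rule ccontr)
      assume "\<not> ?thesis"
      then have "bad (card B)" unfolding bad_def using S finB fS by (intro exI[of _ B] exI[of _ S]) simp
      with nb show False by blast
    qed
    then have "real (triples S) * x ^ 3 \<le> (tdc * real (card B) ^ 3 + 10 ^ 15) * x ^ 3"
      using x by (intro mult_right_mono) auto
    also have "\<dots> = tdc * ms B ^ 3 + \<gamma>"
      unfolding msB[OF B(1)] \<gamma>_def by (simp add: distrib_right power_mult_distrib mult.assoc)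
    finally have "real (triples S) * x ^ 3 \<le> tdc * ms B ^ 3 + \<gamma>" .
    moreover have "tri V S" using T(1) B unfolding S_def tri_def by blast
    ultimately show ?thesis using ed[of S] unfolding S_def by simp
  qed
  \<comment> \<open>Deleting v lowers the bound by tdc * (1 - (1 - x)^3), about 3 * tdc * x, and the
    density by at most 3 * x * deg T v. So the degree exceeds tdc * (1 - x), which for x < 1 / 10^5
    is still above 58 / 125 = 0.464.\<close>
  have degT: "(58 / 125) \<le> deg T v" if v: "v \<in> V" for v
  proof -
    have "V - {v} \<noteq> V" using v by blast
    from sub[OF _ this] have e: "edens T \<le> tdc * ms (V - {v}) ^ 3 + \<gamma> + 3 * (x * deg T v)"
      using edens_remove_vertex[OF T(1) v] by fastforce
    have m: "ms (V - {v}) = 1 - x"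
      using v V n_large nx unfolding msB[OF Diff_subset] by (simp add: algebra_simps of_nat_diff)
    have "tdc * (1 - (1 - x) ^ 3) < 3 * (x * deg T v)"
      using tot e unfolding m by (simp add: algebra_simps)
    moreover have "1 - (1 - x) ^ 3 = 3 * (x * (1 - x + x * x / 3))" by (simp add: power3_eq_cube field_simps)
    ultimately have "x * (tdc * (1 - x + x * x / 3)) < x * deg T v" by (simp add: algebra_simps)
    then have "tdc * (1 - x + x * x / 3) < deg T v" using x by simp
    moreover have "1 - 1 / 100000 \<le> 1 - x + x * x / 3"
    proof -
      have "0 \<le> x * x / 3" by simp
      moreover have "x < 1 / 100000" using x by simp
      ultimately show ?thesis by linarith
    qed
    then have "tdc * (1 - 1 / 100000) \<le> tdc * (1 - x + x * x / 3)"
      using tdc_bounds by (intro mult_left_mono) auto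
    ultimately have "tdc * (1 - 1 / 100000) < deg T v" by (rule le_less_trans[rotated])
    then show ?thesis using tdc_bounds by simp
  qed
  show False using no_minimal_counterexample[OF T tot sub degT] by blast
qed

text \<open>In the blow-up with k copies of each vertex, \<open>fst\<close> projects walks to walks,
  so no bad closed walk arises. An excess over the bound is multiplied by k^3 and outgrows the
  additive constant.\<close>

theorem triples_bound:
  fixes T :: "'a \<Rightarrow> 'a \<Rightarrow> 'a \<Rightarrow> bool"
  assumes V: "finite V" and T: "tri V T" and free: "walk_free walk_bound T"
  shows "real (triples T) \<le> tdc * real (card V) ^ 3"
proof (rule ccontr)
  assume "\<not> ?thesis"
  then have gap: "0 < real (triples T) - tdc * real (card V) ^ 3" (is "0 < ?g") by simp
  obtain k :: nat where k: "10 ^ 15 < real k * ?g" using reals_Archimedean3[OF gap] by blast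
  then have k1: "1 \<le> k" by (cases k) auto
  define T' where "T' = (\<lambda>x y z :: 'a \<times> nat. snd x < k \<and> snd y < k \<and> snd z < k \<and> T (fst x) (fst y) (fst z))"
  have T': "tri (V \<times> {..<k}) T'"
    unfolding tri_def
  proof (intro allI impI)
    fix x y z assume t: "T' x y z"
    then have "T (fst x) (fst y) (fst z)" by (simp add: T'_def)
    from triD[OF T this] t show "T' y x z \<and> T' x z y \<and> x \<noteq> y \<and> x \<in> V \<times> {..<k}"
      by (cases x) (auto simp: T'_def)
  qed
  have free': "walk_free walk_bound T'"
    by (rule walk_free_map[OF free, of T' fst]) (simp add: T'_def)
  have "triples T' = triples T * k ^ 3"
  proof -
    let ?f = "\<lambda>((a, b, c), (i, j, l)). ((a, i), (b, j), (c, l))"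
    have "{(x, y, z). T' x y z} = ?f ` ({(a, b, c). T a b c} \<times> ({..<k} \<times> {..<k} \<times> {..<k}))"
    proof (intro equalityI subsetI)
      fix t assume "t \<in> {(x, y, z). T' x y z}"
      then obtain a i b j c l where t: "t = ((a, i), (b, j), (c, l))" and "T' (a, i) (b, j) (c, l)" by auto
      then have "((a, b, c), (i, j, l)) \<in> {(a, b, c). T a b c} \<times> ({..<k} \<times> {..<k} \<times> {..<k})"
        by (simp add: T'_def)
      then show "t \<in> ?f ` ({(a, b, c). T a b c} \<times> ({..<k} \<times> {..<k} \<times> {..<k}))"
        by (rule rev_image_eqI) (simp add: t)
    next
      fix t assume "t \<in> ?f ` ({(a, b, c). T a b c} \<times> ({..<k} \<times> {..<k} \<times> {..<k}))"
      then show "t \<in> {(x, y, z). T' x y z}" by (auto simp: T'_def)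
    qed
    moreover have "inj_on ?f ({(a, b, c). T a b c} \<times> ({..<k} \<times> {..<k} \<times> {..<k}))"
      by (auto simp: inj_on_def)
    ultimately have "triples T' = card ({(a, b, c). T a b c} \<times> ({..<k} \<times> {..<k} \<times> {..<k}))"
      unfolding triples_def by (simp add: card_image)
    then show ?thesis by (simp add: card_cartesian_product triples_def power3_eq_cube)
  qed
  with triples_bound_additive[OF _ T' free'] V
  have "real (triples T) * real k ^ 3 \<le> tdc * (real (card V) * real k) ^ 3 + 10 ^ 15"
    by (simp add: card_cartesian_product)
  then have le: "?g * real k ^ 3 \<le> 10 ^ 15" by (simp add: power_mult_distrib algebra_simps)
  have "real k \<le> real k ^ 3" using k1 self_le_power[of "real k" 3] by simp
  then have "?g * real k \<le> ?g * real k ^ 3" using gap by (intro mult_left_mono) auto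
  then show False using k le by (simp add: mult.commute)
qed

section \<open>From closed walks to copies of tight cycles\<close>

text \<open>n and 2 * n represent both nonzero residues modulo 3 and are at most l; circling an edge
  at p supplies the remaining multiple of 3.\<close>

lemma closed_walk_of_length:
  assumes T: "tri V T" and nf: "\<not> walk_free L T" and l: "2 * L \<le> l" "\<not> 3 dvd l"
  obtains w :: "nat \<Rightarrow> 'a"
    where "\<And>i. i < l \<Longrightarrow> T (w i) (w ((i + 1) mod l)) (w ((i + 2) mod l))"
proof -
  obtain n p where n: "n \<le> L" "(p, p) \<in> step T ^^ n" "\<not> 3 dvd n"
    using nf unfolding walk_free_def by blast
  have n0: "n \<noteq> 0" using n(3) by (metis dvd_0_right)
  then obtain n' where n': "n = Suc n'" by (cases n) auto
  have three: "(p, p) \<in> step T ^^ 3"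
  proof -
    from n(2)[unfolded n'] obtain q where q: "(p, q) \<in> step T" by (rule relpow_Suc_E2)
    have "(p, q) \<in> step T ^^ 1" using q by simp
    from relpow_trans[OF this step_back[OF T q]] show ?thesis by (simp add: eval_nat_numeral)
  qed
  have threes: "(p, p) \<in> step T ^^ (3 * j)" for j
  proof (induction j)
    case (Suc j)
    from relpow_trans[OF three Suc.IH] show ?case by simp
  qed simp
  have two: "(p, p) \<in> step T ^^ (2 * n)" using relpow_trans[OF n(2) n(2)] by (simp add: mult_2)
  have "(p, p) \<in> step T ^^ l"
  proof (cases "l mod 3 = n mod 3")
    case True
    have "n \<le> l" using n l by linarith
    then obtain j where "l = n + 3 * j" using True by (metis mod_eq_dvd_iff_nat dvdE le_add_diff_inverse)
    then show ?thesis using relpow_trans[OF n(2) threes] by simp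
  next
    case False
    have "n mod 3 = 1 \<or> n mod 3 = 2" "l mod 3 = 1 \<or> l mod 3 = 2" using n(3) l(2) by presburger+
    then have "l mod 3 = 2 * n mod 3" using False by presburger
    moreover have "2 * n \<le> l" using n l by linarith
    ultimately obtain j where "l = 2 * n + 3 * j" by (metis mod_eq_dvd_iff_nat dvdE le_add_diff_inverse)
    then show ?thesis using relpow_trans[OF two threes] by simp
  qed
  then obtain f where f: "f 0 = p" "f l = p" "\<And>i. i < l \<Longrightarrow> (f i, f (Suc i)) \<in> step T"
    unfolding relpow_fun_conv by blast
  have l2: "2 \<le> l" using l n n0 by linarith
  define w where "w = (\<lambda>i. fst (f i))"
  have f0: "f (i mod l) = f i" if "i \<le> l" for i
    using that f by (cases "i = l") auto
  have s: "snd (f i) = fst (f (Suc i)) \<and> T (fst (f i)) (snd (f i)) (snd (f (Suc i)))" if "i < l" for i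
    using f(3)[OF that] by (cases "f i"; cases "f (Suc i)") auto
  have "T (w i) (w ((i + 1) mod l)) (w ((i + 2) mod l))" if i: "i < l" for i
  proof -
    define k where "k = (i + 1) mod l"
    have k: "k < l" "f k = f (Suc i)" using f0[of "Suc i"] i unfolding k_def by auto
    have "f ((k + 1) mod l) = f (Suc k)" using f0[of "Suc k"] k by auto
    moreover have "(k + 1) mod l = (i + 2) mod l" unfolding k_def by (simp add: mod_Suc_eq)
    ultimately have "w ((i + 2) mod l) = snd (f (Suc i))" using s[OF k(1)] k(2) unfolding w_def by simp
    moreover have "w k = snd (f i)" using s[OF i] k(2) unfolding w_def by simp
    ultimately have w: "w k = snd (f i)" "w ((i + 2) mod l) = snd (f (Suc i))" by blast+
    have "T (w i) (w k) (w ((i + 2) mod l))" unfolding w using s[OF i] unfolding w_def by blast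
    then show ?thesis unfolding k_def .
  qed
  with that show ?thesis by blast
qed

text \<open>
  Erdos' induction: by double counting, some \<open>t\<close>-set of first entries has many common continuations.
\<close>

lemma partite_subsystem:
  fixes m t :: nat
  assumes t: "1 \<le> t"
  shows "0 < (\<delta>::real) \<Longrightarrow> \<exists>n0. \<forall>V X. finite V \<longrightarrow> n0 \<le> card V \<longrightarrow>
    X \<subseteq> {xs. set xs \<subseteq> V \<and> length xs = m} \<longrightarrow> \<delta> * real (card V) ^ m \<le> real (card X) \<longrightarrow>
    (\<exists>S. length S = m \<and> (\<forall>s\<in>set S. s \<subseteq> (V :: 'a set) \<and> card s = t) \<and> (\<forall>xs. list_all2 (\<in>) xs S \<longrightarrow> xs \<in> X))"
proof (induction m arbitrary: \<delta>)
  case 0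
  have "X = {[]}" if "X \<subseteq> {xs. set xs \<subseteq> (V :: 'a set) \<and> length xs = 0}" "\<delta> * real (card V) ^ 0 \<le> real (card X)" for V X
  proof -
    have "X \<noteq> {}" using that(2) 0 by auto
    then show ?thesis using that(1) by auto
  qed
  then show ?case by (intro exI[of _ 0] allI impI exI[of _ "[]"]) auto
next
  case (Suc m)
  \<comment> \<open>Tails with at least \<delta> / 2 * N first entries make up a proportion of at
    least \<delta> / 2. Each has at least (\<delta> * N / (2 * t))^t suitable t-sets, and there are
    at most N^t sets to share them; the last factor 1 / 2 makes the comparison strict.\<close>
  define \<delta>' where "\<delta>' = (\<delta> / 2) * (\<delta> / (2 * real t)) ^ t / 2"
  have \<delta>': "0 < \<delta>'" using Suc.prems t unfolding \<delta>'_def by simp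
  from Suc.IH[OF \<delta>'] obtain n1 where n1: "\<forall>V X. finite V \<longrightarrow> n1 \<le> card V \<longrightarrow>
    X \<subseteq> {xs. set xs \<subseteq> V \<and> length xs = m} \<longrightarrow> \<delta>' * real (card V) ^ m \<le> real (card X) \<longrightarrow>
    (\<exists>S. length S = m \<and> (\<forall>s\<in>set S. s \<subseteq> (V :: 'a set) \<and> card s = t) \<and> (\<forall>xs. list_all2 (\<in>) xs S \<longrightarrow> xs \<in> X))"
    by (elim exE)
  \<comment> \<open>This makes \<delta> / 2 * N exceed t, so that the lower bound for the binomial
    coefficient applies to \<open>D y\<close>.\<close>
  obtain n2 :: nat where n2: "real t * 2 < real n2 * \<delta>" using reals_Archimedean3[OF Suc.prems] by blast
  show ?case
  proof (intro exI[of _ "max n1 (max n2 1)"] allI impI)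
    fix V :: "'a set" and X
    assume V: "finite V" and n: "max n1 (max n2 1) \<le> card V"
      and X: "X \<subseteq> {xs. set xs \<subseteq> V \<and> length xs = Suc m}"
      and cX: "\<delta> * real (card V) ^ Suc m \<le> real (card X)"
    define N where "N = card V"
    have N: "n1 \<le> N" "n2 \<le> N" "1 \<le> N" using n unfolding N_def by auto
    define Ls where "Ls = {xs. set xs \<subseteq> V \<and> length xs = m}"
    have Ls: "finite Ls" "card Ls = N ^ m" unfolding Ls_def N_def
      using finite_lists_length_eq[OF V] card_lists_length_eq[OF V] by auto
    define D where "D = (\<lambda>y. {a \<in> V. a # y \<in> X})"
    have D: "finite (D y)" "card (D y) \<le> N" for y
      using V card_mono[of V "D y"] unfolding D_def N_def by auto
    have "X = (\<Union>y\<in>Ls. (\<lambda>a. a # y) ` D y)"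
    proof (intro equalityI subsetI)
      fix xs assume xs: "xs \<in> X"
      then obtain a y where ay: "xs = a # y" using X by (cases xs) auto
      moreover have "set xs \<subseteq> V \<and> length xs = Suc m" using xs X by blast
      ultimately have "y \<in> Ls" "a \<in> D y" using xs unfolding Ls_def D_def by auto
      then show "xs \<in> (\<Union>y\<in>Ls. (\<lambda>a. a # y) ` D y)" unfolding ay by blast
    qed (auto simp: D_def)
    then have "card X \<le> (\<Sum>y\<in>Ls. card ((\<lambda>a. a # y) ` D y))" using card_UN_le[OF Ls(1)] by simp
    also have "\<dots> \<le> (\<Sum>y\<in>Ls. card (D y))" by (intro sum_mono card_image_le D)
    finally have "card X \<le> (\<Sum>y\<in>Ls. card (D y))" .
    from of_nat_mono[OF this, where 'a = real]
    have sumD: "\<delta> * real N ^ Suc m \<le> (\<Sum>y\<in>Ls. real (card (D y)))"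
      using cX unfolding N_def of_nat_sum by linarith
    define Gd where "Gd = {y \<in> Ls. \<delta> / 2 * real N \<le> real (card (D y))}"
    have Gd: "finite Gd" "Gd \<subseteq> Ls" using Ls unfolding Gd_def by auto
    have "(\<Sum>y\<in>Ls. real (card (D y))) \<le> (\<Sum>y\<in>Ls. \<delta> / 2 * real N + of_bool (y \<in> Gd) * real N)"
    proof (rule sum_mono)
      fix y assume "y \<in> Ls"
      then show "real (card (D y)) \<le> \<delta> / 2 * real N + of_bool (y \<in> Gd) * real N"
        using D(2)[of y] Suc.prems unfolding Gd_def by (auto simp: of_bool_def not_le add_increasing)
    qed
    also have "\<dots> = real N ^ m * (\<delta> / 2 * real N) + real (card Gd) * real N"
    proof -
      have "Ls \<inter> {y. y \<in> Gd} = Gd" using Gd by auto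
      then show ?thesis using Ls by (simp add: sum.distrib flip: sum_distrib_right)
    qed
    finally have "\<delta> / 2 * real N ^ m * real N \<le> real (card Gd) * real N" using sumD by (simp add: algebra_simps)
    then have cG: "\<delta> / 2 * real N ^ m \<le> real (card Gd)" using N by simp
    define TT where "TT = {s. s \<subseteq> V \<and> card s = t}"
    have TT: "finite TT" "card TT \<le> N ^ t"
    proof -
      show "finite TT" using V unfolding TT_def by simp
      have "card TT = N choose t" unfolding TT_def N_def by (rule n_subsets[OF V])
      then show "card TT \<le> N ^ t" using binomial_le_pow[of t N] by (cases "t \<le> N") (auto simp: binomial_eq_0)
    qed
    define Y where "Y = (\<lambda>s. {y \<in> Ls. \<forall>a\<in>s. a # y \<in> X})"
    have dc: "(\<Sum>s\<in>TT. real (card (Y s))) = (\<Sum>y\<in>Ls. real (card (D y) choose t))"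
    proof -
      have "card {s \<in> TT. \<forall>a\<in>s. a # y \<in> X} = card (D y) choose t" if "y \<in> Ls" for y
      proof -
        have "{s \<in> TT. \<forall>a\<in>s. a # y \<in> X} = {s. s \<subseteq> D y \<and> card s = t}" unfolding TT_def D_def by auto
        then show ?thesis using n_subsets[OF D(1)] by simp
      qed
      then have "(\<Sum>s\<in>TT. card (Y s)) = (\<Sum>y\<in>Ls. card (D y) choose t)"
        unfolding Y_def by (intro sum_multicount_gen) (use TT Ls in auto)
      then show ?thesis by (metis of_nat_sum)
    qed
    have lower: "(\<Sum>y\<in>Ls. real (card (D y) choose t)) \<ge> 2 * \<delta>' * real N ^ m * real N ^ t"
    proof -
      have "2 * \<delta>' * real N ^ m * real N ^ t = (\<delta> / 2 * real N ^ m) * (\<delta> / (2 * real t) * real N) ^ t"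
        unfolding \<delta>'_def power_mult_distrib by simp
      also have "\<dots> \<le> real (card Gd) * (\<delta> / (2 * real t) * real N) ^ t"
        using cG Suc.prems by (intro mult_right_mono) auto
      also have "\<dots> = (\<Sum>y\<in>Gd. (\<delta> / (2 * real t) * real N) ^ t)" by simp
      also have "\<dots> \<le> (\<Sum>y\<in>Gd. real (card (D y) choose t))"
      proof (rule sum_mono)
        fix y assume y: "y \<in> Gd"
        have d: "\<delta> / 2 * real N \<le> real (card (D y))" using y unfolding Gd_def by simp
        have "real n2 * \<delta> \<le> real N * \<delta>" using N Suc.prems by (intro mult_right_mono) auto
        moreover have "real N * \<delta> \<le> 2 * real (card (D y))" using d by (simp add: algebra_simps)
        ultimately have "real t \<le> real (card (D y))" using n2 by linarith
        then have "t \<le> card (D y)" by simp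
        from binomial_ge_n_over_k_pow_k[OF this, where 'a = real]
        have "(real (card (D y)) / real t) ^ t \<le> real (card (D y) choose t)" .
        moreover have "(\<delta> / (2 * real t) * real N) ^ t \<le> (real (card (D y)) / real t) ^ t"
          using d t Suc.prems by (intro power_mono) (auto simp: field_simps)
        ultimately show "(\<delta> / (2 * real t) * real N) ^ t \<le> real (card (D y) choose t)" by linarith
      qed
      also have "\<dots> \<le> (\<Sum>y\<in>Ls. real (card (D y) choose t))" using Ls Gd by (intro sum_mono2) auto
      finally show ?thesis .
    qed
    obtain s where s: "s \<in> TT" "\<delta>' * real N ^ m \<le> real (card (Y s))"
    proof -
      have "\<exists>s\<in>TT. \<delta>' * real N ^ m \<le> real (card (Y s))"
      proof (rule ccontr)
        assume "\<not> ?thesis"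
        then have "(\<Sum>s\<in>TT. real (card (Y s))) \<le> (\<Sum>s\<in>TT. \<delta>' * real N ^ m)" by (intro sum_mono) auto
        also have "\<dots> = real (card TT) * (\<delta>' * real N ^ m)" by simp
        also have "\<dots> \<le> real (N ^ t) * (\<delta>' * real N ^ m)"
          using TT(2) \<delta>' by (intro mult_right_mono) (auto simp del: of_nat_power)
        also have "\<dots> < 2 * \<delta>' * real N ^ m * real N ^ t" using \<delta>' N by simp
        finally show False using dc lower by simp
      qed
      with that show ?thesis by blast
    qed
    have "Y s \<subseteq> {xs. set xs \<subseteq> V \<and> length xs = m}" unfolding Y_def Ls_def by auto
    with n1[rule_format, OF V, of "Y s"] N(1) s(2)
    have "\<exists>S. length S = m \<and> (\<forall>s\<in>set S. s \<subseteq> V \<and> card s = t) \<and> (\<forall>xs. list_all2 (\<in>) xs S \<longrightarrow> xs \<in> Y s)"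
      unfolding N_def by simp
    then obtain S where S: "length S = m" "\<forall>s\<in>set S. s \<subseteq> V \<and> card s = t" "\<And>xs. list_all2 (\<in>) xs S \<Longrightarrow> xs \<in> Y s"
      by auto
    have "xs \<in> X" if "list_all2 (\<in>) xs (s # S)" for xs
      using that S(3) unfolding Y_def by (auto simp: list_all2_Cons2)
    then show "\<exists>S. length S = Suc m \<and> (\<forall>s\<in>set S. s \<subseteq> V \<and> card s = t) \<and> (\<forall>xs. list_all2 (\<in>) xs S \<longrightarrow> xs \<in> X)"
      using S s by (intro exI[of _ "s # S"]) (auto simp: TT_def)
  qed
qed

text \<open>Choose greedily: fewer than n values are taken when a set of at least n elements is
  served.\<close>

lemma distinct_representatives:
  assumes "\<And>i. i < n \<Longrightarrow> finite (F i) \<and> n \<le> card (F i)"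
  shows "\<exists>f. inj_on f {..<n} \<and> (\<forall>i<n. f i \<in> F i)"
proof -
  have "k \<le> n \<Longrightarrow> \<exists>f. inj_on f {..<k} \<and> (\<forall>i<k. f i \<in> F i)" for k
  proof (induction k)
    case (Suc k)
    then obtain f where f: "inj_on f {..<k}" "\<forall>i<k. f i \<in> F i" by auto
    have "card (f ` {..<k}) < card (F k)"
      using card_image_le[of "{..<k}" f] assms[of k] Suc.prems by simp
    then have "\<not> F k \<subseteq> f ` {..<k}" using card_mono[of "f ` {..<k}" "F k"] by auto
    then obtain v where v: "v \<in> F k" "v \<notin> f ` {..<k}" by blast
    have "inj_on (f(k := v)) {..<Suc k}"
      using f(1) v(2) unfolding lessThan_Suc inj_on_def by auto
    moreover have "\<forall>i<Suc k. (f(k := v)) i \<in> F i" using f(2) v(1) by (simp add: less_Suc_eq)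
    ultimately show ?case by blast
  qed simp
  then show ?thesis by blast
qed

section \<open>Counting ordered edges and supersets\<close>

lemma six_choose_three: "6 * (n choose 3) = n * (n - 1) * (n - 2)"
proof -
  have "3 * (n choose 3) = n * ((n - 1) choose 2)" using times_binomial_minus1_eq[of 3 n] by simp
  moreover have "2 * ((n - 1) choose 2) = (n - 1) * (n - 2)"
    using times_binomial_minus1_eq[of 2 "n - 1"] by (simp add: numeral_2_eq_2)
  ultimately have "6 * (n choose 3) = n * ((n - 1) * (n - 2))" by algebra
  then show ?thesis by (simp only: mult.assoc)
qed

lemma triples_of_edges:
  assumes "finite E" "\<And>e. e \<in> E \<Longrightarrow> card e = 3"
  shows "triples (\<lambda>a b c. {a, b, c} \<in> E) = 6 * card E"
proof -
  have six: "finite {(a, b, c). {a, b, c} = e} \<and> card {(a, b, c). {a, b, c} = e} = 6" if eE: "e \<in> E" for e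
  proof -
    obtain x y z where e: "e = {x, y, z}" "x \<noteq> y" "x \<noteq> z" "y \<noteq> z"
      using assms(2)[OF eE] by (auto simp: card_3_iff)
    have "{(a, b, c). {a, b, c} = e} = {(x, y, z), (x, z, y), (y, x, z), (y, z, x), (z, x, y), (z, y, x)}"
    proof (intro equalityI subsetI)
      fix t assume "t \<in> {(a, b, c). {a, b, c} = e}"
      then obtain a b c where t: "t = (a, b, c)" "{a, b, c} = {x, y, z}" using e by auto
      then have "a = x \<or> a = y \<or> a = z" "b = x \<or> b = y \<or> b = z" "c = x \<or> c = y \<or> c = z"
        by blast+
      moreover have "card {a, b, c} = 3" using assms(2)[OF eE] unfolding e(1) t(2) .
      then have "a \<noteq> b" "a \<noteq> c" "b \<noteq> c" by (auto simp: card_insert_if split: if_splits)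
      ultimately show "t \<in> {(x, y, z), (x, z, y), (y, x, z), (y, z, x), (z, x, y), (z, y, x)}"
        unfolding t(1) by (elim disjE) simp_all
    next
      fix t assume "t \<in> {(x, y, z), (x, z, y), (y, x, z), (y, z, x), (z, x, y), (z, y, x)}"
      then show "t \<in> {(a, b, c). {a, b, c} = e}" unfolding e(1) by (elim insertE emptyE) auto
    qed
    then show ?thesis using e by simp
  qed
  have "{(a, b, c). {a, b, c} \<in> E} = (\<Union>e\<in>E. {(a, b, c). {a, b, c} = e})" by auto
  then have "triples (\<lambda>a b c. {a, b, c} \<in> E) = card (\<Union>e\<in>E. {(a, b, c). {a, b, c} = e})"
    unfolding triples_def by simp
  also have "\<dots> = (\<Sum>e\<in>E. card {(a, b, c). {a, b, c} = e})"
    by (rule card_UN_disjoint) (use assms six in auto)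
  also have "\<dots> = 6 * card E" using six by simp
  finally show ?thesis .
qed

lemma card_supersets:
  assumes V: "finite V" and e: "e \<subseteq> V" "card e = k" "k \<le> m"
  shows "card {T. T \<subseteq> V \<and> card T = m \<and> e \<subseteq> T} = (card V - k) choose (m - k)"
proof -
  have fe: "finite e" using e(1) V finite_subset by blast
  have "bij_betw (\<lambda>T. T - e) {T. T \<subseteq> V \<and> card T = m \<and> e \<subseteq> T} {S. S \<subseteq> V - e \<and> card S = m - k}"
  proof (rule bij_betw_byWitness[where f' = "\<lambda>S. S \<union> e"])
    show "\<forall>T\<in>{T. T \<subseteq> V \<and> card T = m \<and> e \<subseteq> T}. T - e \<union> e = T" by auto
    show "\<forall>S\<in>{S. S \<subseteq> V - e \<and> card S = m - k}. S \<union> e - e = S" by auto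
    show "(\<lambda>T. T - e) ` {T. T \<subseteq> V \<and> card T = m \<and> e \<subseteq> T} \<subseteq> {S. S \<subseteq> V - e \<and> card S = m - k}"
      using fe e(2) by (auto simp: card_Diff_subset)
    show "(\<lambda>S. S \<union> e) ` {S. S \<subseteq> V - e \<and> card S = m - k} \<subseteq> {T. T \<subseteq> V \<and> card T = m \<and> e \<subseteq> T}"
    proof (intro image_subsetI CollectI conjI)
      fix S assume S: "S \<in> {S. S \<subseteq> V - e \<and> card S = m - k}"
      then have "finite S" "S \<inter> e = {}" using V finite_subset[of S V] by auto
      then show "card (S \<union> e) = m" using S fe e by (simp add: card_Un_disjoint)
    qed (use e in auto)
  qed
  then have "card {T. T \<subseteq> V \<and> card T = m \<and> e \<subseteq> T} = card {S. S \<subseteq> V - e \<and> card S = m - k}"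
    by (rule bij_betw_same_card)
  also have "\<dots> = card (V - e) choose (m - k)" by (rule n_subsets) (use V in simp)
  finally show ?thesis using e fe by (simp add: card_Diff_subset)
qed

lemma contains_tight_cycleI:
  assumes l: "3 \<le> l" and v: "inj_on v {..<l}" "\<And>i. i < l \<Longrightarrow> v i \<in> fst G"
    and edge: "\<And>i. i < l \<Longrightarrow> {v i, v ((i + 1) mod l), v ((i + 2) mod l)} \<in> snd G"
  shows "contains_copy G (tight_cycle l)"
  unfolding contains_copy_def
proof (intro exI[of _ "\<lambda>x. v (x - 1)"] conjI ballI)
  show "inj_on (\<lambda>x. v (x - 1)) (fst (tight_cycle l))"
  proof (rule inj_onI)
    fix x y assume "x \<in> fst (tight_cycle l)" "y \<in> fst (tight_cycle l)" and eq: "v (x - 1) = v (y - 1)"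
    then have xy: "1 \<le> x" "x \<le> l" "1 \<le> y" "y \<le> l" unfolding tight_cycle_def by auto
    then have "x - 1 \<in> {..<l}" "y - 1 \<in> {..<l}" by auto
    from inj_onD[OF v(1) eq this] show "x = y" using xy by linarith
  qed
  show "(\<lambda>x. v (x - 1)) ` fst (tight_cycle l) \<subseteq> fst G"
    using v(2) unfolding tight_cycle_def by auto
  fix e assume "e \<in> snd (tight_cycle l)"
  then obtain x where x: "x \<in> {1..l}" "e = {x, x mod l + 1, (x + 1) mod l + 1}"
    unfolding tight_cycle_def by auto
  then have "x - 1 < l" "(x - 1 + 1) mod l = x mod l" "(x - 1 + 2) mod l = (x + 1) mod l"
    by (auto simp: Suc_diff_le)
  with edge[of "x - 1"] show "(\<lambda>x. v (x - 1)) ` e \<in> snd G" unfolding x(2) by simp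
qed

section \<open>Supersaturation and the embedding of the tight cycle\<close>

lemma list_all2_memI:
  "length xs = length S \<Longrightarrow> (\<And>i. i < length S \<Longrightarrow> xs ! i \<in> S ! i) \<Longrightarrow> list_all2 (\<in>) xs S"
  by (simp add: list_all2_conv_all_nth)

text \<open>The walk is recorded by positions in the sorted list of T. Such a pattern does not
  mention T and has at most m ^ l possible values, which permits a pigeonhole argument over all
  dense m-sets.\<close>

lemma dense_subgraph_has_closed_walk:
  assumes T: "finite T" "card T = m" and E: "\<And>e. e \<in> E \<Longrightarrow> e \<subseteq> T \<and> card e = 3"
    and dense: "tdc * real m ^ 3 < 6 * real (card E)"
    and l: "2 * walk_bound \<le> l" "\<not> 3 dvd l"
  obtains \<pi> where "set \<pi> \<subseteq> {..<m}" "length \<pi> = l"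
    "\<And>i. i < l \<Longrightarrow> {sorted_list_of_set T ! (\<pi> ! i), sorted_list_of_set T ! (\<pi> ! ((i + 1) mod l)),
        sorted_list_of_set T ! (\<pi> ! ((i + 2) mod l))} \<in> E"
proof -
  let ?R = "\<lambda>a b c. {a, b, c} \<in> E"
  have finE: "finite E" by (rule finite_subset[of _ "Pow T"]) (use E T in auto)
  have tri: "tri T ?R"
    unfolding tri_def
  proof (intro allI impI)
    fix a b c assume abc: "{a, b, c} \<in> E"
    then have "card {a, b, c} = 3" "a \<in> T" using E by auto
    moreover from this have "a \<noteq> b" by (auto simp: card_insert_if split: if_splits)
    ultimately show "{b, a, c} \<in> E \<and> {a, c, b} \<in> E \<and> a \<noteq> b \<and> a \<in> T"
      using abc by (simp add: insert_commute)
  qed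
  have "triples ?R = 6 * card E" by (rule triples_of_edges[OF finE]) (use E in blast)
  then have "\<not> walk_free walk_bound ?R"
    using triples_bound[OF T(1) tri] dense T(2) by auto
  then obtain w :: "nat \<Rightarrow> 'a" where w: "\<And>i. i < l \<Longrightarrow> {w i, w ((i + 1) mod l), w ((i + 2) mod l)} \<in> E"
    using closed_walk_of_length[OF tri _ l] by blast
  define xs where "xs = sorted_list_of_set T"
  have xs: "set xs = T" "length xs = m" using T unfolding xs_def by auto
  have "\<exists>k<m. xs ! k = w i" if "i < l" for i
  proof -
    have "w i \<in> set xs" using E[OF w[OF that]] xs by auto
    then show ?thesis using xs(2) by (simp add: in_set_conv_nth)
  qed
  then obtain k where k: "\<And>i. i < l \<Longrightarrow> k i < m \<and> xs ! k i = w i" by metis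
  show ?thesis
  proof (rule that[of "map k [0..<l]"])
    show "set (map k [0..<l]) \<subseteq> {..<m}" using k by auto
    fix i assume i: "i < l"
    then have "(i + 1) mod l < l" "(i + 2) mod l < l" by auto
    then show "{sorted_list_of_set T ! (map k [0..<l] ! i), sorted_list_of_set T ! (map k [0..<l] ! ((i + 1) mod l)),
        sorted_list_of_set T ! (map k [0..<l] ! ((i + 2) mod l))} \<in> E"
      using w[OF i] k i unfolding xs_def by simp
  qed simp
qed

text \<open>By double counting, a positive proportion of the m-sets is dense enough for
  \<open>triples_bound\<close>, and many of these share one pattern \<pi>. The partite lemma yields
  m classes of l vertices such that every choice of one vertex per class realises \<pi>. The cycle
  takes its i-th vertex from class \<open>\<pi> ! i\<close>; size l leaves room for distinct
  vertices although classes are revisited.\<close>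

lemma dense_contains_tight_cycle:
  assumes eps: "0 < \<epsilon>" and l: "2 * walk_bound \<le> l" "\<not> 3 dvd l"
  obtains n0 where "\<And>G :: nat hypergraph. three_graph G \<Longrightarrow> n0 \<le> card (fst G) \<Longrightarrow>
    (tdc + \<epsilon>) * real (card (fst G) choose 3) \<le> real (card (snd G)) \<Longrightarrow> contains_copy G (tight_cycle l)"
proof -
  have l3: "3 \<le> l" using l(1) unfolding walk_bound_def by simp
  define c where "c = tdc + \<epsilon> / 2"
  have c: "0 < c" using eps tdc_bounds unfolding c_def by simp
  \<comment> \<open>6 * (m choose 3) is at least m^3 - 3 * m^2, and this choice makes the loss 3 * c
    * m^2 smaller than the surplus \<epsilon> / 2 * m^3.\<close>
  obtain m0 :: nat where m0: "6 * c < real m0 * \<epsilon>" using reals_Archimedean3[OF eps] by blast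
  define m where "m = max m0 3"
  have m: "3 \<le> m" "6 * c < real m * \<epsilon>"
  proof -
    have "real m0 * \<epsilon> \<le> real m * \<epsilon>" using eps unfolding m_def by (intro mult_right_mono) auto
    then show "6 * c < real m * \<epsilon>" using m0 by linarith
  qed (simp add: m_def)
  have m_dense: "tdc * real m ^ 3 < 6 * (c * real (m choose 3))"
  proof -
    have "6 * real (m choose 3) = real m * real (m - 1) * real (m - 2)"
      by (metis six_choose_three of_nat_mult of_nat_numeral)
    also have "\<dots> = real m ^ 3 - 3 * real m ^ 2 + 2 * real m"
      using m by (simp add: of_nat_diff power3_eq_cube power2_eq_square algebra_simps)
    finally have six: "6 * real (m choose 3) = real m ^ 3 - 3 * real m ^ 2 + 2 * real m" .
    have "6 * (c * real (m choose 3)) = c * (6 * real (m choose 3))" by simp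
    then have "6 * (c * real (m choose 3)) = c * real m ^ 3 - 3 * c * real m ^ 2 + 2 * c * real m"
      unfolding six by (simp add: algebra_simps)
    moreover have "0 \<le> 2 * c * real m" using c by simp
    moreover have "6 * c * real m ^ 2 < real m * \<epsilon> * real m ^ 2"
      using m by (intro mult_strict_right_mono) auto
    then have "3 * c * real m ^ 2 < \<epsilon> / 2 * real m ^ 3" by (simp add: power3_eq_cube power2_eq_square algebra_simps)
    ultimately show ?thesis unfolding c_def by (simp add: algebra_simps)
  qed
  \<comment> \<open>At least \<epsilon> / 2 * (N / m)^m dense sets are distributed over m^l
    patterns.\<close>
  define \<delta> where "\<delta> = \<epsilon> / 2 / real m ^ m / real m ^ l"
  have \<delta>: "0 < \<delta>" using eps m unfolding \<delta>_def by simp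
  from partite_subsystem[of l \<delta> m] \<delta> l3 obtain n1 where n1: "\<forall>V X. finite V \<longrightarrow> n1 \<le> card V \<longrightarrow>
    X \<subseteq> {xs. set xs \<subseteq> V \<and> length xs = m} \<longrightarrow> \<delta> * real (card V) ^ m \<le> real (card X) \<longrightarrow>
    (\<exists>S. length S = m \<and> (\<forall>s\<in>set S. s \<subseteq> (V :: nat set) \<and> card s = l) \<and> (\<forall>xs. list_all2 (\<in>) xs S \<longrightarrow> xs \<in> X))"
    by auto
  show ?thesis
  proof (rule that[of "max n1 m"])
    fix G :: "nat hypergraph"
    assume G: "three_graph G" and n: "max n1 m \<le> card (fst G)"
      and dense: "(tdc + \<epsilon>) * real (card (fst G) choose 3) \<le> real (card (snd G))"
    obtain V E where GE: "G = (V, E)" by (cases G)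
    have V: "finite V" and E: "\<And>e. e \<in> E \<Longrightarrow> e \<subseteq> V \<and> card e = 3"
      using G unfolding GE three_graph_def by auto
    have finE: "finite E" using finite_edges[OF G] GE by simp
    define N where "N = card V"
    have N: "n1 \<le> N" "m \<le> N" using n unfolding N_def GE by auto
    define TT where "TT = {T. T \<subseteq> V \<and> card T = m}"
    have TT: "finite TT" "card TT = N choose m" using V n_subsets[OF V] unfolding TT_def N_def by auto
    define ET where "ET = (\<lambda>T. {e \<in> E. e \<subseteq> T})"
    define \<D> where "\<D> = {T \<in> TT. c * real (m choose 3) \<le> real (card (ET T))}"
    have \<D>: "finite \<D>" "\<D> \<subseteq> TT" using TT unfolding \<D>_def by auto
    have "(\<Sum>T\<in>TT. card (ET T)) = (\<Sum>e\<in>E. (N - 3) choose (m - 3))"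
      unfolding ET_def
    proof (intro sum_multicount_gen ballI)
      fix e assume "e \<in> E"
      from card_supersets[OF V, of e 3 m] E[OF this] m
      show "card {T \<in> TT. e \<subseteq> T} = (N - 3) choose (m - 3)" unfolding TT_def N_def by (simp add: conj_assoc)
    qed (use TT finE in auto)
    then have dc: "(\<Sum>T\<in>TT. real (card (ET T))) = real (card E) * real ((N - 3) choose (m - 3))"
      by (simp flip: of_nat_sum of_nat_mult)
    have cm: "real (N choose m) * real (m choose 3) = real (N choose 3) * real ((N - 3) choose (m - 3))"
      using choose_mult[of 3 m N] m N by (metis of_nat_mult)
    have "(tdc + \<epsilon>) * real (N choose 3) * real ((N - 3) choose (m - 3)) \<le> (\<Sum>T\<in>TT. real (card (ET T)))"
      unfolding dc using dense unfolding GE N_def by (intro mult_right_mono) auto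
    also have "\<dots> \<le> (\<Sum>T\<in>TT. c * real (m choose 3) + of_bool (T \<in> \<D>) * real (m choose 3))"
    proof (rule sum_mono)
      fix T assume T: "T \<in> TT"
      then have "three_graph (T, ET T)" using E V finite_subset[of T V] unfolding three_graph_def ET_def TT_def by auto
      from card_edges_le[OF this] have "real (card (ET T)) \<le> real (m choose 3)" using T unfolding TT_def by auto
      moreover have "0 \<le> c * real (m choose 3)" using c by simp
      ultimately show "real (card (ET T)) \<le> c * real (m choose 3) + of_bool (T \<in> \<D>) * real (m choose 3)"
        using T unfolding \<D>_def by (cases "c * real (m choose 3) \<le> real (card (ET T))") auto
    qed
    also have "\<dots> = real (N choose m) * (c * real (m choose 3)) + real (card \<D>) * real (m choose 3)"
    proof -
      have "TT \<inter> {T. T \<in> \<D>} = \<D>" using \<D> by auto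
      then show ?thesis using TT by (simp add: sum.distrib flip: sum_distrib_right)
    qed
    finally have "(\<epsilon> / 2) * real (N choose m) * real (m choose 3) \<le> real (card \<D>) * real (m choose 3)"
      using cm unfolding c_def by (simp add: algebra_simps)
    moreover have "0 < real (m choose 3)" using m by simp
    ultimately have cD: "(\<epsilon> / 2) * real (N choose m) \<le> real (card \<D>)" using mult_le_cancel_right_pos by blast
    have "(real N / real m) ^ m \<le> real (N choose m)" using binomial_ge_n_over_k_pow_k[OF N(2)] .
    then have "(\<epsilon> / 2) * (real N / real m) ^ m \<le> (\<epsilon> / 2) * real (N choose m)" using eps by (intro mult_left_mono) auto
    with cD have cD': "(\<epsilon> / 2) * (real N / real m) ^ m \<le> real (card \<D>)" by linarith

    define \<Pi>s where "\<Pi>s = {\<pi>. set \<pi> \<subseteq> {..<m} \<and> length \<pi> = l}"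
    have \<Pi>s: "finite \<Pi>s" "card \<Pi>s = m ^ l"
      unfolding \<Pi>s_def using finite_lists_length_eq[of "{..<m}" l] card_lists_length_eq[of "{..<m}" l] by auto
    define X where "X = (\<lambda>\<pi>. {xs. set xs \<subseteq> V \<and> length xs = m \<and>
       (\<forall>i<l. {xs ! (\<pi> ! i), xs ! (\<pi> ! ((i + 1) mod l)), xs ! (\<pi> ! ((i + 2) mod l))} \<in> E)})"
    have finX: "finite (X \<pi>)" for \<pi>
      by (rule finite_subset[OF _ finite_lists_length_eq[OF V, of m]]) (auto simp: X_def)
    have sub: "sorted_list_of_set ` \<D> \<subseteq> (\<Union>\<pi>\<in>\<Pi>s. X \<pi>)"
    proof
      fix xs assume "xs \<in> sorted_list_of_set ` \<D>"
      then obtain T where T: "T \<in> \<D>" "xs = sorted_list_of_set T" by blast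
      then have T': "T \<subseteq> V" "card T = m" "finite T" "c * real (m choose 3) \<le> real (card (ET T))"
        using V finite_subset[of T V] unfolding \<D>_def TT_def by auto
      have "tdc * real m ^ 3 < 6 * real (card (ET T))" using m_dense T'(4) by linarith
      moreover have "e \<subseteq> T \<and> card e = 3" if "e \<in> ET T" for e using that E unfolding ET_def by auto
      ultimately obtain \<pi> where \<pi>: "set \<pi> \<subseteq> {..<m}" "length \<pi> = l"
        "\<And>i. i < l \<Longrightarrow> {xs ! (\<pi> ! i), xs ! (\<pi> ! ((i + 1) mod l)), xs ! (\<pi> ! ((i + 2) mod l))} \<in> ET T"
        using dense_subgraph_has_closed_walk[OF T'(3,2) _ _ l, of "ET T"] unfolding T(2) by blast
      then have "xs \<in> X \<pi>" using T'(1,2,3) unfolding X_def T(2) ET_def by auto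
      moreover have "\<pi> \<in> \<Pi>s" using \<pi> unfolding \<Pi>s_def by blast
      ultimately show "xs \<in> (\<Union>\<pi>\<in>\<Pi>s. X \<pi>)" by blast
    qed
    have "inj_on sorted_list_of_set \<D>"
    proof (rule inj_onI)
      fix S T :: "nat set" assume "S \<in> \<D>" "T \<in> \<D>" and eq: "sorted_list_of_set S = sorted_list_of_set T"
      then have "finite S" "finite T" using V finite_subset unfolding \<D>_def TT_def by auto
      then show "S = T" using eq by (metis set_sorted_list_of_set)
    qed
    then have "card \<D> = card (sorted_list_of_set ` \<D>)" by (simp add: card_image)
    also have "\<dots> \<le> card (\<Union>\<pi>\<in>\<Pi>s. X \<pi>)" using \<Pi>s finX by (intro card_mono sub) auto
    also have "\<dots> \<le> (\<Sum>\<pi>\<in>\<Pi>s. card (X \<pi>))" by (rule card_UN_le[OF \<Pi>s(1)])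
    finally have cDX: "card \<D> \<le> (\<Sum>\<pi>\<in>\<Pi>s. card (X \<pi>))" .
    obtain \<pi> where \<pi>: "\<pi> \<in> \<Pi>s" "\<delta> * real N ^ m \<le> real (card (X \<pi>))"
    proof -
      have "\<exists>\<pi>\<in>\<Pi>s. \<delta> * real N ^ m \<le> real (card (X \<pi>))"
      proof (rule ccontr)
        assume "\<not> ?thesis"
        moreover have "\<Pi>s \<noteq> {}" using \<Pi>s m by (metis card.empty power_eq_0_iff not_numeral_le_zero)
        ultimately have "(\<Sum>\<pi>\<in>\<Pi>s. real (card (X \<pi>))) < (\<Sum>\<pi>\<in>\<Pi>s. \<delta> * real N ^ m)"
          using \<Pi>s by (intro sum_strict_mono) auto
        also have "\<dots> = (\<epsilon> / 2) * (real N / real m) ^ m"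
          using \<Pi>s m unfolding \<delta>_def by (simp add: power_divide)
        finally show False using cD' of_nat_mono[OF cDX, where 'a = real] by simp
      qed
      with that show ?thesis by blast
    qed
    have "X \<pi> \<subseteq> {xs. set xs \<subseteq> V \<and> length xs = m}" unfolding X_def by auto
    with n1[rule_format, OF V, of "X \<pi>"] N(1) \<pi>(2)
    have "\<exists>S. length S = m \<and> (\<forall>s\<in>set S. s \<subseteq> V \<and> card s = l) \<and> (\<forall>xs. list_all2 (\<in>) xs S \<longrightarrow> xs \<in> X \<pi>)"
      unfolding N_def by simp
    then obtain S where S: "length S = m" "\<And>s. s \<in> set S \<Longrightarrow> s \<subseteq> V \<and> card s = l"
      "\<And>xs. list_all2 (\<in>) xs S \<Longrightarrow> xs \<in> X \<pi>" by auto
    have \<pi>_lt: "\<pi> ! i < m" if "i < l" for i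
    proof -
      have "\<pi> ! i \<in> set \<pi>" using \<pi>(1) that unfolding \<Pi>s_def by simp
      then show ?thesis using \<pi>(1) unfolding \<Pi>s_def by blast
    qed
    have Sn: "S ! k \<subseteq> V \<and> card (S ! k) = l" if "k < m" for k using S that by auto
    have "\<exists>v. inj_on v {..<l} \<and> (\<forall>i<l. v i \<in> S ! (\<pi> ! i))"
    proof (rule distinct_representatives)
      fix i assume "i < l"
      then show "finite (S ! (\<pi> ! i)) \<and> l \<le> card (S ! (\<pi> ! i))"
        using Sn[OF \<pi>_lt] V finite_subset by fastforce
    qed
    then obtain v where v: "inj_on v {..<l}" "\<And>i. i < l \<Longrightarrow> v i \<in> S ! (\<pi> ! i)" by blast
    have "\<exists>x. x \<in> S ! k" if "k < m" for k using Sn[OF that] l3 by (metis all_not_in_conv card.empty not_numeral_le_zero)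
    then obtain x0 where x0: "\<And>k. k < m \<Longrightarrow> x0 k \<in> S ! k" by metis
    define xs0 where "xs0 = map x0 [0..<m]"
    have xs0: "length xs0 = m" "\<And>k. k < m \<Longrightarrow> xs0 ! k \<in> S ! k" using x0 unfolding xs0_def by auto
    have "xs0 \<in> X \<pi>" by (intro S(3) list_all2_memI) (use xs0 S(1) in auto)
    \<comment> \<open>An edge involves three classes only, which differ because \<open>xs0\<close>
      already realises an edge there. Overwriting these three entries of \<open>xs0\<close> gives
      another choice of one vertex per class.\<close>
    have edge: "{v i, v ((i + 1) mod l), v ((i + 2) mod l)} \<in> E" if i: "i < l" for i
    proof -
      define j where "j = (i + 1) mod l"
      define k where "k = (i + 2) mod l"
      have jk: "j < l" "k < l" using i unfolding j_def k_def by auto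
      have "{xs0 ! (\<pi> ! i), xs0 ! (\<pi> ! j), xs0 ! (\<pi> ! k)} \<in> E"
        using \<open>xs0 \<in> X \<pi>\<close> i unfolding X_def j_def k_def by auto
      then have "card {xs0 ! (\<pi> ! i), xs0 ! (\<pi> ! j), xs0 ! (\<pi> ! k)} = 3" using E by blast
      then have ne: "\<pi> ! i \<noteq> \<pi> ! j" "\<pi> ! i \<noteq> \<pi> ! k" "\<pi> ! j \<noteq> \<pi> ! k"
        by (auto simp: card_insert_if split: if_splits)
      define xs where "xs = xs0[\<pi> ! i := v i, \<pi> ! j := v j, \<pi> ! k := v k]"
      have "xs \<in> X \<pi>"
      proof (intro S(3) list_all2_memI)
        show "length xs = length S" using xs0 S(1) unfolding xs_def by simp
        fix r assume "r < length S"
        then show "xs ! r \<in> S ! r"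
          using xs0 S(1) v(2)[OF i] v(2)[OF jk(1)] v(2)[OF jk(2)] \<pi>_lt[OF i] \<pi>_lt[OF jk(1)] \<pi>_lt[OF jk(2)]
          unfolding xs_def by (auto simp: nth_list_update)
      qed
      then have "{xs ! (\<pi> ! i), xs ! (\<pi> ! j), xs ! (\<pi> ! k)} \<in> E" using i unfolding X_def j_def k_def by auto
      moreover have "xs ! (\<pi> ! i) = v i" "xs ! (\<pi> ! j) = v j" "xs ! (\<pi> ! k) = v k"
        using ne xs0(1) \<pi>_lt[OF i] \<pi>_lt[OF jk(1)] \<pi>_lt[OF jk(2)] unfolding xs_def by (auto simp: nth_list_update)
      ultimately show ?thesis unfolding j_def k_def by simp
    qed
    show "contains_copy G (tight_cycle l)"
    proof (rule contains_tight_cycleI[OF l3 v(1)])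
      fix i assume i: "i < l"
      show "v i \<in> fst G" using v(2)[OF i] Sn[OF \<pi>_lt[OF i]] unfolding GE by auto
      show "{v i, v ((i + 1) mod l), v ((i + 2) mod l)} \<in> snd G" using edge[OF i] unfolding GE by simp
    qed
  qed
qed

lemma turan_density_tight_cycle_le:
  assumes l: "2 * walk_bound \<le> l" "\<not> 3 dvd l"
  shows "turan_density (tight_cycle l) \<le> tdc"
proof (rule field_le_epsilon)
  fix \<epsilon> :: real assume eps: "0 < \<epsilon>"
  have l1: "1 \<le> l" using l(1) unfolding walk_bound_def by simp
  obtain n0 where n0: "\<And>G :: nat hypergraph. three_graph G \<Longrightarrow> n0 \<le> card (fst G) \<Longrightarrow>
    (tdc + \<epsilon>) * real (card (fst G) choose 3) \<le> real (card (snd G)) \<Longrightarrow> contains_copy G (tight_cycle l)"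
    using dense_contains_tight_cycle[OF eps l] by blast
  have "real (turan_number n (tight_cycle l)) / real (n choose 3) \<le> tdc + \<epsilon>" if n: "max n0 3 \<le> n" for n
  proof -
    obtain G :: "nat hypergraph" where G: "three_graph G" "card (fst G) = n"
      "\<not> contains_copy G (tight_cycle l)" "card (snd G) = turan_number n (tight_cycle l)"
      using turan_number_attained[OF edges_tight_cycle_nonempty[OF l1]] by blast
    then have "real (turan_number n (tight_cycle l)) < (tdc + \<epsilon>) * real (n choose 3)"
      using n0[of G] n by fastforce
    moreover have "0 < real (n choose 3)" using n by simp
    ultimately show ?thesis by (simp add: field_simps)
  qed
  then have "\<forall>\<^sub>F n in sequentially. real (turan_number n (tight_cycle l)) / real (n choose 3) \<le> tdc + \<epsilon>"
    unfolding eventually_sequentially by blast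
  from tendsto_upperbound[OF turan_density_tendsto[OF edges_tight_cycle_nonempty[OF l1]] this]
  show "turan_density (tight_cycle l) \<le> tdc + \<epsilon>" by simp
qed

section \<open>The lower bound\<close>

text \<open>
  In a copy meeting the new part, every three consecutive vertices contain exactly two new ones,
  so membership in the new part has period 3 as well as period \<open>l\<close>, and is therefore constant.
\<close>

lemma tight_cycle_avoids:
  assumes l: "4 \<le> l" "\<not> 3 dvd l"
    and f: "inj_on f {1..l}" "\<And>e. e \<in> snd (tight_cycle l) \<Longrightarrow> f ` e \<in> E"
    and E: "\<And>e. e \<in> E \<Longrightarrow> e \<inter> A = {} \<or> (\<exists>a a' b. e = {a, a', b} \<and> a \<noteq> a' \<and> a \<in> A \<and> a' \<in> A \<and> b \<notin> A)"
    and x: "x \<in> {1..l}"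
  shows "f x \<notin> A"
proof
  assume fx: "f x \<in> A"
  \<comment> \<open>An l-periodic sequence indexed from 0, so f x is
    \<open>v (x - 1)\<close>.\<close>
  define v where "v = (\<lambda>i. f (i mod l + 1))"
  define \<chi> where "\<chi> = (\<lambda>i. v i \<in> A)"
  have l0: "0 < l" using l by simp
  have edge: "{v i, v (i + 1), v (i + 2)} \<in> E \<and> v i \<noteq> v (i + 1) \<and> v i \<noteq> v (i + 2) \<and> v (i + 1) \<noteq> v (i + 2)" for i
  proof -
    define y where "y = i mod l + 1"
    have y: "y \<in> {1..l}" unfolding y_def using l0 by (simp add: Suc_leI)
    have y1: "y mod l = (i + 1) mod l" "(y + 1) mod l = (i + 2) mod l"
      unfolding y_def by (simp_all add: mod_simps)
    define e where "e = {y, y mod l + 1, (y + 1) mod l + 1}"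
    have e: "e \<in> snd (tight_cycle l)" unfolding tight_cycle_def e_def using y by auto
    have "f ` e = {f y, f (y mod l + 1), f ((y + 1) mod l + 1)}" unfolding e_def by simp
    also have "\<dots> = {v i, v (i + 1), v (i + 2)}" unfolding y1 v_def unfolding y_def ..
    finally have fe: "f ` e = {v i, v (i + 1), v (i + 2)}" .
    have "three_graph (tight_cycle l)" by (rule three_graph_tight_cycle[OF l(1)])
    then have "card e = 3" "e \<subseteq> {1..l}" using e unfolding three_graph_def tight_cycle_def by auto
    then have "card (f ` e) = 3" using card_image[OF inj_on_subset[OF f(1)]] by simp
    then have "v i \<noteq> v (i + 1)" "v i \<noteq> v (i + 2)" "v (i + 1) \<noteq> v (i + 2)"
      unfolding fe by (auto simp: card_insert_if split: if_splits)
    then show ?thesis using f(2)[OF e] unfolding fe by simp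
  qed
  have two: "(\<not> \<chi> i \<and> \<not> \<chi> (i + 1) \<and> \<not> \<chi> (i + 2)) \<or> (\<chi> i \<and> \<chi> (i + 1) \<and> \<not> \<chi> (i + 2))
     \<or> (\<chi> i \<and> \<not> \<chi> (i + 1) \<and> \<chi> (i + 2)) \<or> (\<not> \<chi> i \<and> \<chi> (i + 1) \<and> \<chi> (i + 2))" for i
  proof -
    note e = edge[of i]
    from E[OF conjunct1[OF e]] show ?thesis
    proof
      assume "{v i, v (i + 1), v (i + 2)} \<inter> A = {}"
      then show ?thesis unfolding \<chi>_def by auto
    next
      assume "\<exists>a a' b. {v i, v (i + 1), v (i + 2)} = {a, a', b} \<and> a \<noteq> a' \<and> a \<in> A \<and> a' \<in> A \<and> b \<notin> A"
      then obtain a a' b where *: "{v i, v (i + 1), v (i + 2)} = {a, a', b}" "a \<noteq> a'" "a \<in> A" "a' \<in> A" "b \<notin> A" by blast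
      have "a \<in> {v i, v (i + 1), v (i + 2)}" "a' \<in> {v i, v (i + 1), v (i + 2)}" "b \<in> {v i, v (i + 1), v (i + 2)}"
        unfolding *(1) by auto
      moreover have "a \<noteq> b" "a' \<noteq> b" using * by auto
      ultimately show ?thesis using * e unfolding \<chi>_def by auto
    qed
  qed
  \<comment> \<open>A nonempty window of length 3 has exactly two members, so the next one is
    nonempty too; the windows share two positions and so agree on the others.\<close>
  have per3: "\<chi> (i + 3) = \<chi> i" if "\<chi> i \<or> \<chi> (i + 1)" for i
    using two[of i] two[of "i + 1"] that by (auto simp: numeral_3_eq_3)
  have perl: "\<chi> (i + l) = \<chi> i" for i unfolding \<chi>_def v_def by simp
  \<comment> \<open>One of the last two positions of a nonempty window is a member, so the property
    propagates from x.\<close>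
  have active: "\<chi> (i + (x - 1)) \<or> \<chi> (i + (x - 1) + 1)" for i
  proof (induction i)
    case 0
    have "(x - 1) mod l = x - 1" using x by auto
    then show ?case using fx x unfolding \<chi>_def v_def by auto
  next
    case (Suc i)
    then show ?case using two[of "i + (x - 1)"] by auto
  qed
  define \<psi> where "\<psi> = (\<lambda>i. \<chi> (i + (x - 1)))"
  have \<psi>3: "\<psi> (i + 3) = \<psi> i" for i
    using per3[OF active[of i]] unfolding \<psi>_def by (simp add: ac_simps)
  have \<psi>3q: "\<psi> (i + 3 * q) = \<psi> i" for i q
  proof (induction q)
    case (Suc q)
    then show ?case using \<psi>3[of "i + 3 * q"] by (simp add: ac_simps)
  qed simp
  have \<psi>l: "\<psi> (i + l) = \<psi> i" for i
    using perl[of "i + (x - 1)"] unfolding \<psi>_def by (simp add: ac_simps)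
  have "\<psi> 1 = \<psi> 0 \<and> \<psi> 2 = \<psi> 0"
  proof -
    define q where "q = l div 3"
    have "l mod 3 = 1 \<or> l mod 3 = 2" using l(2) by presburger
    then have "l = 1 + 3 * q \<or> l = 2 + 3 * q" unfolding q_def by presburger
    then show ?thesis
    proof (elim disjE)
      assume a: "l = 1 + 3 * q"
      have "\<psi> (i + 1) = \<psi> i" for i using \<psi>l[of i] \<psi>3q[of "i + 1" q] unfolding a by (simp add: ac_simps)
      from this[of 0] this[of 1] show ?thesis by (simp add: numeral_2_eq_2)
    next
      assume a: "l = 2 + 3 * q"
      have b: "\<psi> (i + 2) = \<psi> i" for i using \<psi>l[of i] \<psi>3q[of "i + 2" q] unfolding a by (simp add: ac_simps)
      from b[of 0] b[of 1] \<psi>3[of 0] show ?thesis by (simp add: numeral_2_eq_2 numeral_3_eq_3)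
    qed
  qed
  moreover have "\<psi> 0 \<or> \<psi> 1" using active[of 0] unfolding \<psi>_def by (simp add: ac_simps)
  ultimately have "\<psi> 0" "\<psi> 1" "\<psi> 2" by auto
  then show False using two[of "x - 1"] unfolding \<psi>_def by (simp add: ac_simps)
qed

text \<open>One level of the iterated construction: k new vertices, all triples with exactly two of
  them, and an extremal system on the other n - k. By \<open>tight_cycle_avoids\<close> a copy of
  the cycle would lie entirely in the latter.\<close>

lemma turan_number_recursion:
  assumes l: "4 \<le> l" "\<not> 3 dvd l" and k: "k \<le> n"
  shows "(k choose 2) * (n - k) + turan_number (n - k) (tight_cycle l) \<le> turan_number n (tight_cycle l)"
proof -
  have ne: "snd (tight_cycle l) \<noteq> {}" by (rule edges_tight_cycle_nonempty) (use l in simp)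
  obtain G :: "nat hypergraph" where G: "three_graph G" "card (fst G) = n - k"
    "\<not> contains_copy G (tight_cycle l)" "card (snd G) = turan_number (n - k) (tight_cycle l)"
    using turan_number_attained[OF ne] by blast
  obtain V E where GE: "G = (V, E)" by (cases G)
  have V: "finite V" "card V = n - k" and E: "\<And>e. e \<in> E \<Longrightarrow> e \<subseteq> V \<and> card e = 3"
    and cE: "card E = turan_number (n - k) (tight_cycle l)" and finE: "finite E"
    using G finite_edges[OF G(1)] unfolding GE three_graph_def by auto
  \<comment> \<open>Exceeds every old vertex; inserting 0 covers an empty V.\<close>
  define M where "M = Suc (Max (insert 0 V))"
  define A where "A = {M..<M + k}"
  have A: "finite A" "card A = k" unfolding A_def by auto
  have VA: "V \<inter> A = {}"
  proof -
    have "v < M" if "v \<in> V" for v unfolding M_def using V that by (simp add: le_imp_less_Suc)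
    then show ?thesis unfolding A_def by force
  qed
  define F where "F = (\<lambda>(s, b). insert b s) ` ({s. s \<subseteq> A \<and> card s = 2} \<times> V)"
  have "inj_on (\<lambda>(s, b). insert b s) ({s. s \<subseteq> A \<and> card s = 2} \<times> V)"
  proof (rule inj_onI)
    fix x x' assume xx: "x \<in> {s. s \<subseteq> A \<and> card s = 2} \<times> V" "x' \<in> {s. s \<subseteq> A \<and> card s = 2} \<times> V"
      and xeq: "(case x of (s, b) \<Rightarrow> insert b s) = (case x' of (s, b) \<Rightarrow> insert b s)"
    obtain s b s' b' where sb: "x = (s, b)" "x' = (s', b')" by (cases x; cases x')
    have s: "s \<subseteq> A" "s' \<subseteq> A" and b: "b \<in> V" "b' \<in> V" and eq: "insert b s = insert b' s'"
      using xx xeq unfolding sb by auto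
    have "s = insert b s \<inter> A" "s' = insert b' s' \<inter> A" using s b VA by auto
    then have "s = s'" using eq by simp
    moreover have "{b} = insert b s \<inter> V" "{b'} = insert b' s' \<inter> V" using s b VA by auto
    then have "b = b'" using eq by (metis singleton_inject)
    ultimately show "x = x'" unfolding sb by simp
  qed
  then have cF: "card F = (k choose 2) * (n - k)" "finite F"
    unfolding F_def using A V n_subsets[OF A(1), of 2] by (simp_all add: card_image card_cartesian_product)
  have FE: "F \<inter> E = {}"
  proof (rule equals0I)
    fix e assume "e \<in> F \<inter> E"
    then obtain s b where s: "e = insert b s" "s \<subseteq> A" "card s = 2" "e \<subseteq> V" using E unfolding F_def by auto
    then have "s = {}" using VA by auto
    then show False using s by simp
  qed
  have F: "\<exists>a a' b. e = {a, a', b} \<and> a \<noteq> a' \<and> a \<in> A \<and> a' \<in> A \<and> b \<notin> A \<and> b \<in> V" if "e \<in> F" for e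
  proof -
    obtain s b where s: "e = insert b s" "s \<subseteq> A" "card s = 2" "b \<in> V" using \<open>e \<in> F\<close> unfolding F_def by auto
    from s(3) obtain a a' where a: "s = {a, a'}" "a \<noteq> a'" by (auto simp: card_2_iff)
    have "b \<notin> A" using s VA by auto
    moreover have "e = {a, a', b}" using s(1) a(1) by auto
    moreover have "a \<in> A" "a' \<in> A" using s(2) a(1) by auto
    ultimately show ?thesis using a(2) s(4) by blast
  qed
  define G' where "G' = (A \<union> V, E \<union> F)"
  have "e \<subseteq> A \<union> V \<and> card e = 3" if "e \<in> E \<union> F" for e
  proof (cases "e \<in> E")
    case True
    then show ?thesis using E by auto
  next
    case False
    with that have "e \<in> F" by simp
    from F[OF this] obtain a a' b where "e = {a, a', b}" "a \<noteq> a'" "a \<in> A" "a' \<in> A" "b \<notin> A" "b \<in> V"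
      by (elim exE conjE)
    moreover from this have "a \<noteq> b" "a' \<noteq> b" by auto
    ultimately show ?thesis by (simp add: card_insert_if)
  qed
  then have G': "three_graph G'" using A(1) V(1) unfolding three_graph_def G'_def by simp
  have "\<not> contains_copy G' (tight_cycle l)"
  proof
    assume "contains_copy G' (tight_cycle l)"
    then obtain f where f: "inj_on f {1..l}" "f ` {1..l} \<subseteq> A \<union> V" "\<And>e. e \<in> snd (tight_cycle l) \<Longrightarrow> f ` e \<in> E \<union> F"
      unfolding contains_copy_def G'_def by (auto simp: tight_cycle_def)
    have EA: "e \<inter> A = {}" if "e \<in> E" for e using E[OF that] VA by auto
    have "e \<inter> A = {} \<or> (\<exists>a a' b. e = {a, a', b} \<and> a \<noteq> a' \<and> a \<in> A \<and> a' \<in> A \<and> b \<notin> A)" if "e \<in> E \<union> F" for e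
      using that EA[of e] F[of e] by blast
    from tight_cycle_avoids[OF l f(1,3) this] have avoid: "f x \<notin> A" if "x \<in> {1..l}" for x
      using that by blast
    have "f ` e \<in> E" if e: "e \<in> snd (tight_cycle l)" for e
    proof -
      have "e \<subseteq> {1..l}" using three_graph_tight_cycle[OF l(1)] e unfolding three_graph_def tight_cycle_def by auto
      then have "f ` e \<inter> A = {}" using avoid by blast
      then have "f ` e \<notin> F" using F[of "f ` e"] by blast
      then show ?thesis using f(3)[OF e] by blast
    qed
    moreover have "f ` {1..l} \<subseteq> V" using f(2) avoid by blast
    ultimately have "contains_copy G (tight_cycle l)"
      unfolding contains_copy_def GE using f(1) by (intro exI[of _ f]) (auto simp: tight_cycle_def)
    then show False using G(3) by blast
  qed
  moreover have "card (fst G') = n" using A V VA k unfolding G'_def by (simp add: card_Un_disjoint Int_commute)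
  ultimately have "card (snd G') \<le> turan_number n (tight_cycle l)" using turan_number_upper[OF G'] by blast
  moreover have "card (snd G') = (k choose 2) * (n - k) + turan_number (n - k) (tight_cycle l)"
    using cE cF finE FE unfolding G'_def by (simp add: card_Un_disjoint Int_commute)
  ultimately show ?thesis by simp
qed

lemma real_choose_two: "real (n choose 2) = real n * (real n - 1) / 2"
proof (cases n)
  case (Suc m)
  have "2 * (n choose 2) = n * m" using times_binomial_minus1_eq[of 2 n] Suc by simp
  then have "2 * real (n choose 2) = real n * real m" by (metis of_nat_mult of_nat_numeral)
  then show ?thesis using Suc by simp
qed simp

lemma real_choose_three: "real (n choose 3) = real n * (real n - 1) * (real n - 2) / 6"
proof (cases "n \<ge> 2")
  case True
  have "6 * real (n choose 3) = real n * real (n - 1) * real (n - 2)"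
    by (metis six_choose_three of_nat_mult of_nat_numeral)
  then show ?thesis using True by (simp add: of_nat_diff)
next
  case False
  then have "n = 0 \<or> n = 1" by auto
  then show ?thesis by auto
qed

text \<open>With k about \<alpha> * n the recursion gives t \<ge> 3 * \<alpha>^2 * (1 - \<alpha>) +
  t * (1 - \<alpha>)^3 in the limit. For this \<alpha> the square in
  \<open>recursion_identity\<close> vanishes, so \<open>tdc\<close> satisfies the same relation with
  equality.\<close>

lemma turan_density_tight_cycle_ge:
  assumes l: "4 \<le> l" "\<not> 3 dvd l"
  shows "tdc \<le> turan_density (tight_cycle l)"
proof -
  define t where "t = turan_density (tight_cycle l)"
  define \<tau> where "\<tau> = (\<lambda>n. real (turan_number n (tight_cycle l)))"
  define \<alpha> where "\<alpha> = (3 - tdc) / 4"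
  have \<alpha>: "0 < \<alpha>" "\<alpha> < 1" using tdc_bounds unfolding \<alpha>_def by simp_all
  define k where "k = (\<lambda>n. nat \<lfloor>\<alpha> * real n\<rfloor>)"
  have k: "real (k n) \<le> \<alpha> * real n" "\<alpha> * real n - 1 \<le> real (k n)" for n
  proof -
    have "0 \<le> \<lfloor>\<alpha> * real n\<rfloor>" using \<alpha> by simp
    then have "real (k n) = of_int \<lfloor>\<alpha> * real n\<rfloor>" unfolding k_def by simp
    then show "real (k n) \<le> \<alpha> * real n" "\<alpha> * real n - 1 \<le> real (k n)" by linarith+
  qed
  have kn: "k n \<le> n" for n
  proof -
    have "real (k n) \<le> 1 * real n" using k(1)[of n] \<alpha> by (meson less_imp_le mult_right_mono of_nat_0_le_iff order_trans)
    then show ?thesis by simp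
  qed
  have ne: "snd (tight_cycle l) \<noteq> {}" by (rule edges_tight_cycle_nonempty) (use l in simp)
  have lim: "(\<lambda>n. \<tau> n / real (n choose 3)) \<longlonglongrightarrow> t"
    unfolding \<tau>_def t_def by (rule turan_density_tendsto[OF ne])
  define x where "x = (\<lambda>n. real (k n) / real n)"
  define y where "y = (\<lambda>n. 1 / real n)"
  have y0: "y \<longlonglongrightarrow> 0" unfolding y_def by (rule lim_1_over_n)
  have x\<alpha>: "x \<longlonglongrightarrow> \<alpha>"
  proof (rule tendsto_sandwich)
    show "\<forall>\<^sub>F n in sequentially. \<alpha> - y n \<le> x n"
      using eventually_gt_at_top[of 0]
    proof eventually_elim
      case (elim n)
      have "\<alpha> - y n = (\<alpha> * real n - 1) / real n" using elim unfolding y_def by (simp add: field_simps)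
      also have "\<dots> \<le> x n" unfolding x_def by (intro divide_right_mono k(2)) simp
      finally show ?case .
    qed
    show "\<forall>\<^sub>F n in sequentially. x n \<le> \<alpha>"
      using eventually_gt_at_top[of 0]
    proof eventually_elim
      case (elim n)
      have "x n \<le> \<alpha> * real n / real n" unfolding x_def by (intro divide_right_mono k(1)) simp
      then show ?case using elim by simp
    qed
    show "(\<lambda>n. \<alpha> - y n) \<longlonglongrightarrow> \<alpha>" using tendsto_diff[OF tendsto_const y0, of \<alpha>] by simp
  qed simp
  \<comment> \<open>The inner system also grows without bound, so its density has the same limit
    t.\<close>
  have rest: "filterlim (\<lambda>n. n - k n) at_top sequentially"
    unfolding filterlim_at_top
  proof
    fix z :: nat
    obtain m :: nat where m: "real z < real m * (1 - \<alpha>)" using reals_Archimedean3[of "1 - \<alpha>"] \<alpha> by auto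
    show "\<forall>\<^sub>F n in sequentially. z \<le> n - k n"
      using eventually_ge_at_top[of m]
    proof eventually_elim
      case (elim n)
      have "real m * (1 - \<alpha>) \<le> real n * (1 - \<alpha>)" using elim \<alpha> by (intro mult_right_mono) auto
      then have "real z \<le> real n - real (k n)" using m k(1)[of n] by (simp add: algebra_simps)
      then have "real z \<le> real (n - k n)" using kn[of n] by (simp add: of_nat_diff)
      then show ?case by simp
    qed
  qed
  \<comment> \<open>The shares of n choose 3 taken by the new triples and by the triples of the
    inner part, written in k / n and 1 / n so that the limit laws apply.\<close>
  define p where "p = (\<lambda>n. 3 * x n * (x n - y n) * (1 - x n) / ((1 - y n) * (1 - 2 * y n)))"
  define q where "q = (\<lambda>n. (1 - x n) * (1 - x n - y n) * (1 - x n - 2 * y n) / ((1 - y n) * (1 - 2 * y n)))"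
  have "(\<lambda>n. p n + \<tau> (n - k n) / real ((n - k n) choose 3) * q n)
      \<longlonglongrightarrow> 3 * \<alpha> * (\<alpha> - 0) * (1 - \<alpha>) / ((1 - 0) * (1 - 2 * 0))
         + t * ((1 - \<alpha>) * (1 - \<alpha> - 0) * (1 - \<alpha> - 2 * 0) / ((1 - 0) * (1 - 2 * 0)))"
    unfolding p_def q_def
    by (intro tendsto_intros x\<alpha> y0 filterlim_compose[OF lim rest]) auto
  then have limL: "(\<lambda>n. p n + \<tau> (n - k n) / real ((n - k n) choose 3) * q n)
      \<longlonglongrightarrow> 3 * \<alpha> * \<alpha> * (1 - \<alpha>) + t * (1 - \<alpha>) ^ 3"
    by (simp add: power3_eq_cube)
  have ev: "\<forall>\<^sub>F n in sequentially. p n + \<tau> (n - k n) / real ((n - k n) choose 3) * q n \<le> \<tau> n / real (n choose 3)"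
    using eventually_ge_at_top[of 3] rest[unfolded filterlim_at_top, rule_format, of 3]
  proof eventually_elim
    case (elim n)
    define c where "c = real (n choose 3)"
    have n: "3 \<le> real n" using elim by simp
    have c: "0 < c" using elim unfolding c_def by simp
    have c6: "c = real n * (real n - 1) * (real n - 2) / 6" unfolding c_def by (rule real_choose_three)
    have nk: "real (n - k n) = real n - real (k n)" using kn by (simp add: of_nat_diff)
    have xn: "real (k n) = x n * real n" and yn: "y n * real n = 1" using n unfolding x_def y_def by simp_all
    have den: "c = (real n) ^ 3 * ((1 - y n) * (1 - 2 * y n)) / 6"
      unfolding c6 using n unfolding y_def by (simp add: field_simps power3_eq_cube)
    define dd where "dd = (1 - y n) * (1 - 2 * y n)"
    have D: "0 < dd" using n unfolding dd_def y_def by (intro mult_pos_pos) (auto simp: field_simps)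
    have "p n * c = x n * (x n - y n) * (1 - x n) * real n ^ 3 / 2"
      unfolding p_def den dd_def[symmetric] using D by simp
    also have "\<dots> = real (k n choose 2) * real (n - k n)"
      unfolding real_choose_two nk xn using yn by algebra
    finally have pc: "p n * c = real (k n choose 2) * real (n - k n)" .
    have "q n * c = (1 - x n) * (1 - x n - y n) * (1 - x n - 2 * y n) * real n ^ 3 / 6"
      unfolding q_def den dd_def[symmetric] using D by simp
    also have "\<dots> = real ((n - k n) choose 3)"
      unfolding real_choose_three nk xn using yn by algebra
    finally have qc: "q n * c = real ((n - k n) choose 3)" .
    have pos: "0 < real ((n - k n) choose 3)" using elim by simp
    have "(p n + \<tau> (n - k n) / real ((n - k n) choose 3) * q n) * c = p n * c + \<tau> (n - k n) / real ((n - k n) choose 3) * (q n * c)"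
      by (simp add: algebra_simps)
    also have "\<dots> = real (k n choose 2) * real (n - k n) + \<tau> (n - k n)" unfolding pc qc using pos by simp
    also have "\<dots> \<le> \<tau> n"
      using of_nat_mono[OF turan_number_recursion[OF l kn[of n]], where 'a = real] unfolding \<tau>_def by simp
    finally show ?case using c unfolding c_def[symmetric] by (simp add: pos_le_divide_eq)
  qed
  have "3 * \<alpha> * \<alpha> * (1 - \<alpha>) + t * (1 - \<alpha>) ^ 3 \<le> t"
    by (rule tendsto_le[OF _ lim limL ev]) simp
  moreover have "tdc * (1 - (1 - \<alpha>) ^ 3) = 3 * \<alpha> * \<alpha> * (1 - \<alpha>)"
    using recursion_identity[of \<alpha> "1 - \<alpha>"] unfolding \<alpha>_def by simp
  ultimately have "tdc * (1 - (1 - \<alpha>) ^ 3) \<le> t * (1 - (1 - \<alpha>) ^ 3)" by (simp add: algebra_simps)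
  moreover have "(1 - \<alpha>) ^ 3 < 1 ^ 3" using \<alpha> by (intro power_strict_mono) auto
  then have "0 < 1 - (1 - \<alpha>) ^ 3" by simp
  ultimately show ?thesis unfolding t_def by (metis mult_le_cancel_right_pos)
qed

theorem theorem1p3:
  shows "\<exists>l0\<ge>4. \<forall>l\<ge>l0. l mod 3 = 1 \<or> l mod 3 = 2 \<longrightarrow>
           turan_density (tight_cycle l) = 2 * sqrt 3 - 3"
proof (intro exI[of _ "2 * walk_bound"] conjI allI impI)
  show four: "4 \<le> 2 * walk_bound" by (simp add: walk_bound_def)
  fix l assume l: "2 * walk_bound \<le> l" "l mod 3 = 1 \<or> l mod 3 = 2"
  then have "\<not> 3 dvd l" by auto
  then have "turan_density (tight_cycle l) = tdc"
    using turan_density_tight_cycle_le turan_density_tight_cycle_ge l(1) four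
    by (meson antisym order_trans)
  then show "turan_density (tight_cycle l) = 2 * sqrt 3 - 3" by (simp add: tdc_def)
qed

end
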